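(* Let $0<p,q<\infty$ and $n\in\mathbb{N}$, and let $\omega$ be a radial weight. Then $\omega\in\widehat{\mathcal{D}}$ if and only if there exists a constant $C=C(p,q,n,\omega)>0$ such that $$\|f^{(n)}(1-|\cdot|)^n\|_{L^q_p(\omega)}+\sum_{j=0}^{n-1}|f^{(j)}(0)|\le C\|f\|_{AL^q_p(\omega)},\quad f\in\mathcal{H}(\mathbb{D}).$$ Similarly, $\omega\in\widehat{\mathcal{D}}$ if and only if there exists a constant $C=C(p,q,n,\omega)>0$ such that $$\|f^{(n)}(1-|\cdot|)^n\|_{T^q_p(\omega)}+\sum_{j=0}^{n-1}|f^{(j)}(0)|\le C\|f\|_{AT^q_p(\omega)},\quad f\in\mathcal{H}(\mathbb{D}).$$
   Context: $\mathbb{D}$ is the open unit disc, $\mathbb{T}=\partial\mathbb{D}$, $\mathcal{H}(\mathbb{D})$ is the space of analytic functions in $\mathbb{D}$, and $dA=\frac{dx\,dy}{\pi}$. A weight is a function $\omega:\mathbb{D}\to[0,\infty)$ integrable over $\mathbb{D}$; it is radial if $\omega(z)=\omega(|z|)$ for all $z\in\mathbb{D}$. Throughout, it is assumed that $\widehat{\omega}(z)=\int_{|z|}^1\omega(s)\,ds>0$ for all $z\in\mathbb{D}$. A radial weight $\omega$ belongs to $\widehat{\mathcal{D}}$ if there exists $C=C(\omega)>0$ such that $\widehat{\omega}(r)\le C\,\widehat{\omega}\left(\frac{1+r}{2}\right)$ as $r\to1^-$ (i.e. for all $r<1$ sufficiently close to $1$). For $\xi\in\overline{\mathbb{D}}$,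 $\Gamma(\xi)=\{z\in\mathbb{D}:|\arg z-\arg\xi|<|\xi|-|z|\}$ (difference of arguments modulo $2\pi$). For $0<p,q<\infty$ and a complex-valued measurable function $f$ on $\mathbb{D}$, $$\|f\|_{L^q_p(\omega)}=\left(\frac1{2\pi}\int_0^{2\pi}\left(\int_0^1|f(re^{i\theta})|^p\omega(r)r\,dr\right)^{q/p}d\theta\right)^{1/q},$$ $$\|f\|_{T^q_p(\omega)}=\left(\int_{\mathbb{T}}\left(\int_{\Gamma(\xi)}|f(z)|^p\omega(z)\frac{dA(z)}{1-|z|}\right)^{q/p}|d\xi|\right)^{1/q},$$ possibly $+\infty$. For $f\in\mathcal{H}(\mathbb{D})$ we write $\|f\|_{AL^q_p(\omega)}=\|f\|_{L^q_p(\omega)}$ and $\|f\|_{AT^q_p(\omega)}=\|f\|_{T^q_p(\omega)}$. $f^{(n)}(1-|\cdot|)^n$ denotes the function $z\mapsto f^{(n)}(z)(1-|z|)^n$. *)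

theory Defs
  imports "HOL-Complex_Analysis.Complex_Analysis"
begin

abbreviation unit_disc :: "complex set" ("\<bbbD>") where
  "\<bbbD> \<equiv> ball 0 1"

text \<open>
  Weights and functions on the disc are total functions on the complex plane;
  their values outside the disc are never used.
\<close>

definition weight :: "(complex \<Rightarrow> real) \<Rightarrow> bool" where
  "weight \<omega> \<longleftrightarrow> (\<forall>z\<in>\<bbbD>. 0 \<le> \<omega> z) \<and> set_integrable lebesgue \<bbbD> \<omega>"

definition radial_weight :: "(complex \<Rightarrow> real) \<Rightarrow> bool" where
  "radial_weight \<omega> \<longleftrightarrow> weight \<omega> \<and> (\<forall>z\<in>\<bbbD>. \<omega> z = \<omega> (of_real (cmod z)))"

text \<open>
  The tail integral is taken in the extended nonnegative reals: integrability of a radial weight over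
  the disc only bounds the integral of \<open>\<omega>(s) s\<close>, so the value at the origin may be infinite.
\<close>

definition weight_hat :: "(complex \<Rightarrow> real) \<Rightarrow> complex \<Rightarrow> ennreal" where
  "weight_hat \<omega> z = (\<integral>\<^sup>+s\<in>{cmod z..<1}. ennreal (\<omega> (of_real s)) \<partial>lebesgue)"

definition D_hat :: "(complex \<Rightarrow> real) set" where
  "D_hat = {\<omega>. radial_weight \<omega> \<and>
     (\<exists>C::real. C > 0 \<and> (\<forall>\<^sub>F r in at_left (1::real).
        weight_hat \<omega> (of_real r) \<le> ennreal C * weight_hat \<omega> (of_real ((1 + r) / 2))))}"

text \<open>
  The difference of arguments is taken modulo \<open>2\<pi>\<close>.  The library convention \<open>Arg 0 = 0\<close> decides
  whether the single point \<open>0\<close> belongs to the region, which no area integral sees.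
\<close>

definition Gamma_region :: "complex \<Rightarrow> complex set" where
  "Gamma_region \<xi> =
     {z\<in>\<bbbD>. \<exists>k::int. \<bar>Arg z - Arg \<xi> - 2 * pi * of_int k\<bar> < cmod \<xi> - cmod z}"

text \<open>Used for \<open>a > 0\<close> only.\<close>

definition ennreal_powr :: "ennreal \<Rightarrow> real \<Rightarrow> ennreal" where
  "ennreal_powr x a = (if x = top then top else ennreal (enn2real x powr a))"

definition L_norm :: "real \<Rightarrow> real \<Rightarrow> (complex \<Rightarrow> real) \<Rightarrow> (complex \<Rightarrow> complex) \<Rightarrow> ennreal" where
  "L_norm p q \<omega> f =
     ennreal_powr
       (ennreal (1 / (2 * pi)) *
        (\<integral>\<^sup>+\<theta>\<in>{0..2 * pi}.
           ennreal_powr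
             (\<integral>\<^sup>+r\<in>{0..<1}. ennreal (cmod (f (of_real r * cis \<theta>)) powr p * \<omega> (of_real r) * r) \<partial>lebesgue)
             (q / p) \<partial>lebesgue))
       (1 / q)"

text \<open>
  The arc length integral over the unit circle is written in the parametrisation \<open>\<xi> = cis \<theta>\<close>;
  the factor \<open>1 / pi\<close> is the normalisation of the area measure.
\<close>

definition T_norm :: "real \<Rightarrow> real \<Rightarrow> (complex \<Rightarrow> real) \<Rightarrow> (complex \<Rightarrow> complex) \<Rightarrow> ennreal" where
  "T_norm p q \<omega> f =
     ennreal_powr
       (\<integral>\<^sup>+\<theta>\<in>{0..2 * pi}.
          ennreal_powr
            (ennreal (1 / pi) *
             (\<integral>\<^sup>+z\<in>Gamma_region (cis \<theta>). ennreal (cmod (f z) powr p * \<omega> z / (1 - cmod z)) \<partial>lebesgue))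
            (q / p) \<partial>lebesgue)
       (1 / q)"

definition weighted_deriv :: "nat \<Rightarrow> (complex \<Rightarrow> complex) \<Rightarrow> complex \<Rightarrow> complex" where
  "weighted_deriv n f = (\<lambda>z. (deriv ^^ n) f z * of_real ((1 - cmod z) ^ n))"

end

theory Submission
  imports Defs
begin

text \<open>
  Write \<open>\<sigma> = \<omega>(r) r dr\<close> and \<open>a = q / p\<close>.  Up to constants, the \<open>q\<close>-th powers of both norms are
  \<open>\<integral> (\<integral> G(r, \<theta>) d\<sigma>(r))\<^sup>a d\<theta>\<close>, where \<open>G(r, \<theta>)\<close> is \<open>|f(r e\<^sup>i\<^sup>\<theta>)|\<^sup>p\<close> or its mean over an arc of length
  comparable to \<open>1 - r\<close>.

  Sufficiency: by Cauchy's estimate \<open>(1 - r)\<^sup>n |f\<^sup>(\<^sup>n\<^sup>)|\<close> at radius \<open>r\<close> is at most a constant times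
  the supremum of \<open>|f|\<close> over a Stolz region truncated at radius \<open>1 - (1 - r) / 2\<close>.  This supremum
  increases with \<open>r\<close>, so the doubling of \<open>\<sigma>\<close> allows to truncate at a radius smaller than \<open>r\<close> instead.
  Since \<open>|f|\<^sup>s\<close> is dominated by the Poisson integral of its values on the single circle of radius
  \<open>r\<close>, the truncated supremum is at most \<open>M(|f\<^sub>r|\<^sup>s)\<^sup>1\<^sup>/\<^sup>s\<close> with the Hardy--Littlewood maximal function
  \<open>M\<close>, also after replacing \<open>|f\<^sub>r|\<^sup>p\<close> by its arc means.  What remains is a Fefferman--Stein inequality for
  \<open>s < min p q\<close>: for \<open>q \<ge> p\<close> it follows by duality from a weighted maximal inequality, for \<open>q < p\<close> by
  Hoelder's inequality after dividing by the power \<open>1 - a\<close> of the inner integral.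

  Necessity: the monomials \<open>z\<^sup>m\<close> bound the moments of \<open>(m (1 - r))\<^sup>n\<^sup>p d\<sigma>\<close> by those of \<open>\<sigma>\<close>, so the moment of order \<open>m p\<close>
  lives on \<open>1 - r < K / m\<close>; comparing with the mass of \<open>1 - r \<le> 4 K / m\<close> gives doubling.
\<close>

section \<open>Powers of extended nonnegative reals\<close>

text \<open>Doubling compares integrals at r and at (1 + r) / 2 only for increasing integrands, and
  |f(r e^(it))| need not increase with r when t is fixed. Hence the truncated supremum: it is
  increasing in its radius and dominates the derivative. The price is that it must be returned to
  the values of f on the very circle of radius r. As the norms integrate in r before the power a is
  taken, a maximal theorem for a single function of t is not enough, and all constants must be
  uniform in r. The power s enters because M is not bounded on L^1, whereas (M g^\<tau>)^(1/\<tau>)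
  with \<tau> < 1 is. A point w with |w| \<le> 2 \<rho> - 1 stays at distance at least 1 - \<rho>
  from the circle of radius \<rho>, so its Poisson kernel hardly varies on arcs of length 1 -
  \<rho>; this is why arc means can replace |f|^p and one argument serves both norms. The values
  |f^(j)(0)| are treated by the same inequality, as integrands constant in r and t.\<close>

notation ennreal_powr (infixr \<open>powe\<close> 80)

lemma powe_top [simp]: "top powe a = top"
  by (simp add: ennreal_powr_def)

lemma powe_zero [simp]: "0 powe a = 0"
  by (simp add: ennreal_powr_def)

lemma powe_one [simp]: "1 powe a = 1"
  by (simp add: ennreal_powr_def)

lemma powe_ennreal: "0 \<le> x \<Longrightarrow> ennreal x powe a = ennreal (x powr a)"
  by (simp add: ennreal_powr_def)

lemma powe_one_right [simp]: "x powe 1 = x"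
  by (cases x) (auto simp: powe_ennreal)

lemma powe_mono: "x \<le> y \<Longrightarrow> 0 \<le> a \<Longrightarrow> x powe a \<le> y powe a"
  by (cases x; cases y) (auto simp: powe_ennreal top_unique intro!: powr_mono2)

lemma powe_mult: "0 < a \<Longrightarrow> (x * y) powe a = x powe a * y powe a"
proof -
  assume a: "0 < a"
  consider "x = 0" | "y = 0" | "x \<noteq> 0" "y \<noteq> 0" "x = top \<or> y = top"
    | r s where "x = ennreal r" "y = ennreal s" "0 \<le> r" "0 \<le> s"
    by (cases x; cases y) auto
  then show ?thesis
  proof cases
    case 3
    then have "x powe a \<noteq> 0" "y powe a \<noteq> 0"
      by (cases x; cases y; auto simp: powe_ennreal)+
    with 3 show ?thesis by (auto simp: ennreal_mult_top ennreal_top_mult)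
  next
    case 4
    then show ?thesis
      by (simp add: powe_ennreal powr_mult flip: ennreal_mult)
  qed auto
qed

lemma powe_powe: "(x powe a) powe b = x powe (a * b)"
  by (cases x) (auto simp: powe_ennreal powr_powr)

text \<open>Valid for exponents of either sign, because \<open>powe\<close> fixes 0 and
  \<open>top\<close> whatever the exponent. A negative power is therefore a reciprocal only at
  arguments other than 0 and \<open>top\<close>; a.e. finiteness has to be shown before
  dividing.\<close>

lemma powe_add: "x powe (a + b) = x powe a * x powe b"
  by (cases x) (auto simp: powe_ennreal powr_add ennreal_mult)

lemma powe_eq_top_iff [simp]: "x powe a = top \<longleftrightarrow> x = top"
  by (cases x) (auto simp: powe_ennreal)

lemma powe_less_top_iff [simp]: "x powe a < top \<longleftrightarrow> x < top"
  by (cases x) (auto simp: powe_ennreal)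

lemma powe_eq_0_iff [simp]: "x powe a = 0 \<longleftrightarrow> x = 0"
  by (cases x) (auto simp: powe_ennreal ennreal_eq_0_iff)

lemma powe_le_iff: "0 < a \<Longrightarrow> x powe a \<le> y powe a \<longleftrightarrow> x \<le> y"
  using powe_mono[of x y a] powe_mono[of "x powe a" "y powe a" "1/a"]
  by (auto simp: powe_powe)

lemma powe_less_iff: "0 < a \<Longrightarrow> x powe a < y powe a \<longleftrightarrow> x < y"
  using powe_le_iff[of a y x] by (simp add: not_le[symmetric])

lemma powe_measurable [measurable]:
  assumes [measurable]: "f \<in> borel_measurable M"
  shows "(\<lambda>x. f x powe a) \<in> borel_measurable M"
proof -
  have [measurable]: "(\<lambda>x::real. x powr a) \<in> borel_measurable borel"
    by (intro powr_real_measurable) auto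
  show ?thesis unfolding ennreal_powr_def by measurable
qed

text \<open>The identity (r + s)^a = r (r + s)^(a-1) + s (r + s)^(a-1) reduces the claim to the
  monotonicity of u^(a-1).\<close>

lemma powe_subadditive:
  assumes "0 < a" "a \<le> 1"
  shows "(x + y) powe a \<le> x powe a + y powe a"
proof (cases "x = top \<or> y = top \<or> x = 0 \<or> y = 0")
  case False
  then obtain r s where rs: "x = ennreal r" "y = ennreal s" "0 < r" "0 < s"
    by (cases x; cases y) (auto simp: order_less_le)
  have *: "u * (r + s) powr (a - 1) \<le> u powr a" if "0 < u" "u \<le> r + s" for u
  proof -
    have "(r + s) powr (a - 1) \<le> u powr (a - 1)"
      using that assms by (intro powr_mono2') auto
    then have "u * (r + s) powr (a - 1) \<le> u * u powr (a - 1)"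
      using that by (intro mult_left_mono) auto
    then show ?thesis using that by (simp add: powr_mult_base)
  qed
  have "(r + s) powr a = r * (r + s) powr (a - 1) + s * (r + s) powr (a - 1)"
    using rs powr_mult_base[of "r + s" "a - 1"] by (simp add: distrib_right)
  also have "\<dots> \<le> r powr a + s powr a"
    using *[of r] *[of s] rs by simp
  finally show ?thesis
    using rs by (simp add: powe_ennreal flip: ennreal_plus)
qed (use assms in \<open>auto simp: \<close>)

text \<open>For a > 0 the power is an order isomorphism with inverse exponent 1 / a, hence commutes
  with suprema.\<close>

lemma powe_SUP:
  fixes f :: "'i \<Rightarrow> ennreal"
  assumes a: "0 < a"
  shows "(SUP i\<in>I. f i) powe a = (SUP i\<in>I. f i powe a)"
proof (rule antisym)
  show "(SUP i\<in>I. f i powe a) \<le> (SUP i\<in>I. f i) powe a"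
    using a by (intro SUP_least powe_mono SUP_upper) auto
  have "f i \<le> (SUP i\<in>I. f i powe a) powe (1/a)" if "i \<in> I" for i
  proof -
    have "f i = (f i powe a) powe (1/a)" using a by (simp add: powe_powe)
    also have "\<dots> \<le> (SUP i\<in>I. f i powe a) powe (1/a)"
      using a that by (intro powe_mono SUP_upper) auto
    finally show ?thesis .
  qed
  then have "(SUP i\<in>I. f i) \<le> (SUP i\<in>I. f i powe a) powe (1/a)" by (rule SUP_least)
  then have "(SUP i\<in>I. f i) powe a \<le> ((SUP i\<in>I. f i powe a) powe (1/a)) powe a"
    using a by (intro powe_mono) auto
  then show "(SUP i\<in>I. f i) powe a \<le> (SUP i\<in>I. f i powe a)" using a by (simp add: powe_powe)
qed

lemma Young_powe:
  assumes "0 < \<alpha>" "0 < \<beta>" "\<alpha> + \<beta> = 1"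
  shows "x powe \<alpha> * y powe \<beta> \<le> ennreal \<alpha> * x + ennreal \<beta> * y"
proof (cases "x = 0 \<or> y = 0 \<or> x = top \<or> y = top")
  case True
  then show ?thesis using assms by (auto simp: ennreal_mult_top)
next
  case False
  then obtain r s where rs: "x = ennreal r" "y = ennreal s" "0 < r" "0 < s"
    by (cases x; cases y) (auto simp: order_less_le)
  then show ?thesis
    using Youngs_inequality_0[of \<alpha> \<beta> r s] assms
    by (simp add: powe_ennreal flip: ennreal_mult ennreal_plus)
qed

text \<open>The exponents sit on the integrands and add up to 1, so the pairs a, 1 - a and 1/a, 1 -
  1/a used later are both direct instances.\<close>

lemma nn_integral_Hoelder:
  assumes [measurable]: "f \<in> borel_measurable M" "g \<in> borel_measurable M"
    and ab: "0 < \<alpha>" "0 < \<beta>" "\<alpha> + \<beta> = 1"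
  shows "(\<integral>\<^sup>+x. f x powe \<alpha> * g x powe \<beta> \<partial>M) \<le> (\<integral>\<^sup>+x. f x \<partial>M) powe \<alpha> * (\<integral>\<^sup>+x. g x \<partial>M) powe \<beta>"
proof -
  define A where "A = (\<integral>\<^sup>+x. f x \<partial>M)"
  define B where "B = (\<integral>\<^sup>+x. g x \<partial>M)"
  consider "A = 0" | "B = 0" | "A \<noteq> 0" "B \<noteq> 0" "A = top \<or> B = top"
    | r s where "A = ennreal r" "B = ennreal s" "0 < r" "0 < s"
    by (cases A; cases B) (auto simp: order_less_le)
  then show ?thesis
  proof cases
    case 1
    then have "AE x in M. f x = 0" unfolding A_def by (subst (asm) nn_integral_0_iff_AE) auto
    then have "(\<integral>\<^sup>+x. f x powe \<alpha> * g x powe \<beta> \<partial>M) = 0"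
      by (subst nn_integral_0_iff_AE) auto
    then show ?thesis by simp
  next
    case 2
    then have "AE x in M. g x = 0" unfolding B_def by (subst (asm) nn_integral_0_iff_AE) auto
    then have "(\<integral>\<^sup>+x. f x powe \<alpha> * g x powe \<beta> \<partial>M) = 0"
      by (subst nn_integral_0_iff_AE) auto
    then show ?thesis by simp
  next
    case 3
    then have "A powe \<alpha> * B powe \<beta> = top"
      by (auto simp: ennreal_mult_top ennreal_top_mult)
    then show ?thesis by (simp add: A_def B_def)
  next
    case 4
    have eq: "x = ennreal c * (ennreal (1/c) * x)" if "0 < c" for x c
      using that by (simp flip: mult.assoc ennreal_mult)
    \<comment> \<open>Young's inequality is applied to f / A and g / B, whose integrals are 1; the
      bracket then integrates to \<alpha> + \<beta> = 1.\<close>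
    have pt: "f x powe \<alpha> * g x powe \<beta>
       \<le> A powe \<alpha> * B powe \<beta> * (ennreal \<alpha> * (ennreal (1/r) * f x) + ennreal \<beta> * (ennreal (1/s) * g x))" for x
    proof -
      have "f x powe \<alpha> * g x powe \<beta> = (A * (ennreal (1/r) * f x)) powe \<alpha> * (B * (ennreal (1/s) * g x)) powe \<beta>"
        using eq[of r "f x"] eq[of s "g x"] 4 by simp
      also have "\<dots> = A powe \<alpha> * B powe \<beta> * ((ennreal (1/r) * f x) powe \<alpha> * (ennreal (1/s) * g x) powe \<beta>)"
        using ab by (simp add: powe_mult[of _ A] powe_mult[of _ B] ac_simps)
      also have "\<dots> \<le> A powe \<alpha> * B powe \<beta> * (ennreal \<alpha> * (ennreal (1/r) * f x) + ennreal \<beta> * (ennreal (1/s) * g x))"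
        using ab by (intro mult_left_mono Young_powe) auto
      finally show ?thesis .
    qed
    have "(\<integral>\<^sup>+x. f x powe \<alpha> * g x powe \<beta> \<partial>M)
       \<le> (\<integral>\<^sup>+x. A powe \<alpha> * B powe \<beta> * (ennreal \<alpha> * (ennreal (1/r) * f x) + ennreal \<beta> * (ennreal (1/s) * g x)) \<partial>M)"
      by (intro nn_integral_mono pt)
    also have "\<dots> = A powe \<alpha> * B powe \<beta> * (ennreal \<alpha> * (ennreal (1/r) * A) + ennreal \<beta> * (ennreal (1/s) * B))"
      by (simp add: nn_integral_cmult nn_integral_add A_def B_def)
    also have "ennreal \<alpha> * (ennreal (1/r) * A) + ennreal \<beta> * (ennreal (1/s) * B) = 1"
      using 4 ab by (simp flip: ennreal_mult ennreal_plus)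
    finally show ?thesis by (simp add: A_def B_def)
  qed
qed

section \<open>Layer-cake formula\<close>

lemma nn_integral_less_eq: "(\<integral>\<^sup>+t. (if ennreal t < y then 1 else 0) * indicator {0..} t \<partial>lborel) = y"
proof (cases y)
  case (real r)
  have "(\<integral>\<^sup>+t. (if ennreal t < y then 1 else 0) * indicator {0..} t \<partial>lborel) = (\<integral>\<^sup>+t. indicator {0..<r} t \<partial>lborel)"
    by (intro nn_integral_cong) (auto simp: real ennreal_less_iff split: split_indicator)
  then show ?thesis using real by simp
next
  case top
  have "(\<integral>\<^sup>+t. (if ennreal t < y then 1 else 0) * indicator {0..} t \<partial>lborel) = (\<integral>\<^sup>+t. indicator {0::real..} t \<partial>lborel)"
    by (intro nn_integral_cong) (auto simp: top split: split_indicator)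
  also have "\<dots> = emeasure lborel {0::real..}" by simp
  also have "\<dots> = top"
  proof (rule top.extremum_uniqueI)
    have "ennreal (real n) \<le> emeasure lborel {0::real..}" for n
    proof -
      have "ennreal (real n) = emeasure lborel {0..real n}" by simp
      also have "\<dots> \<le> emeasure lborel {0::real..}" by (intro emeasure_mono) auto
      finally show ?thesis .
    qed
    then show "top \<le> emeasure lborel {0::real..}"
      by (metis ennreal_SUP_of_nat_eq_top ennreal_of_nat_eq_real_of_nat SUP_least)
  qed
  finally show ?thesis using top by simp
qed

text \<open>Tonelli, after writing \<Phi> x as the length of the set of all t \<ge> 0 below it. The
  factor h is carried along for the weighted maximal inequality; with h = 1 the formula also serves
  the shift under doubling.\<close>

lemma layer_cake:
  assumes "sigma_finite_measure M"
    and [measurable]: "\<Phi> \<in> borel_measurable M" "h \<in> borel_measurable M"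
  shows "(\<integral>\<^sup>+x. \<Phi> x * h x \<partial>M)
    = (\<integral>\<^sup>+t. (\<integral>\<^sup>+x. (if ennreal t < \<Phi> x then h x else 0) \<partial>M) * indicator {0..} t \<partial>lborel)"
proof -
  interpret sigma_finite_measure M by fact
  interpret pair_sigma_finite M lborel ..
  have "(\<integral>\<^sup>+x. \<Phi> x * h x \<partial>M)
     = (\<integral>\<^sup>+x. (\<integral>\<^sup>+t. (if ennreal t < \<Phi> x then h x else 0) * indicator {0..} t \<partial>lborel) \<partial>M)"
  proof (intro nn_integral_cong)
    fix x
    have "\<Phi> x * h x = (\<integral>\<^sup>+t. ((if ennreal t < \<Phi> x then 1 else 0) * indicator {0..} t) * h x \<partial>lborel)"
      by (subst nn_integral_multc) (auto simp: nn_integral_less_eq)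
    also have "\<dots> = (\<integral>\<^sup>+t. (if ennreal t < \<Phi> x then h x else 0) * indicator {0..} t \<partial>lborel)"
      by (intro nn_integral_cong) (auto simp: mult.commute)
    finally show "\<Phi> x * h x = \<dots>" .
  qed
  also have "\<dots> = (\<integral>\<^sup>+t. (\<integral>\<^sup>+x. (if ennreal t < \<Phi> x then h x else 0) * indicator {0..} t \<partial>M) \<partial>lborel)"
    by (rule Fubini'[symmetric]) measurable
  also have "\<dots> = (\<integral>\<^sup>+t. (\<integral>\<^sup>+x. (if ennreal t < \<Phi> x then h x else 0) \<partial>M) * indicator {0..} t \<partial>lborel)"
    by (intro nn_integral_cong nn_integral_multc) measurable
  finally show ?thesis .
qed

section \<open>The Hardy--Littlewood maximal function\<close>

text \<open>Only radii 2^k are used: the supremum over k is then countable and measurability, also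
  jointly in a parameter, is immediate. Passing from a radius to the next power of two at most
  doubles it.\<close>

definition ball_mean :: "(real \<Rightarrow> ennreal) \<Rightarrow> int \<Rightarrow> real \<Rightarrow> ennreal" where
  "ball_mean g k x = ennreal (1 / (2 * 2 powr k)) * (\<integral>\<^sup>+y\<in>ball x (2 powr k). g y \<partial>lborel)"

definition hl_max :: "(real \<Rightarrow> ennreal) \<Rightarrow> real \<Rightarrow> ennreal" where
  "hl_max g x = (SUP k. ball_mean g k x)"

lemma sets_borel_ball [measurable]: "ball (x::real) R \<in> sets borel"
  by simp

lemma emeasure_ball_real: "0 \<le> R \<Longrightarrow> emeasure lborel (ball (x::real) R) = ennreal (2 * R)"
  by (simp add: ball_eq_greaterThanLessThan)

text \<open>Joint measurability is what Fubini needs in the vector-valued inequality, where the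
  radius r is the parameter.\<close>

lemma ball_mean_measurable_param:
  assumes [measurable]: "case_prod G \<in> borel_measurable (N \<Otimes>\<^sub>M borel)"
  shows "(\<lambda>(r, x). ball_mean (G r) k x) \<in> borel_measurable (N \<Otimes>\<^sub>M borel)"
proof -
  have "(\<lambda>(p, y). G (fst p) y * indicator (ball (snd p) (2 powr k)) y)
      \<in> borel_measurable ((N \<Otimes>\<^sub>M borel) \<Otimes>\<^sub>M lborel)"
    unfolding indicator_def mem_ball by measurable
  then show ?thesis
    unfolding ball_mean_def case_prod_beta
    by (intro borel_measurable_times_ennreal borel_measurable_const)
       (rule lborel.borel_measurable_nn_integral, simp add: case_prod_beta)
qed

lemma hl_max_measurable_param:
  assumes "case_prod G \<in> borel_measurable (N \<Otimes>\<^sub>M borel)"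
  shows "(\<lambda>(r, x). hl_max (G r) x) \<in> borel_measurable (N \<Otimes>\<^sub>M borel)"
  unfolding hl_max_def case_prod_beta
  by (intro borel_measurable_SUP ball_mean_measurable_param[OF assms, unfolded case_prod_beta]) auto

lemma ball_mean_measurable [measurable]:
  assumes [measurable]: "g \<in> borel_measurable borel"
  shows "ball_mean g k \<in> borel_measurable borel"
proof -
  have "(\<lambda>(r::unit, x). ball_mean g k x) \<in> borel_measurable (count_space UNIV \<Otimes>\<^sub>M borel)"
    by (rule ball_mean_measurable_param) measurable
  from measurable_compose[OF measurable_Pair1'[of "()"] this] show ?thesis by simp
qed

lemma hl_max_measurable [measurable]:
  assumes [measurable]: "g \<in> borel_measurable borel"
  shows "hl_max g \<in> borel_measurable borel"
  unfolding hl_max_def by measurable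

lemma ball_mean_le_hl_max: "ball_mean g k x \<le> hl_max g x"
  unfolding hl_max_def by (rule SUP_upper) simp

lemma hl_max_mono_AE:
  assumes "AE y in lborel. f y \<le> g y"
  shows "hl_max f x \<le> hl_max g x"
  unfolding hl_max_def ball_mean_def
  using assms by (intro SUP_mono' mult_left_mono nn_integral_mono_AE) (auto split: split_indicator)

lemma hl_max_cong_AE:
  assumes "AE y in lborel. f y = g y"
  shows "hl_max f x = hl_max g x"
  using assms by (intro antisym hl_max_mono_AE) auto

lemma less_hl_max_iff: "c < hl_max g x \<longleftrightarrow> (\<exists>k. c < ball_mean g k x)"
  by (simp add: hl_max_def less_SUP_iff)

lemma ball_mean_const: "ball_mean (\<lambda>_. c) k x = c"
proof -
  have "ball_mean (\<lambda>_. c) k x = ennreal (1 / (2 * 2 powr k)) * (c * ennreal (2 * 2 powr k))"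
    unfolding ball_mean_def by (subst nn_integral_cmult) (auto simp: emeasure_ball_real intro: borel_measurable_indicator)
  also have "\<dots> = c * ennreal (1 / (2 * 2 powr k) * (2 * 2 powr k))"
    by (subst ennreal_mult) (auto simp: ac_simps)
  finally show ?thesis by simp
qed

lemma ball_mean_add:
  assumes [measurable]: "f \<in> borel_measurable borel" "g \<in> borel_measurable borel"
  shows "ball_mean (\<lambda>y. f y + g y) k x = ball_mean f k x + ball_mean g k x"
  unfolding ball_mean_def distrib_right distrib_left[symmetric]
  by (subst nn_integral_add) auto

lemma hl_max_const: "hl_max (\<lambda>_. c) x = c"
  by (simp add: hl_max_def ball_mean_const)

section \<open>Weighted weak-type and strong-type inequalities\<close>

text \<open>For every y in \<open>ball x R\<close> the ball \<open>ball x (5 * R)\<close> lies in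
  \<open>ball y (8 * R)\<close>, so \<open>hl_max h\<close> is at least H / (16 R) on the small
  ball, while g has mass at least 2 R l there. The constant 8 is the ratio of the lengths 16 R and 2
  R; among the dyadic radii, 8 R is the first one beyond 6 R.\<close>

lemma vitali_ball_estimate:
  assumes [measurable]: "g \<in> borel_measurable borel" "h \<in> borel_measurable borel"
    and l: "0 < l" and k: "ennreal l < ball_mean g k x"
  shows "ennreal l * (\<integral>\<^sup>+y. h y * indicator (ball x (5 * 2 powr k)) y \<partial>lborel)
     \<le> 8 * (\<integral>\<^sup>+y. g y * hl_max h y * indicator (ball x (2 powr k)) y \<partial>lborel)"
proof -
  define R :: real where "R = 2 powr k"
  have R: "0 < R" "2 powr (k + 3) = 8 * R"
    by (auto simp: R_def powr_add)
  define H where "H = (\<integral>\<^sup>+y. h y * indicator (ball x (5 * R)) y \<partial>lborel)"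
  have low: "ennreal (1 / (16 * R)) * H \<le> hl_max h y" if "y \<in> ball x R" for y
  proof -
    have "ball x (5 * R) \<subseteq> ball y (8 * R)"
      using that R by (auto simp: dist_real_def)
    then have "ennreal (1 / (16 * R)) * H \<le> ball_mean h (k + 3) y"
      unfolding H_def ball_mean_def
      using R by (auto intro!: mult_left_mono nn_integral_mono split: split_indicator)
    also have "\<dots> \<le> hl_max h y" by (rule ball_mean_le_hl_max)
    finally show ?thesis .
  qed
  have "ennreal l * ennreal (2 * R) \<le> ball_mean g k x * ennreal (2 * R)"
    using k by (intro mult_right_mono) auto
  also have "\<dots> = ennreal (2 * R * (1 / (2 * R))) * (\<integral>\<^sup>+y. g y * indicator (ball x R) y \<partial>lborel)"
    unfolding ball_mean_def R_def[symmetric] using R by (subst ennreal_mult) (auto simp: ac_simps)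
  finally have g: "ennreal (l * (2 * R)) \<le> (\<integral>\<^sup>+y. g y * indicator (ball x R) y \<partial>lborel)"
    using R l by (simp flip: ennreal_mult)
  have "ennreal l * H = 8 * (ennreal (l * (2 * R)) * (ennreal (1 / (16 * R)) * H))"
  proof -
    have "ennreal l = ennreal (8 * (l * (2 * R)) * (1 / (16 * R)))"
      using R by simp
    also have "\<dots> = ennreal (8 * (l * (2 * R))) * ennreal (1 / (16 * R))"
      using R l by (intro ennreal_mult) auto
    also have "ennreal (8 * (l * (2 * R))) = ennreal 8 * ennreal (l * (2 * R))"
      using R l by (intro ennreal_mult) auto
    also have "ennreal 8 = 8" by simp
    finally show ?thesis by (simp add: ac_simps)
  qed
  also have "\<dots> \<le> 8 * ((\<integral>\<^sup>+y. g y * indicator (ball x R) y \<partial>lborel) * (ennreal (1 / (16 * R)) * H))"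
    by (intro mult_left_mono mult_right_mono g) auto
  also have "\<dots> = 8 * (\<integral>\<^sup>+y. g y * indicator (ball x R) y * (ennreal (1 / (16 * R)) * H) \<partial>lborel)"
    by (subst nn_integral_multc) auto
  also have "\<dots> \<le> 8 * (\<integral>\<^sup>+y. g y * hl_max h y * indicator (ball x R) y \<partial>lborel)"
    using low by (intro mult_left_mono nn_integral_mono) (auto split: split_indicator intro: mult_left_mono)
  finally show ?thesis by (simp add: H_def R_def)
qed

text \<open>Vitali's covering lemma: the selected balls are disjoint while their fivefold
  enlargements cover the level set, and the estimate for one ball is summed over them. The covering
  lemma asks for bounded radii, hence the bound K.\<close>

lemma weighted_weak_type_truncated:
  assumes [measurable]: "g \<in> borel_measurable borel" "h \<in> borel_measurable borel"
    and l: "0 < l"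
  shows "ennreal l * (\<integral>\<^sup>+x. (if \<exists>k\<le>K. ennreal l < ball_mean g k x then h x else 0) \<partial>lborel)
     \<le> 8 * (\<integral>\<^sup>+x. g x * hl_max h x \<partial>lborel)"
proof -
  define E where "E = {x. \<exists>k\<le>K. ennreal l < ball_mean g k x}"
  have "\<forall>x\<in>E. \<exists>k\<le>K. ennreal l < ball_mean g k x" by (auto simp: E_def)
  then obtain k where k: "\<And>x. x \<in> E \<Longrightarrow> k x \<le> K" "\<And>x. x \<in> E \<Longrightarrow> ennreal l < ball_mean g (k x) x"
    by metis
  define r where "r x = (2::real) powr k x" for x
  have r: "0 < r x" for x by (simp add: r_def)
  have "E \<subseteq> (\<Union>x\<in>E. ball x (r x))" using r by force
  moreover have "0 < r x \<and> r x \<le> 2 powr K" if "x \<in> E" for x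
    using k(1)[OF that] by (simp add: r_def)
  ultimately obtain C where C: "countable C" "C \<subseteq> E"
     "pairwise (\<lambda>i j. disjnt (ball i (r i)) (ball j (r j))) C"
     "E \<subseteq> (\<Union>i\<in>C. ball i (5 * r i))"
    by (rule Vitali_covering_lemma_balls)
  \<comment> \<open>Sums over the countable family are written as integrals over
    \<open>count_space C\<close>, so that they can be exchanged with the integral in x.\<close>
  have cover: "(if \<exists>k\<le>K. ennreal l < ball_mean g k x then h x else 0)
      \<le> (\<integral>\<^sup>+i. h x * indicator (ball i (5 * r i)) x \<partial>count_space C)" for x
  proof (cases "x \<in> E")
    case True
    then obtain i where i: "i \<in> C" "x \<in> ball i (5 * r i)" using C(4) by auto
    have "h x = (\<integral>\<^sup>+j. h x * indicator {i} j \<partial>count_space C)"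
      using i by (simp add: nn_integral_cmult_indicator)
    also have "\<dots> \<le> (\<integral>\<^sup>+i. h x * indicator (ball i (5 * r i)) x \<partial>count_space C)"
      using i by (intro nn_integral_mono) (auto split: split_indicator)
    finally show ?thesis by auto
  qed (auto simp: E_def)
  have disj: "(\<integral>\<^sup>+i. g x * hl_max h x * indicator (ball i (r i)) x \<partial>count_space C) \<le> g x * hl_max h x" for x
  proof (cases "\<exists>i\<in>C. x \<in> ball i (r i)")
    case True
    then obtain i where i: "i \<in> C" "x \<in> ball i (r i)" by auto
    have *: "j = i" if "j \<in> C" "x \<in> ball j (r j)" for j
      using C(3) i that unfolding pairwise_def disjnt_def by blast
    have "(\<integral>\<^sup>+i. g x * hl_max h x * indicator (ball i (r i)) x \<partial>count_space C)
      \<le> (\<integral>\<^sup>+j. g x * hl_max h x * indicator {i} j \<partial>count_space C)"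
    proof (intro nn_integral_mono)
      fix j assume "j \<in> space (count_space C)"
      with * show "g x * hl_max h x * indicator (ball j (r j)) x \<le> g x * hl_max h x * indicator {i} j"
        by (cases "x \<in> ball j (r j)") simp_all
    qed
    also have "\<dots> = g x * hl_max h x" using i by (simp add: nn_integral_cmult_indicator)
    finally show ?thesis .
  next
    case False
    then have "(\<integral>\<^sup>+i. g x * hl_max h x * indicator (ball i (r i)) x \<partial>count_space C) = (\<integral>\<^sup>+i. 0 \<partial>count_space C)"
      by (intro nn_integral_cong) auto
    then show ?thesis by simp
  qed
  have "ennreal l * (\<integral>\<^sup>+x. (if \<exists>k\<le>K. ennreal l < ball_mean g k x then h x else 0) \<partial>lborel)
    \<le> ennreal l * (\<integral>\<^sup>+x. (\<integral>\<^sup>+i. h x * indicator (ball i (5 * r i)) x \<partial>count_space C) \<partial>lborel)"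
    by (intro mult_left_mono nn_integral_mono cover) auto
  also have "\<dots> = ennreal l * (\<integral>\<^sup>+i. (\<integral>\<^sup>+x. h x * indicator (ball i (5 * r i)) x \<partial>lborel) \<partial>count_space C)"
    using C(1) by (subst nn_integral_count_space_nn_integral) auto
  also have "\<dots> = (\<integral>\<^sup>+i. ennreal l * (\<integral>\<^sup>+x. h x * indicator (ball i (5 * r i)) x \<partial>lborel) \<partial>count_space C)"
    by (simp add: nn_integral_cmult)
  also have "\<dots> \<le> (\<integral>\<^sup>+i. 8 * (\<integral>\<^sup>+x. g x * hl_max h x * indicator (ball i (r i)) x \<partial>lborel) \<partial>count_space C)"
    using C(2) k(2) l unfolding r_def by (intro nn_integral_mono vitali_ball_estimate) auto
  also have "\<dots> = 8 * (\<integral>\<^sup>+i. (\<integral>\<^sup>+x. g x * hl_max h x * indicator (ball i (r i)) x \<partial>lborel) \<partial>count_space C)"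
    by (simp add: nn_integral_cmult)
  also have "\<dots> = 8 * (\<integral>\<^sup>+x. (\<integral>\<^sup>+i. g x * hl_max h x * indicator (ball i (r i)) x \<partial>count_space C) \<partial>lborel)"
    using C(1) by (subst nn_integral_count_space_nn_integral) auto
  also have "\<dots> \<le> 8 * (\<integral>\<^sup>+x. g x * hl_max h x \<partial>lborel)"
    by (intro mult_left_mono nn_integral_mono disj) auto
  finally show ?thesis .
qed

text \<open>The level sets for radii up to 2^n increase to the full one, so monotone convergence
  removes the bound on the radii.\<close>

lemma weighted_weak_type:
  assumes [measurable]: "g \<in> borel_measurable borel" "h \<in> borel_measurable borel"
    and l: "0 < l"
  shows "ennreal l * (\<integral>\<^sup>+x. (if ennreal l < hl_max g x then h x else 0) \<partial>lborel)
     \<le> 8 * (\<integral>\<^sup>+x. g x * hl_max h x \<partial>lborel)"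
proof -
  define F where "F n x = (if \<exists>k\<le>int n. ennreal l < ball_mean g k x then h x else 0)" for n x
  have [measurable]: "F n \<in> borel_measurable borel" for n
    unfolding F_def by measurable
  have sup: "(if ennreal l < hl_max g x then h x else 0) = (SUP n. F n x)" for x
  proof (cases "ennreal l < hl_max g x")
    case True
    then obtain k where k: "ennreal l < ball_mean g k x" by (auto simp: less_hl_max_iff)
    have "h x \<le> F (nat k) x" using k by (auto simp: F_def intro!: exI[of _ k])
    also have "\<dots> \<le> (SUP n. F n x)" by (rule SUP_upper) simp
    finally have "h x \<le> (SUP n. F n x)" .
    moreover have "(SUP n. F n x) \<le> h x" by (rule SUP_least) (auto simp: F_def)
    ultimately show ?thesis using True by auto
  next
    case False
    then have "F n x = 0" for n by (auto simp: F_def less_hl_max_iff)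
    then show ?thesis using False by simp
  qed
  have inc: "incseq F"
    by (auto simp: incseq_def le_fun_def F_def intro: order_trans)
  have "(\<integral>\<^sup>+x. (if ennreal l < hl_max g x then h x else 0) \<partial>lborel) = (SUP n. \<integral>\<^sup>+x. F n x \<partial>lborel)"
    unfolding sup by (rule nn_integral_monotone_convergence_SUP[OF inc]) simp
  then have "ennreal l * (\<integral>\<^sup>+x. (if ennreal l < hl_max g x then h x else 0) \<partial>lborel)
     = (SUP n. ennreal l * (\<integral>\<^sup>+x. F n x \<partial>lborel))"
    by (simp add: SUP_mult_left_ennreal)
  also have "\<dots> \<le> 8 * (\<integral>\<^sup>+x. g x * hl_max h x \<partial>lborel)"
    unfolding F_def by (intro SUP_least weighted_weak_type_truncated) (use l in auto)
  finally show ?thesis .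
qed

lemma nn_integral_powr_below:
  assumes "0 < c" "c < 1"
  shows "(\<integral>\<^sup>+t. (if ennreal t < X then ennreal (t powr - c) else 0) * indicator {0..} t \<partial>lborel)
    \<le> ennreal (1 / (1 - c)) * X powe (1 - c)"
proof (cases X)
  case (real x)
  have "((\<lambda>t. t powr - c) has_integral x powr (- c + 1) / (- c + 1)) {0..x}"
    using assms real by (intro has_integral_powr_from_0) auto
  then have *: "(\<integral>\<^sup>+t. ennreal (t powr - c) * indicator {0..x} t \<partial>lborel) = ennreal (x powr (- c + 1) / (- c + 1))"
    by (intro nn_integral_has_integral_lebesgue') auto
  have "(\<integral>\<^sup>+t. (if ennreal t < X then ennreal (t powr - c) else 0) * indicator {0..} t \<partial>lborel)
     \<le> (\<integral>\<^sup>+t. ennreal (t powr - c) * indicator {0..x} t \<partial>lborel)"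
    by (intro nn_integral_mono) (auto simp: real ennreal_less_iff split: split_indicator)
  also have "\<dots> = ennreal (1 / (1 - c)) * X powe (1 - c)"
    unfolding * using assms real by (simp add: powe_ennreal flip: ennreal_mult)
  finally show ?thesis .
next
  case top
  then show ?thesis using assms by (simp add: ennreal_mult_top)
qed

text \<open>Marcinkiewicz truncation at l = t^(1/b): the part of g that is at most l / 2 contributes
  at most l / 2 to every mean, so where \<open>hl_max g\<close> exceeds l the maximal function of
  the rest exceeds l / 2. The weak type at level l / 2 gives the factor 8 * 2 / l.\<close>

lemma weighted_level_set_bound:
  assumes [measurable]: "g \<in> borel_measurable borel" "h \<in> borel_measurable borel"
    and b: "1 < b" and t: "0 < t"
  shows "(\<integral>\<^sup>+x. (if ennreal t < hl_max g x powe b then h x else 0) \<partial>lborel)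
    \<le> ennreal (16 * t powr - (1 / b)) * (\<integral>\<^sup>+x. (if ennreal t < (2 * g x) powe b then g x * hl_max h x else 0) \<partial>lborel)"
proof -
  define l where "l = t powr (1 / b)"
  have l: "0 < l" "l powr b = t" using t b by (auto simp: l_def powr_powr)
  have tl: "ennreal t < y powe b \<longleftrightarrow> ennreal l < y" for y
    using powe_less_iff[of b "ennreal l" y] l b by (simp add: powe_ennreal)
  define g1 where "g1 y = (if ennreal l < 2 * g y then g y else 0)" for y
  have [measurable]: "g1 \<in> borel_measurable borel" unfolding g1_def by measurable
  have split: "g y \<le> g1 y + ennreal (l / 2)" for y
  proof (cases "ennreal l < 2 * g y")
    case False
    have "g y = ennreal (1 / 2 * 2) * g y" by simp
    also have "\<dots> = ennreal (1 / 2) * (2 * g y)"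
      by (subst ennreal_mult) (auto simp: ac_simps)
    also have "\<dots> \<le> ennreal (1 / 2) * ennreal l"
      using False by (intro mult_left_mono) auto
    also have "\<dots> = ennreal (l / 2)"
      using l by (subst ennreal_mult[symmetric]) auto
    finally show ?thesis by (simp add: g1_def False)
  qed (simp add: g1_def)
  have level: "ennreal (l / 2) < hl_max g1 x" if "ennreal l < hl_max g x" for x
  proof -
    from that obtain k where k: "ennreal l < ball_mean g k x" unfolding less_hl_max_iff by blast
    have "ball_mean g k x \<le> ball_mean (\<lambda>y. g1 y + ennreal (l / 2)) k x"
      unfolding ball_mean_def by (intro mult_left_mono nn_integral_mono mult_right_mono split) auto
    also have "\<dots> = ball_mean g1 k x + ennreal (l / 2)"
      by (subst ball_mean_add) (auto simp: ball_mean_const)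
    finally have "ennreal (l / 2) + ennreal (l / 2) < ball_mean g1 k x + ennreal (l / 2)"
      using k l by (simp flip: ennreal_plus)
    then have "ennreal (l / 2) < ball_mean g1 k x"
      by (meson add_right_mono leD leI)
    then show ?thesis by (auto simp: less_hl_max_iff)
  qed
  have "(\<integral>\<^sup>+x. (if ennreal t < hl_max g x powe b then h x else 0) \<partial>lborel)
     \<le> (\<integral>\<^sup>+x. (if ennreal (l / 2) < hl_max g1 x then h x else 0) \<partial>lborel)"
    using level by (intro nn_integral_mono) (auto simp: tl)
  also have "\<dots> = ennreal (2 / l) * (ennreal (l / 2) * (\<integral>\<^sup>+x. (if ennreal (l / 2) < hl_max g1 x then h x else 0) \<partial>lborel))"
    using l by (simp flip: mult.assoc ennreal_mult)
  also have "\<dots> \<le> ennreal (2 / l) * (8 * (\<integral>\<^sup>+x. g1 x * hl_max h x \<partial>lborel))"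
    using l by (intro mult_left_mono weighted_weak_type) auto
  also have "\<dots> = ennreal (2 / l) * ennreal 8 * (\<integral>\<^sup>+x. g1 x * hl_max h x \<partial>lborel)"
    by (simp add: mult.assoc)
  also have "ennreal (2 / l) * ennreal 8 = ennreal (16 * t powr - (1 / b))"
    using l by (subst ennreal_mult[symmetric]) (auto simp: l_def powr_minus divide_inverse)
  also have "(\<lambda>x. g1 x * hl_max h x) = (\<lambda>x. if ennreal t < (2 * g x) powe b then g x * hl_max h x else 0)"
    by (auto simp: g1_def tl)
  finally show ?thesis .
qed

text \<open>The scalar Fefferman--Stein inequality, by integrating the level-set bounds in t. As 1 /
  b < 1, t^(-1/b) is integrable at 0, and its integral up to (2 g)^b supplies the missing power
  g^(b-1).\<close>

lemma weighted_strong_type_obtain: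
  assumes b: "1 < b"
  obtains C :: real where "0 < C"
    "\<And>g h. g \<in> borel_measurable borel \<Longrightarrow> h \<in> borel_measurable borel \<Longrightarrow>
       (\<integral>\<^sup>+x. hl_max g x powe b * h x \<partial>lborel) \<le> ennreal C * (\<integral>\<^sup>+x. g x powe b * hl_max h x \<partial>lborel)"
proof
  define c where "c = 1 / b"
  have c: "0 < c" "c < 1" "b * (1 - c) = b - 1" using b by (auto simp: c_def field_simps)
  define C where "C = 16 * (1 / (1 - c)) * 2 powr (b - 1)"
  show "0 < C" using c by (simp add: C_def)
  fix g h :: "real \<Rightarrow> ennreal"
  assume [measurable]: "g \<in> borel_measurable borel" "h \<in> borel_measurable borel"
  have inner: "(\<integral>\<^sup>+t. ennreal (16 * t powr - c) * (if ennreal t < (2 * g x) powe b then g x * hl_max h x else 0) * indicator {0..} t \<partial>lborel)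
      \<le> ennreal C * (g x powe b * hl_max h x)" for x
  proof -
    have "(\<integral>\<^sup>+t. ennreal (16 * t powr - c) * (if ennreal t < (2 * g x) powe b then g x * hl_max h x else 0) * indicator {0..} t \<partial>lborel)
       = (\<integral>\<^sup>+t. 16 * (g x * hl_max h x) * ((if ennreal t < (2 * g x) powe b then ennreal (t powr - c) else 0) * indicator {0..} t) \<partial>lborel)"
      by (intro nn_integral_cong) (auto simp: ennreal_mult ac_simps)
    also have "\<dots> = 16 * (g x * hl_max h x) * (\<integral>\<^sup>+t. (if ennreal t < (2 * g x) powe b then ennreal (t powr - c) else 0) * indicator {0..} t \<partial>lborel)"
      by (intro nn_integral_cmult) measurable
    also have "\<dots> \<le> 16 * (g x * hl_max h x) * (ennreal (1 / (1 - c)) * ((2 * g x) powe b) powe (1 - c))"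
      by (intro mult_left_mono nn_integral_powr_below c) auto
    also have "((2 * g x) powe b) powe (1 - c) = ennreal (2 powr (b - 1)) * g x powe (b - 1)"
      using b c powe_ennreal[of 2 "b - 1"] by (simp add: powe_powe powe_mult)
    also have "16 * (g x * hl_max h x) * (ennreal (1 / (1 - c)) * (ennreal (2 powr (b - 1)) * g x powe (b - 1)))
       = (ennreal 16 * ennreal (1 / (1 - c)) * ennreal (2 powr (b - 1))) * ((g x powe 1 * g x powe (b - 1)) * hl_max h x)"
      by (simp add: ac_simps)
    also have "g x powe 1 * g x powe (b - 1) = g x powe b"
      using powe_add[of "g x" 1 "b - 1"] by simp
    also have "ennreal 16 * ennreal (1 / (1 - c)) * ennreal (2 powr (b - 1)) = ennreal C"
    proof -
      have "ennreal C = ennreal (16 * (1 / (1 - c))) * ennreal (2 powr (b - 1))"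
        unfolding C_def using c by (intro ennreal_mult) auto
      also have "ennreal (16 * (1 / (1 - c))) = ennreal 16 * ennreal (1 / (1 - c))"
        using c by (intro ennreal_mult) auto
      finally show ?thesis by simp
    qed
    finally show ?thesis .
  qed
  have "(\<integral>\<^sup>+x. hl_max g x powe b * h x \<partial>lborel)
     = (\<integral>\<^sup>+t. (\<integral>\<^sup>+x. (if ennreal t < hl_max g x powe b then h x else 0) \<partial>lborel) * indicator {0..} t \<partial>lborel)"
    by (rule layer_cake[OF sigma_finite_lborel]) measurable
  also have "\<dots> \<le> (\<integral>\<^sup>+t. ennreal (16 * t powr - c) * (\<integral>\<^sup>+x. (if ennreal t < (2 * g x) powe b then g x * hl_max h x else 0) \<partial>lborel) * indicator {0..} t \<partial>lborel)"
  \<comment> \<open>The level t = 0 is discarded: \<open>0 powr - c\<close> is 0, so the right-hand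
    side would vanish there.\<close>
  proof (intro nn_integral_mono_AE eventually_mono[OF AE_lborel_singleton[of 0]])
    fix t :: real assume "t \<noteq> 0"
    then show "(\<integral>\<^sup>+x. (if ennreal t < hl_max g x powe b then h x else 0) \<partial>lborel) * indicator {0..} t
      \<le> ennreal (16 * t powr - c) * (\<integral>\<^sup>+x. (if ennreal t < (2 * g x) powe b then g x * hl_max h x else 0) \<partial>lborel) * indicator {0..} t"
      unfolding c_def using weighted_level_set_bound[of g h b t] b by (auto split: split_indicator)
  qed
  also have "\<dots> = (\<integral>\<^sup>+t. (\<integral>\<^sup>+x. ennreal (16 * t powr - c) * (if ennreal t < (2 * g x) powe b then g x * hl_max h x else 0) * indicator {0..} t \<partial>lborel) \<partial>lborel)"
    by (intro nn_integral_cong) (simp add: nn_integral_cmult nn_integral_multc)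
  also have "\<dots> = (\<integral>\<^sup>+x. (\<integral>\<^sup>+t. ennreal (16 * t powr - c) * (if ennreal t < (2 * g x) powe b then g x * hl_max h x else 0) * indicator {0..} t \<partial>lborel) \<partial>lborel)"
    by (rule lborel_pair.Fubini') measurable
  also have "\<dots> \<le> (\<integral>\<^sup>+x. ennreal C * (g x powe b * hl_max h x) \<partial>lborel)"
    by (intro nn_integral_mono inner)
  also have "\<dots> = ennreal C * (\<integral>\<^sup>+x. g x powe b * hl_max h x \<partial>lborel)"
    by (intro nn_integral_cmult) measurable
  finally show "(\<integral>\<^sup>+x. hl_max g x powe b * h x \<partial>lborel) \<le> \<dots>" .
qed

section \<open>Maximal operators built from small powers\<close>

text \<open>Averaging the power \<tau> < 1 gives strong bounds down to L^1, where
  \<open>hl_max\<close> itself has only a weak one.\<close>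

definition max_pow :: "real \<Rightarrow> (real \<Rightarrow> ennreal) \<Rightarrow> real \<Rightarrow> ennreal" where
  "max_pow \<tau> g x = hl_max (\<lambda>y. g y powe \<tau>) x powe (1 / \<tau>)"

lemma max_pow_measurable_param:
  assumes [measurable]: "case_prod G \<in> borel_measurable (N \<Otimes>\<^sub>M borel)"
  shows "(\<lambda>(r, x). max_pow \<tau> (G r) x) \<in> borel_measurable (N \<Otimes>\<^sub>M borel)"
proof -
  have "(\<lambda>(r, x). hl_max (\<lambda>y. G r y powe \<tau>) x) \<in> borel_measurable (N \<Otimes>\<^sub>M borel)"
    by (rule hl_max_measurable_param) measurable
  then show ?thesis unfolding max_pow_def case_prod_beta by measurable
qed

lemma max_pow_measurable [measurable]:
  "g \<in> borel_measurable borel \<Longrightarrow> max_pow \<tau> g \<in> borel_measurable borel"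
  unfolding max_pow_def by measurable

lemma max_pow_weighted_obtain:
  assumes "0 < \<tau>" "\<tau> < 1"
  obtains C :: real where "0 < C"
    "\<And>g h. g \<in> borel_measurable borel \<Longrightarrow> h \<in> borel_measurable borel \<Longrightarrow>
       (\<integral>\<^sup>+x. max_pow \<tau> g x * h x \<partial>lborel) \<le> ennreal C * (\<integral>\<^sup>+x. g x * hl_max h x \<partial>lborel)"
proof -
  obtain C :: real where C: "0 < C"
    "\<And>g h. g \<in> borel_measurable borel \<Longrightarrow> h \<in> borel_measurable borel \<Longrightarrow>
       (\<integral>\<^sup>+x. hl_max g x powe (1/\<tau>) * h x \<partial>lborel) \<le> ennreal C * (\<integral>\<^sup>+x. g x powe (1/\<tau>) * hl_max h x \<partial>lborel)"
    using weighted_strong_type_obtain[of "1/\<tau>"] assms by auto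
  show ?thesis
  proof (rule that[OF C(1)])
    fix g h :: "real \<Rightarrow> ennreal"
    assume [measurable]: "g \<in> borel_measurable borel" "h \<in> borel_measurable borel"
    show "(\<integral>\<^sup>+x. max_pow \<tau> g x * h x \<partial>lborel) \<le> ennreal C * (\<integral>\<^sup>+x. g x * hl_max h x \<partial>lborel)"
      unfolding max_pow_def using C(2)[of "\<lambda>y. g y powe \<tau>" h] assms by (simp add: powe_powe)
  qed
qed

lemma max_pow_power:
  assumes "0 < \<tau>" "0 < b"
  shows "max_pow \<tau> g x powe b = max_pow (\<tau> / b) (\<lambda>y. g y powe b) x"
  unfolding max_pow_def using assms by (simp add: powe_powe)

text \<open>The weight 1 is its own maximal function, so the weighted inequality becomes an
  unweighted one; the exponent b is absorbed by passing from \<tau> to \<tau> / b.\<close>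

lemma max_pow_strong_obtain:
  assumes "0 < \<tau>" "\<tau> < b"
  obtains C :: real where "0 < C"
    "\<And>g. g \<in> borel_measurable borel \<Longrightarrow>
       (\<integral>\<^sup>+x. max_pow \<tau> g x powe b \<partial>lborel) \<le> ennreal C * (\<integral>\<^sup>+x. g x powe b \<partial>lborel)"
proof -
  obtain C :: real where C: "0 < C"
    "\<And>g h. g \<in> borel_measurable borel \<Longrightarrow> h \<in> borel_measurable borel \<Longrightarrow>
       (\<integral>\<^sup>+x. max_pow (\<tau> / b) g x * h x \<partial>lborel) \<le> ennreal C * (\<integral>\<^sup>+x. g x * hl_max h x \<partial>lborel)"
    using max_pow_weighted_obtain[of "\<tau> / b"] assms by auto
  show ?thesis
  proof (rule that[OF C(1)])
    fix g :: "real \<Rightarrow> ennreal"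
    assume [measurable]: "g \<in> borel_measurable borel"
    show "(\<integral>\<^sup>+x. max_pow \<tau> g x powe b \<partial>lborel) \<le> ennreal C * (\<integral>\<^sup>+x. g x powe b \<partial>lborel)"
      using C(2)[of "\<lambda>y. g y powe b" "\<lambda>_. 1"] assms by (simp add: max_pow_power hl_max_const)
  qed
qed

text \<open>Cauchy--Schwarz on each ball, at the cost of doubling the order \<tau>. The
  factorisation is asked for only almost everywhere, since it will come from dividing by a function
  that may be infinite on a null set.\<close>

lemma max_pow_mult_le:
  assumes [measurable]: "g1 \<in> borel_measurable borel" "g2 \<in> borel_measurable borel"
    and ae: "AE y in lborel. g y = g1 y * g2 y" and t: "0 < \<tau>"
  shows "max_pow \<tau> g x \<le> max_pow (2 * \<tau>) g1 x * max_pow (2 * \<tau>) g2 x"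
proof -
  let ?M = "\<lambda>f. hl_max (\<lambda>y. f y powe (2 * \<tau>)) x"
  have "hl_max (\<lambda>y. g y powe \<tau>) x = hl_max (\<lambda>y. (g1 y powe (2 * \<tau>)) powe (1/2) * (g2 y powe (2 * \<tau>)) powe (1/2)) x"
    using ae t by (intro hl_max_cong_AE) (auto simp: powe_powe powe_mult)
  also have "\<dots> \<le> ?M g1 powe (1/2) * ?M g2 powe (1/2)"
    unfolding hl_max_def[of "\<lambda>y. (g1 y powe (2 * \<tau>)) powe (1/2) * (g2 y powe (2 * \<tau>)) powe (1/2)"]
  proof (rule SUP_least)
    fix k
    let ?c = "ennreal (1 / (2 * 2 powr real_of_int k))" and ?B = "ball x (2 powr real_of_int k)"
    have "?c = ?c powe (1/2) * ?c powe (1/2)"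
      using powe_add[of ?c "1/2" "1/2"] by simp
    moreover have "(\<integral>\<^sup>+y. (g1 y powe (2 * \<tau>)) powe (1/2) * (g2 y powe (2 * \<tau>)) powe (1/2) * indicator ?B y \<partial>lborel)
      = (\<integral>\<^sup>+y. (g1 y powe (2 * \<tau>) * indicator ?B y) powe (1/2) * (g2 y powe (2 * \<tau>) * indicator ?B y) powe (1/2) \<partial>lborel)"
      by (intro nn_integral_cong) (auto split: split_indicator)
    ultimately have "ball_mean (\<lambda>y. (g1 y powe (2 * \<tau>)) powe (1/2) * (g2 y powe (2 * \<tau>)) powe (1/2)) k x
       = ?c powe (1/2) * ?c powe (1/2) * (\<integral>\<^sup>+y. (g1 y powe (2 * \<tau>) * indicator ?B y) powe (1/2) * (g2 y powe (2 * \<tau>) * indicator ?B y) powe (1/2) \<partial>lborel)"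
      unfolding ball_mean_def by simp
    also have "\<dots> \<le> ?c powe (1/2) * ?c powe (1/2) * ((\<integral>\<^sup>+y. g1 y powe (2 * \<tau>) * indicator ?B y \<partial>lborel) powe (1/2) * (\<integral>\<^sup>+y. g2 y powe (2 * \<tau>) * indicator ?B y \<partial>lborel) powe (1/2))"
      by (intro mult_left_mono nn_integral_Hoelder) auto
    also have "\<dots> = ball_mean (\<lambda>y. g1 y powe (2 * \<tau>)) k x powe (1/2) * ball_mean (\<lambda>y. g2 y powe (2 * \<tau>)) k x powe (1/2)"
      unfolding ball_mean_def by (simp add: powe_mult ac_simps)
    also have "\<dots> \<le> ?M g1 powe (1/2) * ?M g2 powe (1/2)"
      by (intro mult_mono powe_mono ball_mean_le_hl_max) auto
    finally show "ball_mean (\<lambda>y. (g1 y powe (2 * \<tau>)) powe (1/2) * (g2 y powe (2 * \<tau>)) powe (1/2)) k x \<le> \<dots>" .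
  qed
  finally have "hl_max (\<lambda>y. g y powe \<tau>) x powe (1/\<tau>) \<le> (?M g1 powe (1/2) * ?M g2 powe (1/2)) powe (1/\<tau>)"
    using t by (intro powe_mono) auto
  then show ?thesis
    unfolding max_pow_def using t by (simp add: powe_mult powe_powe)
qed

section \<open>A vector-valued maximal inequality\<close>

text \<open>The factors in G = H v are balanced: the integral of H over r is at most (U + e)^a, and
  v to the power a / (1 - a) is (U + e)^a again on W. Hoelder with exponents a and 1 - a therefore
  recombines the two scalar bounds into the first power of the integral of V. The summand e keeps
  the divisor positive, and the finite measure of W makes its contribution disappear as e tends to
  0.\<close>

lemma vector_maximal_small_exponent:
  fixes G :: "'r \<Rightarrow> real \<Rightarrow> ennreal"
  assumes S: "sigma_finite_measure S" and a: "0 < a" "a < 1"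
    and C1: "0 < C1" "\<And>g. g \<in> borel_measurable borel \<Longrightarrow>
       (\<integral>\<^sup>+x. max_pow (2 * \<tau>) g x \<partial>lborel) \<le> ennreal C1 * (\<integral>\<^sup>+x. g x \<partial>lborel)"
    and C2: "0 < C2" "\<And>g. g \<in> borel_measurable borel \<Longrightarrow>
       (\<integral>\<^sup>+x. max_pow (2 * \<tau>) g x powe (a / (1 - a)) \<partial>lborel) \<le> ennreal C2 * (\<integral>\<^sup>+x. g x powe (a / (1 - a)) \<partial>lborel)"
    and t: "0 < \<tau>"
    and [measurable]: "case_prod G \<in> borel_measurable (S \<Otimes>\<^sub>M borel)"
    and W [measurable]: "W \<in> sets borel" and Wfin: "emeasure lborel W < top"
    and GW: "\<And>r y. y \<notin> W \<Longrightarrow> G r y = 0"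
  shows "(\<integral>\<^sup>+x. (\<integral>\<^sup>+r. max_pow \<tau> (G r) x \<partial>S) powe a \<partial>lborel)
    \<le> ennreal (C1 powr a * C2 powr (1 - a)) * (\<integral>\<^sup>+x. (\<integral>\<^sup>+r. G r x \<partial>S) powe a \<partial>lborel)"
proof -
  interpret S: sigma_finite_measure S by fact
  interpret P: pair_sigma_finite S lborel ..
  define U where "U x = (\<integral>\<^sup>+r. G r x \<partial>S)" for x
  have [measurable]: "U \<in> borel_measurable borel" unfolding U_def by measurable
  define X where "X = (\<integral>\<^sup>+x. U x powe a \<partial>lborel)"
  define D where "D = C1 powr a * C2 powr (1 - a)"
  have D: "0 < D" using C1(1) C2(1) by (simp add: D_def)
  define w where "w = measure lborel W"
  have w: "emeasure lborel W = ennreal w" "0 \<le> w"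
    using Wfin by (auto simp: w_def emeasure_eq_ennreal_measure)
  define L where "L = (\<integral>\<^sup>+x. (\<integral>\<^sup>+r. max_pow \<tau> (G r) x \<partial>S) powe a \<partial>lborel)"
  have main: "L \<le> ennreal D * (X + ennreal (e powr a * w))" if Xfin: "X < top" and e: "0 < e" for e
  proof -
    \<comment> \<open>Needed because a negative power of \<open>top\<close> is \<open>top\<close>
      here, so the powers a - 1 and 1 - a are mutually inverse only where U is finite.\<close>
    have aeU: "AE x in lborel. U x \<noteq> top"
    proof -
      have "AE x in lborel. U x powe a \<noteq> \<infinity>"
        using Xfin by (intro nn_integral_noteq_infinite) (auto simp: X_def)
      then show ?thesis by simp
    qed
    define V where "V x = (U x + ennreal e) powe a * indicator W x" for x
    define v where "v x = (U x + ennreal e) powe (1 - a) * indicator W x" for x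
    define H where "H r x = G r x * (U x + ennreal e) powe (a - 1)" for r x
    have [measurable]: "V \<in> borel_measurable borel" "v \<in> borel_measurable borel"
      unfolding V_def v_def by measurable
    have Hm [measurable]: "case_prod H \<in> borel_measurable (S \<Otimes>\<^sub>M borel)"
      unfolding H_def by measurable
    have Hr: "H r \<in> borel_measurable borel" "G r \<in> borel_measurable borel" if "r \<in> space S" for r
      using measurable_compose[OF measurable_Pair1'[OF that], of "case_prod H"]
        measurable_compose[OF measurable_Pair1'[OF that], of "case_prod G"] by auto
    have inv: "(U x + ennreal e) powe (a - 1) * (U x + ennreal e) powe (1 - a) = 1" if "U x \<noteq> top" for x
    proof -
      from that obtain u where u: "U x = ennreal u" "0 \<le> u" by (cases "U x") auto
      then show ?thesis
        using e by (simp add: powe_ennreal flip: ennreal_plus ennreal_mult powr_add)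
    qed
    have split: "AE x in lborel. G r x = H r x * v x" for r
      using aeU
    proof (rule eventually_mono)
      fix x assume "U x \<noteq> top"
      from inv[OF this] show "G r x = H r x * v x"
        by (cases "x \<in> W") (auto simp: H_def v_def GW mult.assoc)
    qed
    have intH: "(\<integral>\<^sup>+r. H r x \<partial>S) \<le> V x" for x
    proof (cases "x \<in> W")
      case True
      have "(\<integral>\<^sup>+r. H r x \<partial>S) = U x * (U x + ennreal e) powe (a - 1)"
        unfolding H_def U_def by (rule nn_integral_multc) measurable
      also have "\<dots> \<le> (U x + ennreal e) * (U x + ennreal e) powe (a - 1)"
        by (intro mult_right_mono) auto
      also have "\<dots> = V x"
        using True powe_add[of "U x + ennreal e" 1 "a - 1"] by (simp add: V_def)
      finally show ?thesis .
    next
      case False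
      then show ?thesis by (simp add: H_def GW)
    qed
    have vV: "v x powe (a / (1 - a)) = V x" for x
      using a by (simp add: v_def V_def powe_powe split: split_indicator)
    have mH [measurable]: "(\<lambda>(r, x). max_pow (2 * \<tau>) (H r) x) \<in> borel_measurable (S \<Otimes>\<^sub>M borel)"
      by (rule max_pow_measurable_param[OF Hm])
    define f where "f x = (\<integral>\<^sup>+r. max_pow (2 * \<tau>) (H r) x \<partial>S)" for x
    define gg where "gg x = max_pow (2 * \<tau>) v x powe (a / (1 - a))" for x
    have [measurable]: "f \<in> borel_measurable borel" "gg \<in> borel_measurable borel"
      unfolding f_def gg_def by measurable
    have pt: "(\<integral>\<^sup>+r. max_pow \<tau> (G r) x \<partial>S) powe a \<le> f x powe a * gg x powe (1 - a)" for x
    proof -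
      have "(\<integral>\<^sup>+r. max_pow \<tau> (G r) x \<partial>S) \<le> (\<integral>\<^sup>+r. max_pow (2 * \<tau>) (H r) x * max_pow (2 * \<tau>) v x \<partial>S)"
        using Hr split t by (intro nn_integral_mono max_pow_mult_le) auto
      also have "\<dots> = f x * max_pow (2 * \<tau>) v x"
        unfolding f_def by (rule nn_integral_multc) measurable
      finally have "(\<integral>\<^sup>+r. max_pow \<tau> (G r) x \<partial>S) powe a \<le> (f x * max_pow (2 * \<tau>) v x) powe a"
        using a by (intro powe_mono) auto
      also have "\<dots> = f x powe a * gg x powe (1 - a)"
        using a by (simp add: powe_mult gg_def powe_powe)
      finally show ?thesis .
    qed
    \<comment> \<open>Here a < 1 enters: the power a is subadditive, so regularising costs only e^a
      times the measure of W.\<close>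
    have intV: "(\<integral>\<^sup>+x. V x \<partial>lborel) \<le> X + ennreal (e powr a * w)"
    proof -
      have "(\<integral>\<^sup>+x. V x \<partial>lborel) \<le> (\<integral>\<^sup>+x. U x powe a + ennreal e powe a * indicator W x \<partial>lborel)"
        unfolding V_def using powe_subadditive[of a _ "ennreal e"] a
        by (intro nn_integral_mono) (auto split: split_indicator)
      also have "\<dots> = X + ennreal e powe a * emeasure lborel W"
        unfolding X_def by (simp add: nn_integral_add nn_integral_cmult_indicator)
      also have "\<dots> = X + ennreal (e powr a * w)"
        using e w by (simp add: powe_ennreal ennreal_mult)
      finally show ?thesis .
    qed
    have "(\<integral>\<^sup>+x. f x \<partial>lborel) = (\<integral>\<^sup>+r. (\<integral>\<^sup>+x. max_pow (2 * \<tau>) (H r) x \<partial>lborel) \<partial>S)"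
      unfolding f_def by (rule P.Fubini') measurable
    also have "\<dots> \<le> (\<integral>\<^sup>+r. ennreal C1 * (\<integral>\<^sup>+x. H r x \<partial>lborel) \<partial>S)"
      by (intro nn_integral_mono C1 Hr)
    also have "\<dots> = ennreal C1 * (\<integral>\<^sup>+r. (\<integral>\<^sup>+x. H r x \<partial>lborel) \<partial>S)"
      by (intro nn_integral_cmult) measurable
    also have "\<dots> = ennreal C1 * (\<integral>\<^sup>+x. (\<integral>\<^sup>+r. H r x \<partial>S) \<partial>lborel)"
      by (subst P.Fubini') auto
    also have "\<dots> \<le> ennreal C1 * (\<integral>\<^sup>+x. V x \<partial>lborel)"
      by (intro mult_left_mono nn_integral_mono intH) auto
    finally have intf: "(\<integral>\<^sup>+x. f x \<partial>lborel) \<le> ennreal C1 * (\<integral>\<^sup>+x. V x \<partial>lborel)" .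
    have intg: "(\<integral>\<^sup>+x. gg x \<partial>lborel) \<le> ennreal C2 * (\<integral>\<^sup>+x. V x \<partial>lborel)"
      unfolding gg_def using C2(2)[of v] by (simp add: vV)
    have "L \<le> (\<integral>\<^sup>+x. f x powe a * gg x powe (1 - a) \<partial>lborel)"
      unfolding L_def by (intro nn_integral_mono pt)
    also have "\<dots> \<le> (\<integral>\<^sup>+x. f x \<partial>lborel) powe a * (\<integral>\<^sup>+x. gg x \<partial>lborel) powe (1 - a)"
      using a by (intro nn_integral_Hoelder) auto
    also have "\<dots> \<le> (ennreal C1 * (\<integral>\<^sup>+x. V x \<partial>lborel)) powe a * (ennreal C2 * (\<integral>\<^sup>+x. V x \<partial>lborel)) powe (1 - a)"
      using a by (intro mult_mono powe_mono intf intg) auto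
    also have "\<dots> = ennreal D * ((\<integral>\<^sup>+x. V x \<partial>lborel) powe a * (\<integral>\<^sup>+x. V x \<partial>lborel) powe (1 - a))"
      using a C1(1) C2(1) by (simp add: powe_mult powe_ennreal D_def ennreal_mult ac_simps)
    also have "\<dots> = ennreal D * (\<integral>\<^sup>+x. V x \<partial>lborel)"
      by (simp flip: powe_add)
    also have "\<dots> \<le> ennreal D * (X + ennreal (e powr a * w))"
      by (intro mult_left_mono intV) auto
    finally show ?thesis .
  qed
  have "L \<le> ennreal D * X"
  proof (cases "X = top")
    case True
    then show ?thesis using D by (simp add: ennreal_mult_top)
  next
    case False
    show ?thesis
    proof (rule ennreal_le_epsilon)
      fix \<epsilon> :: real assume eps: "0 < \<epsilon>"
      \<comment> \<open>Solved from D e^a w \<le> \<epsilon>; the 1 in the denominator covers w =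
        0.\<close>
      define e where "e = (\<epsilon> / (D * w + 1)) powr (1 / a)"
      have pos: "0 < D * w + 1" using D w by (simp add: add_nonneg_pos)
      have e: "0 < e" "e powr a = \<epsilon> / (D * w + 1)" using eps pos a by (auto simp: e_def powr_powr)
      have "D * (e powr a * w) = \<epsilon> * (D * w / (D * w + 1))" by (simp add: e)
      also have "\<dots> \<le> \<epsilon> * 1" using eps pos by (intro mult_left_mono) (auto simp: divide_le_eq_1)
      finally have le: "D * (e powr a * w) \<le> \<epsilon>" by simp
      have "L \<le> ennreal D * (X + ennreal (e powr a * w))"
        using False e by (intro main) (auto simp: top.not_eq_extremum)
      also have "\<dots> = ennreal D * X + ennreal (D * (e powr a * w))"
        using D w by (simp add: distrib_left ennreal_mult)
      also have "\<dots> \<le> ennreal D * X + ennreal \<epsilon>"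
        using le by (intro add_left_mono ennreal_leI)
      finally show "L \<le> ennreal D * X + ennreal \<epsilon>" .
    qed
  qed
  then show ?thesis by (simp add: L_def X_def U_def D_def)
qed

text \<open>The test function h is the power a - 1 of the truncation of Z, so h to the conjugate
  exponent a / (a - 1) is the integrand of \<open>X n\<close> again. Moving the maximal operator
  from G to h and applying Hoelder bounds \<open>X n\<close> by a multiple of its own power 1 - 1/a,
  which is then cancelled. Truncating at n and restricting to B make \<open>X n\<close> finite for
  this cancellation.\<close>

lemma vector_maximal_large_exponent:
  fixes G :: "'r \<Rightarrow> real \<Rightarrow> ennreal"
  assumes S: "sigma_finite_measure S" and a: "1 < a"
    and C1: "0 < C1" "\<And>g h. g \<in> borel_measurable borel \<Longrightarrow> h \<in> borel_measurable borel \<Longrightarrow>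
       (\<integral>\<^sup>+x. max_pow \<tau> g x * h x \<partial>lborel) \<le> ennreal C1 * (\<integral>\<^sup>+x. g x * hl_max h x \<partial>lborel)"
    and C2: "0 < C2" "\<And>g h. g \<in> borel_measurable borel \<Longrightarrow> h \<in> borel_measurable borel \<Longrightarrow>
       (\<integral>\<^sup>+x. hl_max g x powe (a / (a - 1)) * h x \<partial>lborel) \<le> ennreal C2 * (\<integral>\<^sup>+x. g x powe (a / (a - 1)) * hl_max h x \<partial>lborel)"
    and [measurable]: "case_prod G \<in> borel_measurable (S \<Otimes>\<^sub>M borel)"
    and B [measurable]: "B \<in> sets borel" and Bfin: "emeasure lborel B < top"
  shows "(\<integral>\<^sup>+x\<in>B. (\<integral>\<^sup>+r. max_pow \<tau> (G r) x \<partial>S) powe a \<partial>lborel)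
    \<le> ennreal ((C1 * C2 powr (1 - 1/a)) powr a) * (\<integral>\<^sup>+x. (\<integral>\<^sup>+r. G r x \<partial>S) powe a \<partial>lborel)"
proof -
  interpret S: sigma_finite_measure S by fact
  interpret P: pair_sigma_finite S lborel ..
  define D where "D = C1 * C2 powr (1 - 1/a)"
  have D: "0 < D" using C1 C2 by (simp add: D_def)
  define U where "U x = (\<integral>\<^sup>+r. G r x \<partial>S)" for x
  define Z where "Z x = (\<integral>\<^sup>+r. max_pow \<tau> (G r) x \<partial>S)" for x
  have mG [measurable]: "(\<lambda>(r, x). max_pow \<tau> (G r) x) \<in> borel_measurable (S \<Otimes>\<^sub>M borel)"
    by (rule max_pow_measurable_param) measurable
  have [measurable]: "U \<in> borel_measurable borel" "Z \<in> borel_measurable borel"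
    unfolding U_def Z_def by measurable
  have Gr: "G r \<in> borel_measurable borel" if "r \<in> space S" for r
    using measurable_compose[OF measurable_Pair1'[OF that], of "case_prod G"] by auto
  define Y where "Y = (\<integral>\<^sup>+x. U x powe a \<partial>lborel)"
  define X where "X n = (\<integral>\<^sup>+x. min (Z x) (of_nat n) powe a * indicator B x \<partial>lborel)" for n
  have bound: "X n \<le> ennreal (D powr a) * Y" for n
  proof -
    define h where "h x = min (Z x) (of_nat n) powe (a - 1) * indicator B x" for x
    have [measurable]: "h \<in> borel_measurable borel" unfolding h_def by measurable
    have ha: "h x powe (a / (a - 1)) = min (Z x) (of_nat n) powe a * indicator B x" for x
      using a by (simp add: h_def powe_powe split: split_indicator)
    have "X n \<le> (\<integral>\<^sup>+x. of_nat n powe a * indicator B x \<partial>lborel)"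
      unfolding X_def using a by (intro nn_integral_mono mult_right_mono powe_mono) auto
    also have "\<dots> = of_nat n powe a * emeasure lborel B"
      by (simp add: nn_integral_cmult_indicator)
    also have "\<dots> < top" using Bfin by (simp add: ennreal_mult_less_top of_nat_less_top)
    finally have Xfin: "X n < top" .
    have "X n \<le> (\<integral>\<^sup>+x. Z x * h x \<partial>lborel)"
      unfolding X_def
    proof (intro nn_integral_mono)
      fix x
      have "min (Z x) (of_nat n) powe a = min (Z x) (of_nat n) * min (Z x) (of_nat n) powe (a - 1)"
        using powe_add[of "min (Z x) (of_nat n)" 1 "a - 1"] by simp
      also have "\<dots> \<le> Z x * min (Z x) (of_nat n) powe (a - 1)"
        by (intro mult_right_mono) auto
      finally show "min (Z x) (of_nat n) powe a * indicator B x \<le> Z x * h x"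
        by (auto simp: h_def split: split_indicator)
    qed
    also have "\<dots> = (\<integral>\<^sup>+x. (\<integral>\<^sup>+r. max_pow \<tau> (G r) x * h x \<partial>S) \<partial>lborel)"
      unfolding Z_def by (intro nn_integral_cong nn_integral_multc[symmetric]) measurable
    also have "\<dots> = (\<integral>\<^sup>+r. (\<integral>\<^sup>+x. max_pow \<tau> (G r) x * h x \<partial>lborel) \<partial>S)"
      by (rule P.Fubini') measurable
    also have "\<dots> \<le> (\<integral>\<^sup>+r. ennreal C1 * (\<integral>\<^sup>+x. G r x * hl_max h x \<partial>lborel) \<partial>S)"
      by (intro nn_integral_mono C1 Gr) auto
    also have "\<dots> = ennreal C1 * (\<integral>\<^sup>+r. (\<integral>\<^sup>+x. G r x * hl_max h x \<partial>lborel) \<partial>S)"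
      by (intro nn_integral_cmult) measurable
    also have "\<dots> = ennreal C1 * (\<integral>\<^sup>+x. (\<integral>\<^sup>+r. G r x * hl_max h x \<partial>S) \<partial>lborel)"
      by (subst P.Fubini') auto
    also have "\<dots> = ennreal C1 * (\<integral>\<^sup>+x. U x * hl_max h x \<partial>lborel)"
      unfolding U_def by (intro arg_cong2[where f="(*)"] nn_integral_cong nn_integral_multc refl) measurable
    also have "\<dots> = ennreal C1 * (\<integral>\<^sup>+x. (U x powe a) powe (1/a) * (hl_max h x powe (a / (a - 1))) powe (1 - 1/a) \<partial>lborel)"
    proof -
      have "a / (a - 1) * (1 - 1 / a) = 1" using a by (simp add: field_simps)
      then show ?thesis using a by (simp add: powe_powe)
    qed
    also have "\<dots> \<le> ennreal C1 * ((\<integral>\<^sup>+x. U x powe a \<partial>lborel) powe (1/a) * (\<integral>\<^sup>+x. hl_max h x powe (a / (a - 1)) \<partial>lborel) powe (1 - 1/a))"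
      using a by (intro mult_left_mono nn_integral_Hoelder) auto
    also have "\<dots> \<le> ennreal C1 * (Y powe (1/a) * (ennreal C2 * X n) powe (1 - 1/a))"
      using C2(2)[of h "\<lambda>_. 1"] a unfolding Y_def X_def
      by (intro mult_left_mono powe_mono) (auto simp: hl_max_const ha)
    also have "\<dots> = (ennreal D * Y powe (1/a)) * X n powe (1 - 1/a)"
      using C1(1) C2(1) a by (simp add: powe_mult powe_ennreal D_def ennreal_mult ac_simps)
    finally have *: "X n powe (1/a) * X n powe (1 - 1/a) \<le> (ennreal D * Y powe (1/a)) * X n powe (1 - 1/a)"
      by (simp flip: powe_add)
    have "X n powe (1/a) \<le> ennreal D * Y powe (1/a)"
    proof (cases "X n = 0")
      case False
      then show ?thesis
        using * Xfin ennreal_mult_le_mult_iff[of "X n powe (1 - 1/a)" "X n powe (1/a)" "ennreal D * Y powe (1/a)"]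
        by (simp add: mult.commute)
    qed simp
    then have "(X n powe (1/a)) powe a \<le> (ennreal D * Y powe (1/a)) powe a"
      using a by (intro powe_mono) auto
    then show ?thesis
      using a D by (simp add: powe_powe powe_mult powe_ennreal)
  qed
  have lim: "Z x powe a * indicator B x = (SUP n. min (Z x) (of_nat n) powe a * indicator B x)" for x
  proof -
    have "Z x = (SUP n. min (Z x) (of_nat n))"
      using inf_SUP[of "Z x" of_nat UNIV] ennreal_SUP_of_nat_eq_top by (simp add: inf_min)
    then have "Z x powe a = (SUP n. min (Z x) (of_nat n) powe a)"
      using powe_SUP[of a "\<lambda>n. min (Z x) (of_nat n)" UNIV] a by simp
    then show ?thesis by (auto split: split_indicator)
  qed
  have "(\<integral>\<^sup>+x\<in>B. Z x powe a \<partial>lborel) = (SUP n. X n)"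
    unfolding lim X_def using a
    by (intro nn_integral_monotone_convergence_SUP)
       (auto simp: incseq_def le_fun_def intro!: mult_right_mono powe_mono min.mono)
  also have "\<dots> \<le> ennreal (D powr a) * Y"
    by (intro SUP_least bound)
  finally show ?thesis by (simp add: Z_def Y_def U_def D_def)
qed

text \<open>B keeps the truncated integrals finite when a > 1, W the regularising term when a < 1;
  for a = 1 Fubini reduces the claim to each \<open>G r\<close>.\<close>

lemma vector_maximal_inequality_obtain:
  assumes S: "sigma_finite_measure (S :: 'r measure)" and a: "0 < a"
  obtains C :: real where "0 < C"
    "\<And>G B W. case_prod G \<in> borel_measurable (S \<Otimes>\<^sub>M borel) \<Longrightarrow> B \<in> sets borel \<Longrightarrow>
       emeasure lborel B < top \<Longrightarrow> W \<in> sets borel \<Longrightarrow> emeasure lborel W < top \<Longrightarrow>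
       (\<And>r y. y \<notin> W \<Longrightarrow> G r y = 0) \<Longrightarrow>
       (\<integral>\<^sup>+x\<in>B. (\<integral>\<^sup>+r. max_pow (min a 1 / 4) (G r) x \<partial>S) powe a \<partial>lborel)
         \<le> ennreal C * (\<integral>\<^sup>+x. (\<integral>\<^sup>+r. G r x \<partial>S) powe a \<partial>lborel)"
proof -
  consider "a < 1" | "a = 1" | "1 < a" by linarith
  then show ?thesis
  proof cases
    case 1
    \<comment> \<open>Then 2 \<tau> = a / 2 lies below both 1 and a / (1 - a), the exponents of the
      two scalar inequalities.\<close>
    define \<tau> where "\<tau> = a / 4"
    have t: "0 < \<tau>" "2 * \<tau> < 1" "2 * \<tau> < a / (1 - a)" "min a 1 / 4 = \<tau>"
    proof -
      have "a / 2 * (1 - a) < a" using 1 a by (auto simp: field_simps intro: add_strict_increasing)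
      then show "2 * \<tau> < a / (1 - a)" using 1 by (simp add: \<tau>_def pos_less_divide_eq)
    qed (use 1 a in \<open>auto simp: \<tau>_def\<close>)
    obtain C1 :: real where C1: "0 < C1"
      "\<And>g h. g \<in> borel_measurable borel \<Longrightarrow> h \<in> borel_measurable borel \<Longrightarrow>
         (\<integral>\<^sup>+x. max_pow (2 * \<tau>) g x * h x \<partial>lborel) \<le> ennreal C1 * (\<integral>\<^sup>+x. g x * hl_max h x \<partial>lborel)"
      using max_pow_weighted_obtain[of "2 * \<tau>"] t by auto
    obtain C2 :: real where C2: "0 < C2"
      "\<And>g. g \<in> borel_measurable borel \<Longrightarrow>
         (\<integral>\<^sup>+x. max_pow (2 * \<tau>) g x powe (a / (1 - a)) \<partial>lborel) \<le> ennreal C2 * (\<integral>\<^sup>+x. g x powe (a / (1 - a)) \<partial>lborel)"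
      using max_pow_strong_obtain[of "2 * \<tau>" "a / (1 - a)"] t by auto
    have C1': "(\<integral>\<^sup>+x. max_pow (2 * \<tau>) g x \<partial>lborel) \<le> ennreal C1 * (\<integral>\<^sup>+x. g x \<partial>lborel)"
      if "g \<in> borel_measurable borel" for g
      using C1(2)[OF that, of "\<lambda>_. 1"] by (simp add: hl_max_const)
    show ?thesis
    proof (rule that[of "C1 powr a * C2 powr (1 - a)"], goal_cases)
      case (2 G B W)
      have "(\<integral>\<^sup>+x\<in>B. (\<integral>\<^sup>+r. max_pow (min a 1 / 4) (G r) x \<partial>S) powe a \<partial>lborel)
         \<le> (\<integral>\<^sup>+x. (\<integral>\<^sup>+r. max_pow \<tau> (G r) x \<partial>S) powe a \<partial>lborel)"
        unfolding t(4) by (intro nn_integral_mono) (auto split: split_indicator)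
      also have "\<dots> \<le> ennreal (C1 powr a * C2 powr (1 - a)) * (\<integral>\<^sup>+x. (\<integral>\<^sup>+r. G r x \<partial>S) powe a \<partial>lborel)"
        by (rule vector_maximal_small_exponent[OF S a 1 C1(1) C1' C2 t(1) 2(1,4,5,6)])
      finally show ?case .
    qed (use C1 C2 in auto)
  next
    case 2
    interpret S: sigma_finite_measure S by fact
    interpret P: pair_sigma_finite S lborel ..
    obtain C1 :: real where C1: "0 < C1"
      "\<And>g h. g \<in> borel_measurable borel \<Longrightarrow> h \<in> borel_measurable borel \<Longrightarrow>
         (\<integral>\<^sup>+x. max_pow (1/4) g x * h x \<partial>lborel) \<le> ennreal C1 * (\<integral>\<^sup>+x. g x * hl_max h x \<partial>lborel)"
      using max_pow_weighted_obtain[of "1/4"] by auto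
    show ?thesis
    proof (rule that[OF C1(1)], goal_cases)
      case (1 G B W)
      note [measurable] = 1(1)
      have [measurable]: "(\<lambda>(r, x). max_pow (1/4) (G r) x) \<in> borel_measurable (S \<Otimes>\<^sub>M borel)"
        by (rule max_pow_measurable_param) measurable
      have Gr: "G r \<in> borel_measurable borel" if "r \<in> space S" for r
        using measurable_compose[OF measurable_Pair1'[OF that], of "case_prod G"] by auto
      have C1': "(\<integral>\<^sup>+x. max_pow (1/4) g x \<partial>lborel) \<le> ennreal C1 * (\<integral>\<^sup>+x. g x \<partial>lborel)"
        if "g \<in> borel_measurable borel" for g
        using C1(2)[OF that, of "\<lambda>_. 1"] by (simp add: hl_max_const)
      have "(\<integral>\<^sup>+x\<in>B. (\<integral>\<^sup>+r. max_pow (min a 1 / 4) (G r) x \<partial>S) powe a \<partial>lborel)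
         \<le> (\<integral>\<^sup>+x. (\<integral>\<^sup>+r. max_pow (1/4) (G r) x \<partial>S) \<partial>lborel)"
        unfolding 2 by (intro nn_integral_mono) (auto split: split_indicator)
      also have "\<dots> = (\<integral>\<^sup>+r. (\<integral>\<^sup>+x. max_pow (1/4) (G r) x \<partial>lborel) \<partial>S)"
        by (rule P.Fubini') measurable
      also have "\<dots> \<le> (\<integral>\<^sup>+r. ennreal C1 * (\<integral>\<^sup>+x. G r x \<partial>lborel) \<partial>S)"
        by (intro nn_integral_mono C1' Gr)
      also have "\<dots> = ennreal C1 * (\<integral>\<^sup>+r. (\<integral>\<^sup>+x. G r x \<partial>lborel) \<partial>S)"
        by (intro nn_integral_cmult) measurable
      also have "\<dots> = ennreal C1 * (\<integral>\<^sup>+x. (\<integral>\<^sup>+r. G r x \<partial>S) \<partial>lborel)"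
        by (subst P.Fubini') auto
      finally show ?case by (simp add: 2)
    qed
  next
    case 3
    have t: "min a 1 / 4 = 1/4" using 3 by simp
    obtain C1 :: real where C1: "0 < C1"
      "\<And>g h. g \<in> borel_measurable borel \<Longrightarrow> h \<in> borel_measurable borel \<Longrightarrow>
         (\<integral>\<^sup>+x. max_pow (1/4) g x * h x \<partial>lborel) \<le> ennreal C1 * (\<integral>\<^sup>+x. g x * hl_max h x \<partial>lborel)"
      using max_pow_weighted_obtain[of "1/4"] by auto
    obtain C2 :: real where C2: "0 < C2"
      "\<And>g h. g \<in> borel_measurable borel \<Longrightarrow> h \<in> borel_measurable borel \<Longrightarrow>
         (\<integral>\<^sup>+x. hl_max g x powe (a / (a - 1)) * h x \<partial>lborel) \<le> ennreal C2 * (\<integral>\<^sup>+x. g x powe (a / (a - 1)) * hl_max h x \<partial>lborel)"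
      using weighted_strong_type_obtain[of "a / (a - 1)"] 3 by auto
    show ?thesis
    proof (rule that[of "(C1 * C2 powr (1 - 1/a)) powr a"], goal_cases)
      case (2 G B W)
      show ?case unfolding t
        by (rule vector_maximal_large_exponent[OF S 3 C1 C2 2(1-3)])
    qed (use C1 C2 in auto)
  qed
qed

section \<open>Polar coordinates\<close>

lemma nn_integral_shift:
  fixes f :: "real \<Rightarrow> ennreal"
  assumes "f \<in> borel_measurable borel"
  shows "(\<integral>\<^sup>+x. f (x + c) \<partial>lborel) = (\<integral>\<^sup>+x. f x \<partial>lborel)"
  using nn_integral_real_affine[OF assms, of 1 c] by (simp add: add.commute)

lemma periodic_of_int:
  fixes K :: "real \<Rightarrow> 'a" and p :: real and n :: int
  assumes "\<And>x. K (x + p) = K x"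
  shows "K (x + of_int n * p) = K x"
proof -
  have nat: "K (x + real m * p) = K x" for x m
  proof (induction m)
    case (Suc m)
    have "x + real (Suc m) * p = (x + real m * p) + p" by (simp add: algebra_simps)
    then show ?case using assms[of "x + real m * p"] Suc by metis
  qed simp
  show ?thesis
  proof (cases "0 \<le> n")
    case True
    then show ?thesis using nat[of x "nat n"] by simp
  next
    case False
    then show ?thesis using nat[of "x + of_int n * p" "nat (- n)"] by simp
  qed
qed

lemma nn_integral_periodic:
  fixes K :: "real \<Rightarrow> ennreal"
  assumes [measurable]: "K \<in> borel_measurable borel" and per: "\<And>x. K (x + p) = K x" and p: "0 < p"
  shows "(\<integral>\<^sup>+x\<in>{a..<a + p}. K x \<partial>lborel) = (\<integral>\<^sup>+x\<in>{0..<p}. K x \<partial>lborel)"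
proof -
  \<comment> \<open>Subtracting n periods moves the left end into [0, p); the window is then cut at
    p and the second piece moved back by one period.\<close>
  define n where "n = \<lfloor>a / p\<rfloor>"
  define b where "b = a - of_int n * p"
  have b: "0 \<le> b" "b < p"
    using p floor_divide_lower[OF p, of a] floor_divide_upper[OF p, of a]
    by (auto simp: b_def n_def algebra_simps)
  have "(\<integral>\<^sup>+x\<in>{a..<a + p}. K x \<partial>lborel) = (\<integral>\<^sup>+x. K (x + of_int n * p) * indicator {a..<a + p} (x + of_int n * p) \<partial>lborel)"
    by (subst nn_integral_shift) auto
  also have "\<dots> = (\<integral>\<^sup>+x\<in>{b..<b + p}. K x \<partial>lborel)"
    unfolding periodic_of_int[of K, OF per]
    by (intro nn_integral_cong) (auto simp: b_def split: split_indicator)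
  also have "\<dots> = (\<integral>\<^sup>+x. K x * indicator {b..<p} x + K x * indicator {p..<b + p} x \<partial>lborel)"
    using b by (intro nn_integral_cong) (auto split: split_indicator)
  also have "\<dots> = (\<integral>\<^sup>+x\<in>{b..<p}. K x \<partial>lborel) + (\<integral>\<^sup>+x\<in>{p..<b + p}. K x \<partial>lborel)"
    by (intro nn_integral_add) auto
  also have "(\<integral>\<^sup>+x\<in>{p..<b + p}. K x \<partial>lborel) = (\<integral>\<^sup>+x. K (x + p) * indicator {p..<b + p} (x + p) \<partial>lborel)"
    by (subst nn_integral_shift) auto
  also have "\<dots> = (\<integral>\<^sup>+x\<in>{0..<b}. K x \<partial>lborel)"
    by (intro nn_integral_cong) (auto simp: per split: split_indicator)
  also have "(\<integral>\<^sup>+x\<in>{b..<p}. K x \<partial>lborel) + (\<integral>\<^sup>+x\<in>{0..<b}. K x \<partial>lborel)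
     = (\<integral>\<^sup>+x. K x * indicator {b..<p} x + K x * indicator {0..<b} x \<partial>lborel)"
    by (intro nn_integral_add[symmetric]) auto
  also have "\<dots> = (\<integral>\<^sup>+x\<in>{0..<p}. K x \<partial>lborel)"
    using b by (intro nn_integral_cong) (auto split: split_indicator)
  finally show ?thesis .
qed

lemma measurable_Complex [measurable]:
  assumes [measurable]: "f \<in> borel_measurable M" "g \<in> borel_measurable M"
  shows "(\<lambda>x. Complex (f x) (g x)) \<in> borel_measurable M"
  unfolding Complex_eq by measurable

lemma lborel_complex_eq:
  "(lborel :: complex measure) = distr (lborel \<Otimes>\<^sub>M lborel) borel (\<lambda>(x, y). Complex x y)"
proof (rule lborel_eqI)
  have meas [measurable]: "(\<lambda>(x, y). Complex x y) \<in> borel_measurable (lborel \<Otimes>\<^sub>M lborel)"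
    by measurable
  fix l u :: complex
  assume le: "\<And>b. b \<in> Basis \<Longrightarrow> l \<bullet> b \<le> u \<bullet> b"
  from le[of 1] le[of \<i>] have lu: "Re l \<le> Re u" "Im l \<le> Im u" by (auto simp: Basis_complex_def)
  have "(\<lambda>(x, y). Complex x y) -` box l u \<inter> space (lborel \<Otimes>\<^sub>M lborel) = {Re l<..<Re u} \<times> {Im l<..<Im u}"
    by (auto simp: box_def Basis_complex_def space_pair_measure)
  then have "emeasure (distr (lborel \<Otimes>\<^sub>M lborel) borel (\<lambda>(x, y). Complex x y)) (box l u)
      = emeasure (lborel \<Otimes>\<^sub>M lborel) ({Re l<..<Re u} \<times> {Im l<..<Im u})"
    by (subst emeasure_distr) (auto simp: meas)
  also have "\<dots> = ennreal ((Re u - Re l) * (Im u - Im l))"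
    using lu by (subst lborel.emeasure_pair_measure_Times) (auto simp: ennreal_mult)
  also have "(Re u - Re l) * (Im u - Im l) = (\<Prod>b\<in>Basis. (u - l) \<bullet> b)"
    by (simp add: Basis_complex_def)
  finally show "emeasure (distr (lborel \<Otimes>\<^sub>M lborel) borel (\<lambda>(x, y). Complex x y)) (box l u) = (\<Prod>b\<in>Basis. (u - l) \<bullet> b)"
    by simp
qed simp

lemma measurable_cis [measurable]:
  assumes [measurable]: "f \<in> borel_measurable M"
  shows "(\<lambda>x. cis (f x)) \<in> borel_measurable M"
  unfolding cis.code by measurable

lemma nn_integral_complex:
  fixes F :: "complex \<Rightarrow> ennreal"
  assumes [measurable]: "F \<in> borel_measurable borel"
  shows "(\<integral>\<^sup>+z. F z \<partial>lborel) = (\<integral>\<^sup>+x. \<integral>\<^sup>+y. F (Complex x y) \<partial>lborel \<partial>lborel)"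
  unfolding lborel_complex_eq
  by (subst nn_integral_distr) (auto simp: case_prod_beta lborel.nn_integral_fst[symmetric])

text \<open>The substitution is made on the compact intervals where |t| \<le> n + 1 and extended by
  monotone convergence; n + 1 in place of n keeps them nondegenerate.\<close>

lemma nn_integral_tan:
  fixes g :: "real \<Rightarrow> ennreal"
  assumes [measurable]: "g \<in> borel_measurable borel"
  shows "(\<integral>\<^sup>+t. g t \<partial>lborel) = (\<integral>\<^sup>+x\<in>{- (pi/2)<..<pi/2}. g (tan x) * ennreal (1 + tan x ^ 2) \<partial>lborel)"
proof -
  have arc: "0 < arctan (real n + 1)" "arctan (real n + 1) < pi/2" "0 < cos (arctan (real n + 1))" for n
    using arctan_bounded[of "real n + 1"] by (auto intro!: cos_gt_zero_pi)
  have [measurable]: "(tan :: real \<Rightarrow> real) \<in> borel_measurable borel"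
    unfolding tan_def by measurable
  have part: "(\<integral>\<^sup>+t. g t * indicator {- (real n + 1)..real n + 1} t \<partial>lborel)
     = (\<integral>\<^sup>+x. g (tan x) * ennreal (1 + tan x ^ 2) * indicator {- arctan (real n + 1)..arctan (real n + 1)} x \<partial>lborel)" for n
  proof -
    have pos: "0 < cos x" if "x \<in> {- arctan (real n + 1)..arctan (real n + 1)}" for x
      using that arc[of n] by (intro cos_gt_zero_pi) auto
    have "(\<integral>\<^sup>+t. g t * indicator {tan (- arctan (real n + 1))..tan (arctan (real n + 1))} t \<partial>lborel)
      = (\<integral>\<^sup>+x. g (tan x) * ennreal (1 + tan x ^ 2) * indicator {- arctan (real n + 1)..arctan (real n + 1)} x \<partial>lborel)"
    proof (rule nn_integral_substitution_aux)
      fix x assume "x \<in> {- arctan (real n + 1)..arctan (real n + 1)}"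
      from pos[OF this] show "(tan has_real_derivative 1 + tan x ^ 2) (at x)"
        by (auto intro!: derivative_eq_intros simp: tan_def field_simps power2_eq_square)
    next
      show "continuous_on {- arctan (real n + 1)..arctan (real n + 1)} (\<lambda>x. 1 + tan x ^ 2)"
        using pos by (intro continuous_intros) force
    qed (use arc[of n] in \<open>auto simp: add_nonneg_nonneg\<close>)
    then show ?thesis by (simp add: tan_arctan)
  qed
  have "(\<integral>\<^sup>+t. g t \<partial>lborel) = (\<integral>\<^sup>+t. (SUP n. g t * indicator {- (real n + 1)..real n + 1} t) \<partial>lborel)"
  proof (intro nn_integral_cong antisym SUP_least)
    fix t
    obtain n where "\<bar>t\<bar> \<le> real n" using real_arch_simple by blast
    then have "t \<in> {- (real n + 1)..real n + 1}" by auto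
    then have "g t \<le> g t * indicator {- (real n + 1)..real n + 1} t" by (simp only: indicator_simps) simp
    also have "\<dots> \<le> (SUP n. g t * indicator {- (real n + 1)..real n + 1} t)" by (rule SUP_upper) simp
    finally show "g t \<le> \<dots>" .
  qed (auto split: split_indicator)
  also have "\<dots> = (SUP n. \<integral>\<^sup>+t. g t * indicator {- (real n + 1)..real n + 1} t \<partial>lborel)"
    by (intro nn_integral_monotone_convergence_SUP) (auto simp: incseq_def le_fun_def split: split_indicator)
  also have "\<dots> = (SUP n. \<integral>\<^sup>+x. g (tan x) * ennreal (1 + tan x ^ 2) * indicator {- arctan (real n + 1)..arctan (real n + 1)} x \<partial>lborel)"
    by (simp only: part)
  also have "\<dots> = (\<integral>\<^sup>+x. (SUP n. g (tan x) * ennreal (1 + tan x ^ 2) * indicator {- arctan (real n + 1)..arctan (real n + 1)} x) \<partial>lborel)"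
  proof (intro nn_integral_monotone_convergence_SUP[symmetric])
    show "incseq (\<lambda>n x. g (tan x) * ennreal (1 + tan x ^ 2) * indicator {- arctan (real n + 1)..arctan (real n + 1)} x)"
      unfolding incseq_def le_fun_def
    proof (intro allI impI mult_left_mono)
      fix m n x assume "(m::nat) \<le> n"
      then have "arctan (real m + 1) \<le> arctan (real n + 1)" by (intro arctan_monotone') auto
      then show "(indicator {- arctan (real m + 1)..arctan (real m + 1)} x :: ennreal)
        \<le> indicator {- arctan (real n + 1)..arctan (real n + 1)} x" by (auto split: split_indicator)
    qed auto
  qed measurable
  also have "\<dots> = (\<integral>\<^sup>+x\<in>{- (pi/2)<..<pi/2}. g (tan x) * ennreal (1 + tan x ^ 2) \<partial>lborel)"
  proof (intro nn_integral_cong antisym SUP_least)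
    fix x n
    show "g (tan x) * ennreal (1 + tan x ^ 2) * indicator {- arctan (real n + 1)..arctan (real n + 1)} x
      \<le> g (tan x) * ennreal (1 + tan x ^ 2) * indicator {- (pi/2)<..<pi/2} x"
      using arc[of n] by (intro mult_left_mono) (auto split: split_indicator)
  next
    fix x
    show "g (tan x) * ennreal (1 + tan x ^ 2) * indicator {- (pi/2)<..<pi/2} x
      \<le> (SUP n. g (tan x) * ennreal (1 + tan x ^ 2) * indicator {- arctan (real n + 1)..arctan (real n + 1)} x)"
    proof (cases "x \<in> {- (pi/2)<..<pi/2}")
      case True
      obtain n where n: "\<bar>tan x\<bar> \<le> real n" using real_arch_simple by blast
      have "arctan (tan x) = x" using True by (intro arctan_tan) auto
      moreover have "arctan (tan x) \<le> arctan (real n + 1)" "arctan (- (real n + 1)) \<le> arctan (tan x)"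
        using n by (auto intro!: arctan_monotone')
      ultimately have "x \<le> arctan (real n + 1)" "- arctan (real n + 1) \<le> x"
        by (simp_all only: arctan_minus)
      then show ?thesis using True by (intro SUP_upper2[of n]) auto
    qed simp
  qed
  finally show ?thesis .
qed

definition radial_integral :: "(complex \<Rightarrow> ennreal) \<Rightarrow> real \<Rightarrow> ennreal" where
  "radial_integral F x = (\<integral>\<^sup>+r\<in>{0<..}. F (of_real r * cis x) * ennreal r \<partial>lborel)"

lemma radial_integral_measurable [measurable]:
  assumes [measurable]: "F \<in> borel_measurable borel"
  shows "radial_integral F \<in> borel_measurable borel"
  unfolding radial_integral_def by measurable

text \<open>Two one-variable substitutions: y = x tan t replaces vertical lines by rays, and x = r
  cos t rescales each ray. The Jacobians combine to r because cos^2 t (1 + tan^2 t) = 1.\<close>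

lemma nn_integral_half_plane:
  fixes F :: "complex \<Rightarrow> ennreal"
  assumes [measurable]: "F \<in> borel_measurable borel"
  shows "(\<integral>\<^sup>+x\<in>{0<..}. \<integral>\<^sup>+y. F (Complex x y) \<partial>lborel \<partial>lborel)
    = (\<integral>\<^sup>+t\<in>{- (pi/2)<..<pi/2}. radial_integral F t \<partial>lborel)"
proof -
  have "(\<integral>\<^sup>+x\<in>{0<..}. \<integral>\<^sup>+y. F (Complex x y) \<partial>lborel \<partial>lborel)
    = (\<integral>\<^sup>+x. \<integral>\<^sup>+t. F (Complex x (x * t)) * ennreal x * indicator {0<..} x \<partial>lborel \<partial>lborel)"
  proof (intro nn_integral_cong)
    fix x :: real
    show "(\<integral>\<^sup>+y. F (Complex x y) \<partial>lborel) * indicator {0<..} x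
       = (\<integral>\<^sup>+t. F (Complex x (x * t)) * ennreal x * indicator {0<..} x \<partial>lborel)"
    proof (cases "0 < x")
      case True
      then show ?thesis
        using nn_integral_real_affine[of "\<lambda>y. F (Complex x y)" x 0]
        by (simp add: nn_integral_cmult mult.commute)
    qed simp
  qed
  also have "\<dots> = (\<integral>\<^sup>+t. \<integral>\<^sup>+x. F (Complex x (x * t)) * ennreal x * indicator {0<..} x \<partial>lborel \<partial>lborel)"
    by (rule lborel_pair.Fubini') measurable
  also have "\<dots> = (\<integral>\<^sup>+t\<in>{- (pi/2)<..<pi/2}. (\<integral>\<^sup>+x. F (Complex x (x * tan t)) * ennreal x * indicator {0<..} x \<partial>lborel) * ennreal (1 + tan t ^ 2) \<partial>lborel)"
    by (rule nn_integral_tan) measurable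
  also have "\<dots> = (\<integral>\<^sup>+t\<in>{- (pi/2)<..<pi/2}. radial_integral F t \<partial>lborel)"
  proof (intro nn_integral_cong)
    fix t :: real
    show "(\<integral>\<^sup>+x. F (Complex x (x * tan t)) * ennreal x * indicator {0<..} x \<partial>lborel) * ennreal (1 + tan t ^ 2) * indicator {- (pi/2)<..<pi/2} t
      = radial_integral F t * indicator {- (pi/2)<..<pi/2} t"
    proof (cases "t \<in> {- (pi/2)<..<pi/2}")
      case True
      then have c: "0 < cos t" by (intro cos_gt_zero_pi) auto
      have "(\<integral>\<^sup>+x. F (Complex x (x * tan t)) * ennreal x * indicator {0<..} x \<partial>lborel)
        = ennreal (cos t) * (\<integral>\<^sup>+r. F (Complex (cos t * r) (cos t * r * tan t)) * ennreal (cos t * r) * indicator {0<..} (cos t * r) \<partial>lborel)"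
        using nn_integral_real_affine[of "\<lambda>x. F (Complex x (x * tan t)) * ennreal x * indicator {0<..} x" "cos t" 0] c
        by simp
      also have "(\<integral>\<^sup>+r. F (Complex (cos t * r) (cos t * r * tan t)) * ennreal (cos t * r) * indicator {0<..} (cos t * r) \<partial>lborel)
        = (\<integral>\<^sup>+r. ennreal (cos t) * (F (of_real r * cis t) * ennreal r * indicator {0<..} r) \<partial>lborel)"
      proof (intro nn_integral_cong)
        fix r
        have "Complex (cos t * r) (cos t * r * tan t) = of_real r * cis t"
          using c by (auto simp: complex_eq_iff tan_def)
        then show "F (Complex (cos t * r) (cos t * r * tan t)) * ennreal (cos t * r) * indicator {0<..} (cos t * r)
          = ennreal (cos t) * (F (of_real r * cis t) * ennreal r * indicator {0<..} r)"
          using c by (auto simp: ennreal_mult zero_less_mult_iff ac_simps split: split_indicator)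
      qed
      also have "\<dots> = ennreal (cos t) * radial_integral F t"
        unfolding radial_integral_def by (rule nn_integral_cmult) measurable
      finally have "(\<integral>\<^sup>+x. F (Complex x (x * tan t)) * ennreal x * indicator {0<..} x \<partial>lborel) * ennreal (1 + tan t ^ 2)
        = (ennreal (cos t) * ennreal (cos t) * ennreal (1 + tan t ^ 2)) * radial_integral F t"
        by (simp add: ac_simps)
      also have "ennreal (cos t) * ennreal (cos t) * ennreal (1 + tan t ^ 2) = ennreal (cos t * cos t * (1 + tan t ^ 2))"
        using c by (simp add: ennreal_mult add_nonneg_nonneg)
      also have "cos t * cos t * (1 + tan t ^ 2) = 1"
        using c tan_sec[of t] by (simp add: field_simps power2_eq_square)
      finally show ?thesis by simp
    qed simp
  qed
  finally show ?thesis .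
qed

text \<open>The left half-plane is the right one under negation, a shift of the angle by pi, and the
  imaginary axis is a null set. The starting angle is left free so that the window can be centred at
  any \<theta>.\<close>

lemma nn_integral_polar:
  fixes F :: "complex \<Rightarrow> ennreal"
  assumes [measurable]: "F \<in> borel_measurable borel"
  shows "(\<integral>\<^sup>+z. F z \<partial>lborel) = (\<integral>\<^sup>+t\<in>{a..<a + 2 * pi}. radial_integral F t \<partial>lborel)"
proof -
  define G where "G x = (\<integral>\<^sup>+y. F (Complex x y) \<partial>lborel)" for x
  have [measurable]: "G \<in> borel_measurable borel" unfolding G_def by measurable
  have minus: "radial_integral (\<lambda>z. F (- z)) t = radial_integral F (t + pi)" for t
    by (simp add: radial_integral_def flip: cis_mult)
  have period: "radial_integral F (t + 2 * pi) = radial_integral F t" for t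
    by (simp add: radial_integral_def flip: cis_mult)
  have "(\<integral>\<^sup>+z. F z \<partial>lborel) = (\<integral>\<^sup>+x. G x * indicator {0<..} x + G x * indicator {..<0} x \<partial>lborel)"
    unfolding nn_integral_complex[OF assms] G_def[symmetric]
    by (intro nn_integral_cong_AE eventually_mono[OF AE_lborel_singleton[of 0]]) (auto split: split_indicator)
  also have "\<dots> = (\<integral>\<^sup>+x\<in>{0<..}. G x \<partial>lborel) + (\<integral>\<^sup>+x\<in>{..<0}. G x \<partial>lborel)"
    by (intro nn_integral_add) auto
  also have "(\<integral>\<^sup>+x\<in>{..<0}. G x \<partial>lborel) = (\<integral>\<^sup>+x. G (- x) * indicator {..<0} (- x) \<partial>lborel)"
    using nn_integral_real_affine[of "\<lambda>x. G x * indicator {..<0} x" "-1" 0] by simp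
  also have "\<dots> = (\<integral>\<^sup>+x\<in>{0<..}. \<integral>\<^sup>+y. F (- Complex x y) \<partial>lborel \<partial>lborel)"
  proof (intro nn_integral_cong)
    fix x
    have "G (- x) = (\<integral>\<^sup>+y. F (- Complex x y) \<partial>lborel)"
    proof -
      have "Complex (- x) (- y) = - Complex x y" for y by (simp add: complex_eq_iff)
      then show ?thesis
        unfolding G_def using nn_integral_real_affine[of "\<lambda>y. F (Complex (- x) y)" "-1" 0] by simp
    qed
    then show "G (- x) * indicator {..<0} (- x) = (\<integral>\<^sup>+y. F (- Complex x y) \<partial>lborel) * indicator {0<..} x"
      by (auto split: split_indicator)
  qed
  also have "\<dots> = (\<integral>\<^sup>+t\<in>{- (pi/2)<..<pi/2}. radial_integral F (t + pi) \<partial>lborel)"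
    unfolding minus[symmetric] by (rule nn_integral_half_plane) measurable
  also have "\<dots> = (\<integral>\<^sup>+t. radial_integral F (t + pi) * indicator {pi/2<..<3*pi/2} (t + pi) \<partial>lborel)"
    by (intro nn_integral_cong) (auto split: split_indicator)
  also have "\<dots> = (\<integral>\<^sup>+t\<in>{pi/2<..<3*pi/2}. radial_integral F t \<partial>lborel)"
    by (subst nn_integral_shift) auto
  also have "(\<integral>\<^sup>+x\<in>{0<..}. G x \<partial>lborel) = (\<integral>\<^sup>+t\<in>{- (pi/2)<..<pi/2}. radial_integral F t \<partial>lborel)"
    unfolding G_def by (rule nn_integral_half_plane) measurable
  also have "(\<integral>\<^sup>+t\<in>{- (pi/2)<..<pi/2}. radial_integral F t \<partial>lborel) + (\<integral>\<^sup>+t\<in>{pi/2<..<3*pi/2}. radial_integral F t \<partial>lborel)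
     = (\<integral>\<^sup>+t. radial_integral F t * indicator {- (pi/2)<..<pi/2} t + radial_integral F t * indicator {pi/2<..<3*pi/2} t \<partial>lborel)"
    by (intro nn_integral_add[symmetric]) auto
  also have "\<dots> = (\<integral>\<^sup>+t\<in>{- (pi/2)..<- (pi/2) + 2 * pi}. radial_integral F t \<partial>lborel)"
    by (intro nn_integral_cong_AE eventually_mono[OF eventually_conj[OF AE_lborel_singleton[of "- (pi/2)"] AE_lborel_singleton[of "pi/2"]]])
       (auto split: split_indicator)
  also have "\<dots> = (\<integral>\<^sup>+t\<in>{a..<a + 2 * pi}. radial_integral F t \<partial>lborel)"
    using nn_integral_periodic[of "radial_integral F" "2 * pi" "- (pi/2)"]
      nn_integral_periodic[of "radial_integral F" "2 * pi" a] period by simp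
  finally show ?thesis .
qed

section \<open>Subharmonicity of powers of the modulus\<close>

text \<open>On the circle the conjugate of z is 1 / z, so the product is a Laurent polynomial, and
  conjugating its negative powers does not change the real part. Real parts of polynomials thus form
  an algebra on the circle, as Stone--Weierstrass requires.\<close>

lemma Re_poly_mult_cnj_poly:
  "\<exists>Q. \<forall>z. cmod z = 1 \<longrightarrow> Re (poly p z * cnj (poly q z)) = Re (poly Q z)"
proof (induction p arbitrary: q)
  case 0
  then show ?case by (intro exI[of _ 0]) simp
next
  case (pCons a p)
  obtain b q' where q: "q = pCons b q'" by (cases q)
  obtain R where R: "\<And>z. cmod z = 1 \<Longrightarrow> Re (poly p z * cnj (poly q' z)) = Re (poly R z)"
    using pCons.IH by blast
  show ?case
  proof (intro exI allI impI)
    fix z :: complex assume z: "cmod z = 1"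
    then have "z * cnj z = 1" by (simp add: complex_norm_square[symmetric])
    then have "poly (pCons a p) z * cnj (poly q z)
      = a * cnj b + cnj (cnj a * z * poly q' z) + cnj b * z * poly p z + poly p z * cnj (poly q' z)"
      by (simp add: q algebra_simps)
    then have "Re (poly (pCons a p) z * cnj (poly q z))
      = Re (a * cnj b) + Re (cnj a * z * poly q' z) + Re (cnj b * z * poly p z) + Re (poly R z)"
      using R[OF z] by (simp only: plus_complex.sel cnj.sel)
    also have "\<dots> = Re (poly ([:a * cnj b:] + pCons 0 (smult (cnj a) q') + pCons 0 (smult (cnj b) p) + R) z)"
      by (simp add: algebra_simps)
    finally show "Re (poly (pCons a p) z * cnj (poly q z)) = \<dots>" .
  qed
qed

text \<open>For complex A and B, the product of the real parts is half the real part of A B + A (cnj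
  B).\<close>

lemma Re_poly_mult_Re_poly:
  "\<exists>Q. \<forall>z. cmod z = 1 \<longrightarrow> Re (poly p z) * Re (poly q z) = Re (poly Q z)"
proof -
  obtain R where R: "\<And>z. cmod z = 1 \<Longrightarrow> Re (poly p z * cnj (poly q z)) = Re (poly R z)"
    using Re_poly_mult_cnj_poly by blast
  have "Re (poly p z) * Re (poly q z) = Re (poly (smult (1/2) (p * q + R)) z)" if "cmod z = 1" for z
    using R[OF that] by (simp add: field_simps)
  then show ?thesis by blast
qed

lemma Re_poly_dense_on_circle:
  fixes \<psi> :: "complex \<Rightarrow> real"
  assumes "continuous_on (sphere 0 1) \<psi>" "0 < e"
  obtains Q where "\<And>z. cmod z = 1 \<Longrightarrow> \<bar>\<psi> z - Re (poly Q z)\<bar> < e"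
proof -
  define P :: "(complex \<Rightarrow> real) \<Rightarrow> bool"
    where "P g \<longleftrightarrow> (\<exists>Q. \<forall>z. cmod z = 1 \<longrightarrow> g z = Re (poly Q z))" for g
  have "\<exists>g. P g \<and> (\<forall>z\<in>sphere 0 1. \<bar>\<psi> z - g z\<bar> < e)"
  proof (rule Stone_Weierstrass_HOL)
    show "P (\<lambda>x. c)" for c
      unfolding P_def by (intro exI[of _ "[:of_real c:]"]) simp
    show "continuous_on (sphere 0 1) g" if Pg: "P g" for g
    proof -
      obtain Q where "\<And>z. cmod z = 1 \<Longrightarrow> g z = Re (poly Q z)" using Pg unfolding P_def by blast
      then show ?thesis
        by (subst continuous_on_cong[of _ "sphere 0 1" g "\<lambda>z. Re (poly Q z)"]) (auto intro!: continuous_intros)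
    qed
    show "P (\<lambda>x. f x + g x)" if fg: "P f \<and> P g" for f g
    proof -
      obtain p q where "\<And>z. cmod z = 1 \<Longrightarrow> f z = Re (poly p z)" "\<And>z. cmod z = 1 \<Longrightarrow> g z = Re (poly q z)"
        using fg unfolding P_def by blast
      then show ?thesis unfolding P_def by (intro exI[of _ "p + q"]) simp
    qed
    show "P (\<lambda>x. f x * g x)" if fg: "P f \<and> P g" for f g
    proof -
      obtain p q where "\<And>z. cmod z = 1 \<Longrightarrow> f z = Re (poly p z)" "\<And>z. cmod z = 1 \<Longrightarrow> g z = Re (poly q z)"
        using fg unfolding P_def by blast
      then show ?thesis unfolding P_def using Re_poly_mult_Re_poly[of p q] by simp
    qed
    show "\<exists>f. P f \<and> f x \<noteq> f y" if xy: "x \<in> sphere 0 1 \<and> y \<in> sphere 0 1 \<and> x \<noteq> y" for x y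
    proof (cases "Re x = Re y")
      case True
      then have "Im x \<noteq> Im y" using xy complex_eqI by blast
      moreover have "P Im" unfolding P_def by (intro exI[of _ "[:0, - \<i>:]"]) simp
      ultimately show ?thesis by blast
    next
      case False
      moreover have "P Re" unfolding P_def by (intro exI[of _ "[:0, 1:]"]) simp
      ultimately show ?thesis by blast
    qed
  qed (use assms in auto)
  then show ?thesis using that unfolding P_def by fastforce
qed

text \<open>The normalisation 1 / (2 pi) is left out; the inequalities below carry 2 pi on their
  left-hand side instead.\<close>

definition poisson :: "complex \<Rightarrow> complex \<Rightarrow> real" where
  "poisson \<zeta> u = (1 - (cmod \<zeta>)\<^sup>2) / (cmod (u - \<zeta>))\<^sup>2"

lemma poisson_nonneg: "cmod \<zeta> < 1 \<Longrightarrow> 0 \<le> poisson \<zeta> u"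
  unfolding poisson_def by (simp add: abs_square_le_1 power_le_one)

lemma continuous_on_poisson [continuous_intros]:
  assumes "cmod \<zeta> < 1" "continuous_on A g" "\<And>t. t \<in> A \<Longrightarrow> cmod (g t) = 1"
  shows "continuous_on A (\<lambda>t. poisson \<zeta> (g t))"
  unfolding poisson_def using assms by (auto intro!: continuous_intros)

text \<open>Cauchy's formula for H multiplied by (1 - |\<zeta>|^2) / (1 - cnj \<zeta> u). This
  factor is 1 at \<zeta>, and on the circle |1 - cnj \<zeta> u| = |u - \<zeta>|, so in modulus the
  Cauchy kernel becomes the Poisson kernel.\<close>

lemma norm_le_poisson_integral:
  assumes hol: "H holomorphic_on cball 0 1" and z: "cmod \<zeta> < 1"
  shows "2 * pi * cmod (H \<zeta>) \<le> integral {0..2 * pi} (\<lambda>t. poisson \<zeta> (cis t) * cmod (H (cis t)))"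
proof -
  have nz: "1 - cnj \<zeta> * u \<noteq> 0" if "cmod u \<le> 1" for u
  proof
    assume "1 - cnj \<zeta> * u = 0"
    then have "cmod (cnj \<zeta> * u) = 1" by (metis diff_eq_diff_eq diff_self norm_one right_minus_eq)
    moreover have "cmod (cnj \<zeta> * u) \<le> cmod \<zeta> * 1"
      unfolding norm_mult complex_mod_cnj using that by (intro mult_left_mono) auto
    ultimately show False using z by simp
  qed
  define f where "f u = H u * (1 - (cmod \<zeta>)\<^sup>2) / (1 - cnj \<zeta> * u)" for u
  have "f holomorphic_on cball 0 1"
    unfolding f_def using nz by (intro holomorphic_intros hol) auto
  then have "((\<lambda>u. f u / (u - \<zeta>)) has_contour_integral (2 * of_real pi * \<i> * f \<zeta>)) (circlepath 0 1)"
    using z by (intro Cauchy_integral_circlepath_simple) auto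
  then have I: "((\<lambda>t. f (cis t) / (cis t - \<zeta>) * \<i> * cis t) has_integral (2 * of_real pi * \<i> * f \<zeta>)) {0..2 * pi}"
    unfolding circlepath_def by (subst (asm) has_contour_integral_part_circlepath_iff) auto
  have fz: "f \<zeta> = H \<zeta>"
  proof -
    have "(cmod \<zeta>)\<^sup>2 < 1" using z by (simp add: abs_square_less_1)
    then have "1 - (cmod \<zeta>)\<^sup>2 \<noteq> 0" by simp
    moreover have "1 - cnj \<zeta> * \<zeta> = of_real (1 - (cmod \<zeta>)\<^sup>2)"
      using complex_norm_square[of \<zeta>] by (simp add: mult.commute)
    ultimately show ?thesis unfolding f_def by (simp del: of_real_diff)
  qed
  have norm: "cmod (f (cis t) / (cis t - \<zeta>) * \<i> * cis t) = poisson \<zeta> (cis t) * cmod (H (cis t))" for t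
  proof -
    have "cmod (1 - cnj \<zeta> * cis t) = cmod (cis t * cnj (cis t - \<zeta>))"
      by (simp add: algebra_simps flip: complex_norm_square)
    then have *: "cmod (1 - cnj \<zeta> * cis t) = cmod (cis t - \<zeta>)"
      by (simp add: norm_mult del: complex_cnj_diff)
    have "0 \<le> 1 - (cmod \<zeta>)\<^sup>2" using z by (simp add: abs_square_le_1 power_le_one)
    then have "cmod (1 - of_real ((cmod \<zeta>)\<^sup>2) :: complex) = 1 - (cmod \<zeta>)\<^sup>2"
      by (metis norm_of_real of_real_1 of_real_diff abs_of_nonneg)
    then show ?thesis
      unfolding f_def poisson_def by (simp add: norm_mult norm_divide * power2_eq_square)
  qed
  have int: "(\<lambda>t. poisson \<zeta> (cis t) * cmod (H (cis t))) integrable_on {0..2 * pi}"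
    using z by (intro integrable_continuous_interval continuous_intros
        continuous_on_compose2[OF holomorphic_on_imp_continuous_on[OF hol]]) auto
  have "cmod (2 * of_real pi * \<i> * f \<zeta>) \<le> integral {0..2 * pi} (\<lambda>t. poisson \<zeta> (cis t) * cmod (H (cis t)))"
    using integral_norm_bound_integral[OF has_integral_integrable[OF I] int] norm I
    by (simp add: integral_unique)
  then show ?thesis by (simp add: fz norm_mult)
qed

text \<open>A polynomial Q with exp (Re Q) slightly above |F|^s on the circle makes |F exp (- Q /
  s)| at most 1 there, hence inside by the maximum principle. So |F|^s \<le> |exp Q| at \<zeta>, and
  the inequality for s = 1 applies to the holomorphic function exp Q. In this way zeros of F never
  have to be divided out.\<close>

lemma powr_norm_le_poisson_integral:
  assumes hol: "F holomorphic_on ball 0 1" and cont: "continuous_on (cball 0 1) F"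
    and z: "cmod \<zeta> < 1" and s: "0 < s"
  shows "2 * pi * cmod (F \<zeta>) powr s \<le> integral {0..2 * pi} (\<lambda>t. poisson \<zeta> (cis t) * cmod (F (cis t)) powr s)"
proof -
  have cF: "continuous_on {0..2*pi} (\<lambda>t. cmod (F (cis t)) powr s)"
    using s by (intro continuous_on_powr' continuous_intros continuous_on_compose2[OF cont]) auto
  have intF: "(\<lambda>t. poisson \<zeta> (cis t) * cmod (F (cis t)) powr s) integrable_on {0..2 * pi}"
    and int1: "(\<lambda>t. poisson \<zeta> (cis t)) integrable_on {0..2 * pi}"
    using z cF by (auto intro!: integrable_continuous_interval continuous_intros)
  define I where "I = integral {0..2 * pi} (\<lambda>t. poisson \<zeta> (cis t) * cmod (F (cis t)) powr s)"
  define J where "J = integral {0..2 * pi} (\<lambda>t. poisson \<zeta> (cis t))"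
  have J: "0 \<le> J" unfolding J_def using z int1 by (intro integral_nonneg poisson_nonneg) auto
  have contS: "continuous_on (sphere 0 1) (\<lambda>z. cmod (F z) powr s)"
    using s by (intro continuous_on_powr' continuous_intros continuous_on_subset[OF cont]) auto
  then have "compact ((\<lambda>z. cmod (F z) powr s) ` sphere 0 1)"
    by (intro compact_continuous_image) auto
  then have "bdd_above ((\<lambda>z. cmod (F z) powr s) ` sphere 0 1)"
    by (intro bounded_imp_bdd_above compact_imp_bounded)
  then obtain B where "\<forall>z\<in>sphere 0 1. cmod (F z) powr s \<le> B"
    by (auto simp: bdd_above_def)
  then have B: "cmod (F z) powr s \<le> B" if "cmod z = 1" for z
    using that by simp
  have B0: "0 \<le> B" using B[of 1] by (rule order_trans[rotated]) auto
  have main: "2 * pi * cmod (F \<zeta>) powr s \<le> I + e * J" if e: "0 < e" for e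
  proof -
    \<comment> \<open>Tolerance on the logarithmic scale: for all X between 0 and B, multiplying X +
      e / 2 by exp \<eta> gives at most X + e, and dividing it by exp \<eta> gives at least
      X.\<close>
    define \<eta> where "\<eta> = ln ((B + e) / (B + e / 2))"
    have ratio: "1 < (B + e) / (B + e / 2)" using B0 e by (simp add: less_divide_eq)
    have \<eta>: "0 < \<eta>" "exp \<eta> = (B + e) / (B + e / 2)"
      using ratio by (auto simp: \<eta>_def)
    \<comment> \<open>The summand e / 2 keeps the logarithm continuous at the zeros of F.\<close>
    have cln: "continuous_on (sphere 0 1) (\<lambda>z. ln (cmod (F z) powr s + e / 2))"
      using e by (intro continuous_intros contS) (smt (verit) powr_ge_zero half_gt_zero)
    obtain Q where Q: "\<And>z. cmod z = 1 \<Longrightarrow> \<bar>ln (cmod (F z) powr s + e / 2) - Re (poly Q z)\<bar> < \<eta>"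
      by (rule Re_poly_dense_on_circle[OF cln \<eta>(1)]) blast
    have upper: "exp (Re (poly Q u)) \<le> cmod (F u) powr s + e"
      and lower: "cmod (F u) powr s \<le> exp (Re (poly Q u))" if u: "cmod u = 1" for u
    proof -
      define X where "X = cmod (F u) powr s"
      have X: "0 \<le> X" "X \<le> B" using B[OF u] by (auto simp: X_def)
      have Xp: "0 < X + e / 2" using X e by simp
      have "exp (Re (poly Q u)) \<le> exp (ln (X + e / 2) + \<eta>)"
        using Q[OF u] by (simp add: X_def)
      also have "\<dots> = (X + e / 2) * (B + e) / (B + e / 2)"
        using Xp by (simp add: exp_add \<eta>)
      also have "\<dots> \<le> X + e"
      proof -
        have "(X + e) * (B + e / 2) - (X + e / 2) * (B + e) = (B - X) * e / 2" by (simp add: field_simps)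
        moreover have "0 \<le> (B - X) * e / 2" using X e by simp
        ultimately have "(X + e / 2) * (B + e) \<le> (X + e) * (B + e / 2)" by linarith
        then show ?thesis using B0 e by (simp add: divide_le_eq)
      qed
      finally show "exp (Re (poly Q u)) \<le> cmod (F u) powr s + e" by (simp add: X_def)
      have "X * (B + e) \<le> (X + e / 2) * (B + e / 2)"
      proof -
        have "(X + e / 2) * (B + e / 2) - X * (B + e) = (B - X) * e / 2 + e * e / 4" by (simp add: field_simps)
        moreover have "0 \<le> (B - X) * e / 2 + e * e / 4" using X e by simp
        ultimately show ?thesis by linarith
      qed
      then have "X \<le> (X + e / 2) * (B + e / 2) / (B + e)"
        using B0 e by (simp add: le_divide_eq)
      also have "\<dots> = exp (ln (X + e / 2) - \<eta>)"
        using Xp by (simp add: exp_diff \<eta>)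
      also have "\<dots> \<le> exp (Re (poly Q u))"
        using Q[OF u] by (simp add: X_def)
      finally show "cmod (F u) powr s \<le> exp (Re (poly Q u))" by (simp add: X_def)
    qed
    have "cmod (F \<zeta> * exp (- poly Q \<zeta> / of_real s)) \<le> 1"
    proof (rule maximum_modulus_frontier[of "\<lambda>z. F z * exp (- poly Q z / of_real s)" "cball 0 1"])
      show "(\<lambda>z. F z * exp (- poly Q z / of_real s)) holomorphic_on interior (cball 0 1)"
        using hol s by (auto intro!: holomorphic_intros)
      show "continuous_on (closure (cball 0 1)) (\<lambda>z. F z * exp (- poly Q z / of_real s))"
        using cont s by (auto intro!: continuous_intros)
      fix u :: complex assume "u \<in> frontier (cball 0 1)"
      then have u: "cmod u = 1" by simp
      have "cmod (F u) = (cmod (F u) powr s) powr (1 / s)" using s by (simp add: powr_powr)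
      also have "\<dots> \<le> exp (Re (poly Q u)) powr (1 / s)"
        using s lower[OF u] by (intro powr_mono2) auto
      also have "\<dots> = exp (Re (poly Q u) / s)"
        by (simp add: powr_def)
      finally have "cmod (F u) * exp (- (Re (poly Q u) / s)) \<le> exp (Re (poly Q u) / s) * exp (- (Re (poly Q u) / s))"
        by (intro mult_right_mono) auto
      then show "cmod (F u * exp (- poly Q u / of_real s)) \<le> 1"
        by (simp add: norm_mult flip: exp_add)
    qed (use z in auto)
    then have "cmod (F \<zeta>) \<le> exp (Re (poly Q \<zeta>) / s)"
      by (simp add: norm_mult norm_divide exp_minus field_simps)
    then have "cmod (F \<zeta>) powr s \<le> exp (Re (poly Q \<zeta>) / s) powr s"
      using s by (intro powr_mono2) auto
    also have "\<dots> = cmod (exp (poly Q \<zeta>))" using s by (simp add: powr_def)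
    finally have "2 * pi * cmod (F \<zeta>) powr s \<le> 2 * pi * cmod (exp (poly Q \<zeta>))" by simp
    also have "\<dots> \<le> integral {0..2 * pi} (\<lambda>t. poisson \<zeta> (cis t) * cmod (exp (poly Q (cis t))))"
      using z by (intro norm_le_poisson_integral holomorphic_intros)
    also have "\<dots> \<le> integral {0..2 * pi} (\<lambda>t. poisson \<zeta> (cis t) * cmod (F (cis t)) powr s + e * poisson \<zeta> (cis t))"
    proof (intro integral_le)
      show "(\<lambda>t. poisson \<zeta> (cis t) * cmod (exp (poly Q (cis t)))) integrable_on {0..2 * pi}"
        using z by (auto intro!: integrable_continuous_interval continuous_intros)
      show "(\<lambda>t. poisson \<zeta> (cis t) * cmod (F (cis t)) powr s + e * poisson \<zeta> (cis t)) integrable_on {0..2 * pi}"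
        by (intro integrable_add intF integrable_on_mult_right int1)
      fix t
      have "poisson \<zeta> (cis t) * cmod (exp (poly Q (cis t))) \<le> poisson \<zeta> (cis t) * (cmod (F (cis t)) powr s + e)"
        using upper[of "cis t"] z by (intro mult_left_mono poisson_nonneg) auto
      then show "poisson \<zeta> (cis t) * cmod (exp (poly Q (cis t)))
          \<le> poisson \<zeta> (cis t) * cmod (F (cis t)) powr s + e * poisson \<zeta> (cis t)"
        by (simp add: algebra_simps)
    qed
    also have "\<dots> = I + e * J"
      unfolding I_def J_def by (subst integral_add) (auto intro!: intF int1 integrable_on_mult_right)
    finally show ?thesis .
  qed
  show ?thesis unfolding I_def[symmetric]
  proof (rule field_le_epsilon)
    fix \<epsilon> :: real assume eps: "0 < \<epsilon>"
    have "\<epsilon> / (J + 1) * J \<le> \<epsilon>" using eps J by (simp add: field_simps)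
    then show "2 * pi * cmod (F \<zeta>) powr s \<le> I + \<epsilon>"
      using main[of "\<epsilon> / (J + 1)"] eps J by simp
  qed
qed

section \<open>The Poisson kernel on Stolz regions\<close>

lemma norm_cis_diff: "cmod (cis x - cis y) = 2 * \<bar>sin ((x - y) / 2)\<bar>"
proof -
  define u where "u = (x - y) / 2"
  have "(cmod (cis x - cis y))\<^sup>2 = (sin x ^ 2 + cos x ^ 2) + (sin y ^ 2 + cos y ^ 2) - 2 * cos (x - y)"
    unfolding cmod_power2 cos_diff by (simp add: power2_eq_square algebra_simps del: sin_cos_squared_add sin_cos_squared_add2)
  also have "x - y = 2 * u" by (simp add: u_def)
  also have "(sin x ^ 2 + cos x ^ 2) + (sin y ^ 2 + cos y ^ 2) - 2 * cos (2 * u) = 2 - 2 * cos (2 * u)" by simp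
  also have "\<dots> = (2 * sin u)\<^sup>2" by (simp add: cos_double_sin power_mult_distrib)
  finally have "cmod (cis x - cis y) = \<bar>2 * sin u\<bar>"
    by (metis abs_norm_cancel real_sqrt_abs)
  then show ?thesis by (simp add: u_def abs_mult)
qed

lemma norm_cis_diff_le: "cmod (cis x - cis y) \<le> \<bar>x - y\<bar>"
  using abs_sin_x_le_abs_x[of "(x - y) / 2"] by (simp add: norm_cis_diff)

text \<open>Jordan's inequality sin x \<ge> 2 x / pi, from the concavity of the sine, weakened by pi
  < 4.\<close>

lemma norm_cis_diff_ge:
  assumes "\<bar>x - y\<bar> \<le> pi"
  shows "\<bar>x - y\<bar> / 2 \<le> cmod (cis x - cis y)"
proof -
  have sin: "x / 2 \<le> sin x" if "0 \<le> x" "x \<le> pi / 2" for x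
  proof -
    have "convex_on {0..pi} (\<lambda>x. - sin x)"
      by (rule f''_ge0_imp_convex[of _ _ "\<lambda>x. - cos x" sin])
         (auto intro!: derivative_eq_intros sin_ge_zero)
    from convex_onD[OF this, of "2 * x / pi" 0 "pi / 2"] have "2 * x / pi \<le> sin x"
      using that by (simp add: field_simps)
    moreover have "x / 2 \<le> 2 * x / pi"
      using that mult_right_mono[of pi 4 x] pi_less_4 by (simp add: field_simps)
    ultimately show ?thesis by simp
  qed
  from sin[of "\<bar>x - y\<bar> / 2"] assms have "\<bar>x - y\<bar> / 4 \<le> sin (\<bar>x - y\<bar> / 2)" by simp
  also have "\<bar>x - y\<bar> / 2 = \<bar>(x - y) / 2\<bar>" by simp
  also have "sin \<bar>(x - y) / 2\<bar> \<le> \<bar>sin ((x - y) / 2)\<bar>"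
    by (cases "0 \<le> (x - y) / 2") (simp_all only: abs_of_nonneg abs_of_neg not_le sin_minus abs_ge_self abs_ge_minus_self)
  finally show ?thesis by (simp add: norm_cis_diff)
qed


text \<open>Here 2^k is the first power of two that is at least \<delta>; the term that carries the
  bound is the first j with |t| < 2^(k+j). The coefficient decays like 4^(-j) while the interval
  grows like 2^j, so against a maximal function the j-th term weighs about 2^(-j).\<close>

lemma inverse_square_kernel_le_dyadic:
  fixes \<delta> t :: real
  assumes d: "0 < \<delta>"
  obtains k :: int where "\<delta> \<le> 2 powr k"
    "\<And>t. ennreal (\<delta> / (max \<delta> \<bar>t\<bar>)\<^sup>2)
      \<le> (\<Sum>j. ennreal (4 / (4 ^ j * 2 powr k)) * indicator {t. \<bar>t\<bar> < 2 powr (k + int j)} t)"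
proof -
  define k where "k = \<lceil>log 2 \<delta>\<rceil>"
  have D1: "\<delta> \<le> 2 powr k"
    using d by (simp add: k_def le_powr_iff)
  have "real_of_int k < log 2 \<delta> + 1" by (simp add: k_def) linarith
  then have "2 powr k < 2 powr (log 2 \<delta> + 1)" by (intro powr_less_mono) auto
  then have D2: "2 powr k < 2 * \<delta>" using d by (simp add: powr_add)
  define D :: real where "D = 2 powr k"
  have D: "0 < D" "\<delta> \<le> D" "D < 2 * \<delta>" using D1 D2 by (auto simp: D_def)
  have pw: "2 powr (k + int j) = D * 2 ^ j" for j
    by (simp add: D_def powr_add powr_realpow)
  have "ennreal (\<delta> / (max \<delta> \<bar>t\<bar>)\<^sup>2)
      \<le> (\<Sum>j. ennreal (4 / (4 ^ j * D)) * indicator {t. \<bar>t\<bar> < D * 2 ^ j} t)" for t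
  proof -
    obtain n where "\<bar>t\<bar> / D < 2 ^ n" using real_arch_pow[of 2] by auto
    then have ex: "\<bar>t\<bar> < D * 2 ^ n" using D by (simp add: divide_less_eq mult.commute)
    define j where "j = (LEAST n. \<bar>t\<bar> < D * 2 ^ n)"
    have j: "\<bar>t\<bar> < D * 2 ^ j" unfolding j_def using ex by (rule LeastI)
    have "\<delta> / (max \<delta> \<bar>t\<bar>)\<^sup>2 \<le> 4 / (4 ^ j * D)"
    proof (cases j)
      case 0
      have "\<delta> / (max \<delta> \<bar>t\<bar>)\<^sup>2 \<le> \<delta> / \<delta>\<^sup>2"
        using d by (intro divide_left_mono power_mono) auto
      also have "\<dots> = 1 / \<delta>" using d by (simp add: power2_eq_square)
      also have "\<dots> \<le> 4 / D" using D d by (simp add: field_simps)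
      finally show ?thesis using 0 by simp
    next
      case (Suc i)
      have "\<not> \<bar>t\<bar> < D * 2 ^ i"
        using Suc not_less_Least[of i "\<lambda>n. \<bar>t\<bar> < D * 2 ^ n"] unfolding j_def by simp
      then have "(D * 2 ^ i)\<^sup>2 \<le> (max \<delta> \<bar>t\<bar>)\<^sup>2"
        using D by (intro power_mono) auto
      then have "\<delta> / (max \<delta> \<bar>t\<bar>)\<^sup>2 \<le> D / (D * 2 ^ i)\<^sup>2"
        using D d by (intro frac_le) auto
      also have "\<dots> = 4 / (4 ^ j * D)"
        using D by (simp add: Suc power2_eq_square power_mult_distrib flip: power_mult_distrib)
      finally show ?thesis .
    qed
    then have "ennreal (\<delta> / (max \<delta> \<bar>t\<bar>)\<^sup>2) \<le> (\<Sum>j\<in>{j}. ennreal (4 / (4 ^ j * D)) * indicator {t. \<bar>t\<bar> < D * 2 ^ j} t)"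
      using j by (simp add: ennreal_leI)
    also have "\<dots> \<le> (\<Sum>j. ennreal (4 / (4 ^ j * D)) * indicator {t. \<bar>t\<bar> < D * 2 ^ j} t)"
      by (rule sum_le_suminf) auto
    finally show ?thesis .
  qed
  then show ?thesis using that[of k] D1 unfolding pw D_def[symmetric] by blast
qed

text \<open>With \<delta> = 1 - |w| / \<rho>, the truncation |w| \<le> 2 \<rho> - 1 gives 1 - |w|
  \<le> 2 \<delta> and |w / \<rho> - w| \<le> \<delta>. The Stolz condition at w therefore passes to
  w / \<rho>, at scale \<delta>.\<close>

lemma poisson_le_stolz:
  assumes \<rho>: "0 < \<rho>" "\<rho> < 1" and w: "cmod w \<le> 2 * \<rho> - 1" "cmod (w - cis \<theta>) \<le> 5 * (1 - cmod w)"
    and y: "\<bar>y - \<theta>\<bar> \<le> pi"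
  shows "poisson (w / of_real \<rho>) (cis y) \<le> 1152 * ((1 - cmod w / \<rho>) / (max (1 - cmod w / \<rho>) \<bar>y - \<theta>\<bar>)\<^sup>2)"
    and "1 - \<rho> \<le> 1 - cmod w / \<rho>"
proof -
  define \<zeta> where "\<zeta> = w / of_real \<rho>"
  define \<delta> where "\<delta> = 1 - cmod w / \<rho>"
  have z: "cmod \<zeta> = 1 - \<delta>" using \<rho> by (simp add: \<zeta>_def \<delta>_def norm_divide)
  have "(\<rho> - cmod w) * \<rho> \<le> \<rho> - cmod w" using \<rho> w by (intro mult_left_le) auto
  then have d1: "\<rho> - cmod w \<le> \<delta>" using \<rho> by (simp add: \<delta>_def field_simps)
  have d2: "1 - cmod w \<le> 2 * (\<rho> - cmod w)" using w by simp
  have d3: "1 - \<rho> \<le> \<rho> - cmod w" using w by simp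
  show "1 - \<rho> \<le> 1 - cmod w / \<rho>" using d1 d3 by (simp add: \<delta>_def)
  have dpos: "0 < \<delta>" using d1 d3 \<rho> by simp
  have "\<delta> \<le> 1" using \<rho> by (simp add: \<delta>_def)
  have a: "\<delta> \<le> cmod (cis y - \<zeta>)"
    using norm_triangle_ineq2[of "cis y" \<zeta>] z by simp
  have zw: "cmod (\<zeta> - w) \<le> \<delta>"
  proof -
    have "\<zeta> - w = \<zeta> * of_real (1 - \<rho>)" using \<rho> by (simp add: \<zeta>_def field_simps)
    then have "cmod (\<zeta> - w) = cmod \<zeta> * (1 - \<rho>)" using \<rho> by (simp add: norm_mult del: of_real_diff)
    also have "\<dots> \<le> 1 * (1 - \<rho>)" using \<rho> z dpos by (intro mult_right_mono) auto
    finally show ?thesis using d1 d3 by simp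
  qed
  have "cmod (cis y - cis \<theta>) \<le> cmod (cis y - \<zeta>) + cmod (\<zeta> - w) + cmod (w - cis \<theta>)"
    using norm_triangle_ineq[of "cis y - \<zeta>" "\<zeta> - w"] norm_triangle_ineq[of "cis y - w" "w - cis \<theta>"] by simp
  \<comment> \<open>The three terms are at most 1, 1 and 5 * 2 times |cis y - \<zeta>|, because
    \<delta> is at most that distance.\<close>
  also have "\<dots> \<le> 12 * cmod (cis y - \<zeta>)"
    using a zw w(2) d1 d2 by simp
  finally have "\<bar>y - \<theta>\<bar> / 24 \<le> cmod (cis y - \<zeta>)"
    using norm_cis_diff_ge[OF y] by simp
  then have "max \<delta> \<bar>y - \<theta>\<bar> / 24 \<le> cmod (cis y - \<zeta>)" using a dpos by (simp add: max_def)
  then have b: "(max \<delta> \<bar>y - \<theta>\<bar> / 24)\<^sup>2 \<le> (cmod (cis y - \<zeta>))\<^sup>2"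
    using dpos by (intro power_mono) auto
  have "1 - (cmod \<zeta>)\<^sup>2 \<le> 2 * \<delta>" by (simp add: z power2_eq_square algebra_simps)
  \<comment> \<open>The 24 is 12 times the factor 2 between arc and chord, and 1152 = 2 *
    24^2.\<close>
  then have "poisson \<zeta> (cis y) \<le> (2 * \<delta>) / (max \<delta> \<bar>y - \<theta>\<bar> / 24)\<^sup>2"
    unfolding poisson_def using b dpos by (intro frac_le) (auto simp: max_def)
  also have "\<dots> = 1152 * (\<delta> / (max \<delta> \<bar>y - \<theta>\<bar>)\<^sup>2)"
    by (simp add: power_divide)
  finally show "poisson (w / of_real \<rho>) (cis y) \<le> 1152 * ((1 - cmod w / \<rho>) / (max (1 - cmod w / \<rho>) \<bar>y - \<theta>\<bar>)\<^sup>2)"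
    by (simp add: \<zeta>_def \<delta>_def)
qed

text \<open>Rescaling to the circle of radius \<rho> and rotating by \<theta> - pi makes the
  integral run over the window centred at \<theta>, on which |y - \<theta>| is comparable to the
  chord.\<close>

lemma powr_norm_le_poisson_arc:
  assumes hol: "f holomorphic_on ball 0 1" and \<rho>: "0 < \<rho>" "\<rho> < 1" and w: "cmod w < \<rho>" and s: "0 < s"
  shows "ennreal (cmod (f w) powr s) \<le>
    (\<integral>\<^sup>+y\<in>{\<theta> - pi..\<theta> + pi}. ennreal (poisson (w / of_real \<rho>) (cis y) * cmod (f (of_real \<rho> * cis y)) powr s) \<partial>lborel)"
proof -
  define F where "F z = f (of_real \<rho> * (cis (\<theta> - pi) * z))" for z
  define \<zeta> where "\<zeta> = w / of_real \<rho> * cis (pi - \<theta>)"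
  have z: "cmod \<zeta> < 1" using w \<rho> by (simp add: \<zeta>_def norm_mult norm_divide)
  have in1: "cmod (of_real \<rho> * (cis (\<theta> - pi) * z)) < 1" if "cmod z \<le> 1" for z
  proof -
    have "cmod (of_real \<rho> * (cis (\<theta> - pi) * z)) \<le> \<rho> * 1"
      using that \<rho> by (simp add: norm_mult mult_left_le)
    then show ?thesis using \<rho> by simp
  qed
  have holF: "F holomorphic_on cball 0 1"
    unfolding F_def using in1
    by (intro holomorphic_on_compose_gen[OF _ hol, unfolded o_def] holomorphic_intros) auto
  have "cis (\<theta> - pi) * \<zeta> = w / of_real \<rho> * (cis (\<theta> - pi) * cis (pi - \<theta>))"
    by (simp only: \<zeta>_def mult.left_commute)
  then have rot: "cis (\<theta> - pi) * \<zeta> = w / of_real \<rho>" by (simp add: cis_mult)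
  have Fz: "F \<zeta> = f w" using \<rho> by (simp add: F_def rot)
  have Fc: "F (cis t) = f (of_real \<rho> * cis (t + (\<theta> - pi)))" for t
    by (simp add: F_def cis_mult add.commute)
  have Pc: "poisson \<zeta> (cis t) = poisson (w / of_real \<rho>) (cis (t + (\<theta> - pi)))" for t
  proof -
    have "cmod (cis (t + (\<theta> - pi)) - w / of_real \<rho>) = cmod (cis (\<theta> - pi) * (cis t - \<zeta>))"
      by (simp add: right_diff_distrib rot cis_mult add.commute)
    moreover have "cmod \<zeta> = cmod (w / of_real \<rho>)" by (simp add: \<zeta>_def norm_mult norm_divide)
    ultimately show ?thesis by (simp add: poisson_def norm_mult)
  qed
  define g where "g t = poisson \<zeta> (cis t) * cmod (F (cis t)) powr s" for t
  have cg: "continuous_on {0..2*pi} g"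
    unfolding g_def using z s
    by (intro continuous_intros continuous_on_powr' continuous_on_compose2[OF holomorphic_on_imp_continuous_on[OF holF]]) auto
  \<comment> \<open>The normalising factor 2 pi \<ge> 1 is given away.\<close>
  have "cmod (f w) powr s \<le> 2 * pi * cmod (F \<zeta>) powr s"
    using pi_ge_two by (simp add: Fz mult_le_cancel_right1)
  also have "\<dots> \<le> integral {0..2 * pi} g"
    unfolding g_def by (intro powr_norm_le_poisson_integral holomorphic_on_subset[OF holF]
        holomorphic_on_imp_continuous_on[OF holF] z s) auto
  finally have "ennreal (cmod (f w) powr s) \<le> ennreal (integral {0..2 * pi} g)"
    by (rule ennreal_leI)
  also have "\<dots> = (\<integral>\<^sup>+t. ennreal (g t) * indicator {0..2 * pi} t \<partial>lborel)"
    using z by (intro nn_integral_has_integral_lebesgue'[symmetric] integrable_integral integrable_continuous_interval cg)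
       (auto simp: g_def poisson_nonneg)
  also have "\<dots> = (\<integral>\<^sup>+y\<in>{\<theta> - pi..\<theta> + pi}. ennreal (poisson (w / of_real \<rho>) (cis y) * cmod (f (of_real \<rho> * cis y)) powr s) \<partial>lborel)"
  proof -
    define h where "h y = ennreal (poisson (w / of_real \<rho>) (cis y) * cmod (f (of_real \<rho> * cis y)) powr s) * indicator {\<theta> - pi..\<theta> + pi} y" for y
    have "continuous_on UNIV (\<lambda>y. cmod (f (of_real \<rho> * cis y)) powr s)"
      using s \<rho> by (intro continuous_intros continuous_on_powr' continuous_on_compose2[OF holomorphic_on_imp_continuous_on[OF hol]])
        (auto simp: norm_mult)
    then have [measurable]: "(\<lambda>y. cmod (f (of_real \<rho> * cis y)) powr s) \<in> borel_measurable borel"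
      by (rule borel_measurable_continuous_onI)
    have [measurable]: "h \<in> borel_measurable borel"
      unfolding h_def poisson_def by measurable
    have "(\<integral>\<^sup>+t. ennreal (g t) * indicator {0..2 * pi} t \<partial>lborel) = (\<integral>\<^sup>+t. h (t + (\<theta> - pi)) \<partial>lborel)"
      by (intro nn_integral_cong) (auto simp: h_def g_def Fc Pc split: split_indicator)
    also have "\<dots> = (\<integral>\<^sup>+y. h y \<partial>lborel)" by (rule nn_integral_shift) measurable
    finally show ?thesis unfolding h_def .
  qed
  finally show ?thesis .
qed

text \<open>The kernel at w has width \<delta> \<ge> 1 - \<rho>, so \<open>avg\<close> is asked for
  only on arcs of half-length at least 1 - \<rho>; hence g may be built from averages at that scale.
  The doubled arc in \<open>avg\<close> leaves room for the windows of such averages.\<close>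

lemma powr_norm_le_hl_max:
  assumes hol: "f holomorphic_on ball 0 1" and \<rho>: "0 < \<rho>" "\<rho> < 1"
    and w: "cmod w \<le> 2 * \<rho> - 1" "cmod (w - cis \<theta>) \<le> 5 * (1 - cmod w)" and s: "0 < s"
    and avg: "\<And>u. 1 - \<rho> \<le> u \<Longrightarrow> u \<le> pi \<Longrightarrow>
       (\<integral>\<^sup>+y\<in>ball \<theta> u. ennreal (cmod (f (of_real \<rho> * cis y)) powr s) \<partial>lborel)
         \<le> c * (\<integral>\<^sup>+y\<in>ball \<theta> (2 * u). g y \<partial>lborel)"
  shows "ennreal (cmod (f w) powr s) \<le> 36864 * c * hl_max g \<theta>"
proof -
  define \<delta> where "\<delta> = 1 - cmod w / \<rho>"
  have d: "1 - \<rho> \<le> \<delta>" unfolding \<delta>_def using poisson_le_stolz(2)[OF \<rho> w, of \<theta>] by simp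
  then have dpos: "0 < \<delta>" using \<rho> by simp
  obtain k :: int where k: "\<delta> \<le> 2 powr k"
    "\<And>t. ennreal (\<delta> / (max \<delta> \<bar>t\<bar>)\<^sup>2)
      \<le> (\<Sum>j. ennreal (4 / (4 ^ j * 2 powr k)) * indicator {t. \<bar>t\<bar> < 2 powr (k + int j)} t)"
    using inverse_square_kernel_le_dyadic[OF dpos] by blast
  define G where "G y = ennreal (cmod (f (of_real \<rho> * cis y)) powr s)" for y
  have "continuous_on UNIV (\<lambda>y. cmod (f (of_real \<rho> * cis y)) powr s)"
    using s \<rho> by (intro continuous_intros continuous_on_powr' continuous_on_compose2[OF holomorphic_on_imp_continuous_on[OF hol]])
      (auto simp: norm_mult)
  then have [measurable]: "(\<lambda>y. cmod (f (of_real \<rho> * cis y)) powr s) \<in> borel_measurable borel"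
    by (rule borel_measurable_continuous_onI)
  have [measurable]: "G \<in> borel_measurable borel" unfolding G_def by measurable
  \<comment> \<open>The cap pi keeps the arcs inside the window, where the kernel estimate
    holds.\<close>
  define u where "u j = min (2 powr (k + int j)) pi" for j :: nat
  have u: "1 - \<rho> \<le> u j" "u j \<le> pi" for j
  proof -
    have "2 powr k \<le> (2::real) powr (k + int j)" by (intro powr_mono) auto
    then have "1 - \<rho> \<le> 2 powr (k + int j)" using d k(1) by linarith
    then show "1 - \<rho> \<le> u j" using \<rho> pi_ge_two by (auto simp: u_def)
  qed (simp add: u_def)
  have part: "(\<integral>\<^sup>+y\<in>ball \<theta> (u j). G y \<partial>lborel) \<le> c * (ennreal (4 * (2 ^ j * 2 powr k)) * hl_max g \<theta>)" for j
  proof -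
    define R :: real where "R = 2 powr (k + int j + 1)"
    have R: "0 < R" "R = 2 * (2 ^ j * 2 powr k)" by (auto simp: R_def powr_add powr_realpow)
    have "2 * u j \<le> R" by (simp add: u_def R_def powr_add)
    then have sub: "ball \<theta> (2 * u j) \<subseteq> ball \<theta> R" by (rule subset_ball)
    have "(\<integral>\<^sup>+y\<in>ball \<theta> (u j). G y \<partial>lborel) \<le> c * (\<integral>\<^sup>+y\<in>ball \<theta> (2 * u j). g y \<partial>lborel)"
      unfolding G_def by (rule avg[OF u])
    also have "\<dots> \<le> c * (\<integral>\<^sup>+y\<in>ball \<theta> R. g y \<partial>lborel)"
      using sub by (intro mult_left_mono nn_integral_mono) (auto split: split_indicator simp del: mem_ball)
    also have "(\<integral>\<^sup>+y\<in>ball \<theta> R. g y \<partial>lborel) = ennreal (2 * R) * ball_mean g (k + int j + 1) \<theta>"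
      using R unfolding ball_mean_def R_def[symmetric] of_int_add of_int_1 of_int_of_nat_eq
      by (simp add: R_def flip: mult.assoc ennreal_mult)
    also have "\<dots> \<le> ennreal (2 * R) * hl_max g \<theta>"
      by (intro mult_left_mono ball_mean_le_hl_max) auto
    finally show ?thesis using R by (simp add: mult_left_mono)
  qed
  \<comment> \<open>The balls are open and capped at pi, so the two end points of the window are
    left out; they form a null set.\<close>
  have ker: "ennreal (poisson (w / of_real \<rho>) (cis y)) * indicator {\<theta> - pi..\<theta> + pi} y
     \<le> (\<Sum>j. ennreal (4608 / (4 ^ j * 2 powr k)) * indicator (ball \<theta> (u j)) y)"
    if y: "y \<noteq> \<theta> - pi" "y \<noteq> \<theta> + pi" for y
  proof (cases "y \<in> {\<theta> - pi..\<theta> + pi}")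
    case True
    then have yp: "\<bar>y - \<theta>\<bar> < pi" using y by (auto simp: abs_less_iff)
    have "ennreal (poisson (w / of_real \<rho>) (cis y)) \<le> ennreal (1152 * (\<delta> / (max \<delta> \<bar>y - \<theta>\<bar>)\<^sup>2))"
      unfolding \<delta>_def using yp by (intro ennreal_leI poisson_le_stolz(1) \<rho> w) auto
    also have "\<dots> = 1152 * ennreal (\<delta> / (max \<delta> \<bar>y - \<theta>\<bar>)\<^sup>2)"
      using dpos by (subst ennreal_mult) auto
    also have "\<dots> \<le> 1152 * (\<Sum>j. ennreal (4 / (4 ^ j * 2 powr k)) * indicator {t. \<bar>t\<bar> < 2 powr (k + int j)} (y - \<theta>))"
      by (intro mult_left_mono k) auto
    also have "\<dots> = (\<Sum>j. 1152 * (ennreal (4 / (4 ^ j * 2 powr k)) * indicator {t. \<bar>t\<bar> < 2 powr (k + int j)} (y - \<theta>)))"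
      by (rule ennreal_suminf_cmult[symmetric])
    also have "\<dots> = (\<Sum>j. ennreal (4608 / (4 ^ j * 2 powr k)) * indicator (ball \<theta> (u j)) y)"
    proof (intro suminf_cong)
      fix j
      have "1152 * ennreal (4 / (4 ^ j * 2 powr k)) = ennreal (1152 * (4 / (4 ^ j * 2 powr k)))"
        by (subst ennreal_mult) auto
      moreover have "(indicator {t. \<bar>t\<bar> < 2 powr (k + int j)} (y - \<theta>) :: ennreal) = indicator (ball \<theta> (u j)) y"
        using yp by (auto simp: u_def dist_real_def abs_minus_commute split: split_indicator)
      ultimately show "1152 * (ennreal (4 / (4 ^ j * 2 powr k)) * indicator {t. \<bar>t\<bar> < 2 powr (k + int j)} (y - \<theta>))
        = ennreal (4608 / (4 ^ j * 2 powr k)) * indicator (ball \<theta> (u j)) y"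
        by (simp flip: mult.assoc)
    qed
    finally show ?thesis using True by simp
  qed simp
  have "cmod w < \<rho>" using w(1) \<rho> by simp
  then have "ennreal (cmod (f w) powr s)
     \<le> (\<integral>\<^sup>+y\<in>{\<theta> - pi..\<theta> + pi}. ennreal (poisson (w / of_real \<rho>) (cis y) * cmod (f (of_real \<rho> * cis y)) powr s) \<partial>lborel)"
    by (intro powr_norm_le_poisson_arc hol \<rho> s)
  also have "\<dots> \<le> (\<integral>\<^sup>+y. (\<Sum>j. ennreal (4608 / (4 ^ j * 2 powr k)) * (G y * indicator (ball \<theta> (u j)) y)) \<partial>lborel)"
  proof (intro nn_integral_mono_AE eventually_mono[OF eventually_conj[OF AE_lborel_singleton[of "\<theta> - pi"] AE_lborel_singleton[of "\<theta> + pi"]]])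
    fix y assume "y \<noteq> \<theta> - pi \<and> y \<noteq> \<theta> + pi"
    then have y: "y \<noteq> \<theta> - pi" "y \<noteq> \<theta> + pi" by auto
    have "cmod (w / of_real \<rho>) < 1" using \<open>cmod w < \<rho>\<close> \<rho> by (simp add: norm_divide)
    then have "ennreal (poisson (w / of_real \<rho>) (cis y) * cmod (f (of_real \<rho> * cis y)) powr s) * indicator {\<theta> - pi..\<theta> + pi} y
      = G y * (ennreal (poisson (w / of_real \<rho>) (cis y)) * indicator {\<theta> - pi..\<theta> + pi} y)"
      by (simp add: G_def ennreal_mult poisson_nonneg ac_simps)
    also have "\<dots> \<le> G y * (\<Sum>j. ennreal (4608 / (4 ^ j * 2 powr k)) * indicator (ball \<theta> (u j)) y)"
      by (intro mult_left_mono ker y) auto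
    also have "\<dots> = (\<Sum>j. G y * (ennreal (4608 / (4 ^ j * 2 powr k)) * indicator (ball \<theta> (u j)) y))"
      by (rule ennreal_suminf_cmult[symmetric])
    finally show "ennreal (poisson (w / of_real \<rho>) (cis y) * cmod (f (of_real \<rho> * cis y)) powr s) * indicator {\<theta> - pi..\<theta> + pi} y
      \<le> (\<Sum>j. ennreal (4608 / (4 ^ j * 2 powr k)) * (G y * indicator (ball \<theta> (u j)) y))"
      by (simp add: mult.left_commute)
  qed
  also have "\<dots> = (\<Sum>j. \<integral>\<^sup>+y. ennreal (4608 / (4 ^ j * 2 powr k)) * (G y * indicator (ball \<theta> (u j)) y) \<partial>lborel)"
    by (rule nn_integral_suminf) measurable
  also have "\<dots> = (\<Sum>j. ennreal (4608 / (4 ^ j * 2 powr k)) * (\<integral>\<^sup>+y\<in>ball \<theta> (u j). G y \<partial>lborel))"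
    by (intro suminf_cong nn_integral_cmult) measurable
  \<comment> \<open>Coefficients of order 4^(-j) against arcs of order 2^j leave a geometric series
    with sum 2; altogether 36864 = 2 * 4 * 4 * 1152.\<close>
  also have "\<dots> \<le> (\<Sum>j. 18432 * c * hl_max g \<theta> * ennreal ((1 / 2) ^ j))"
  proof (intro suminf_le summableI)
    fix j
    have "ennreal (4608 / (4 ^ j * 2 powr k)) * (\<integral>\<^sup>+y\<in>ball \<theta> (u j). G y \<partial>lborel)
      \<le> ennreal (4608 / (4 ^ j * 2 powr k)) * (c * (ennreal (4 * (2 ^ j * 2 powr k)) * hl_max g \<theta>))"
      by (intro mult_left_mono part) auto
    also have "\<dots> = (ennreal (4608 / (4 ^ j * 2 powr k)) * ennreal (4 * (2 ^ j * 2 powr k))) * (c * hl_max g \<theta>)"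
      by (simp add: ac_simps)
    also have "ennreal (4608 / (4 ^ j * 2 powr k)) * ennreal (4 * (2 ^ j * 2 powr k)) = ennreal (18432 * (1 / 2) ^ j)"
      by (subst ennreal_mult[symmetric]) (auto simp: power_divide field_simps simp flip: power_mult_distrib)
    also have "ennreal (18432 * (1 / 2) ^ j) = 18432 * ennreal ((1 / 2) ^ j)"
      by (subst ennreal_mult) auto
    finally show "ennreal (4608 / (4 ^ j * 2 powr k)) * (\<integral>\<^sup>+y\<in>ball \<theta> (u j). G y \<partial>lborel)
      \<le> 18432 * c * hl_max g \<theta> * ennreal ((1 / 2) ^ j)"
      by (simp add: ac_simps)
  qed
  also have "\<dots> = 18432 * c * hl_max g \<theta> * (\<Sum>j. ennreal ((1 / 2) ^ j))"
    by (rule ennreal_suminf_cmult)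
  also have "(\<Sum>j. ennreal ((1 / 2) ^ j)) = ennreal (\<Sum>j. (1 / 2) ^ j)"
    by (intro suminf_ennreal2 summable_geometric) auto
  also have "(\<Sum>j. (1 / 2 :: real) ^ j) = 2" by (simp add: suminf_geometric)
  also have "18432 * c * hl_max g \<theta> * ennreal 2 = (18432 * 2) * c * hl_max g \<theta>"
    by (simp only: ennreal_numeral mult_ac)
  finally show ?thesis by simp
qed

section \<open>Radial weights\<close>

text \<open>\<open>Arg\<close> is continuous off the nonpositive reals and takes only the values 0
  and pi on them.\<close>

lemma borel_measurable_Arg [measurable]: "Arg \<in> borel_measurable borel"
proof -
  have [measurable]: "(\<real>\<^sub>\<le>\<^sub>0 :: complex set) \<in> sets borel"
    by (intro borel_closed closed_nonpos_Reals_complex)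
  have [measurable]: "(\<lambda>z. indicator (- \<real>\<^sub>\<le>\<^sub>0) z *\<^sub>R Arg z) \<in> borel_measurable borel"
    by (intro borel_measurable_continuous_on_indicator continuous_on_Arg) auto
  have "Arg = (\<lambda>z. if z \<in> \<real>\<^sub>\<le>\<^sub>0 then (if z = 0 then 0 else pi) else indicator (- \<real>\<^sub>\<le>\<^sub>0) z *\<^sub>R Arg z)"
    by (auto simp: fun_eq_iff Arg_zero Arg_eq_pi complex_nonpos_Reals_iff complex_eq_iff less_le)
       (metis Arg_zero complex_eqI zero_complex.sel)
  also have "\<dots> \<in> borel_measurable borel" by measurable
  finally show ?thesis .
qed

lemma sets_Gamma_region [measurable]: "Gamma_region \<xi> \<in> sets borel"
  unfolding Gamma_region_def by measurable

lemma Arg_rcis_eq: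
  assumes "0 < r"
  shows "\<exists>k::int. Arg (of_real r * cis t) = t + 2 * pi * of_int k"
proof -
  have "cis (Arg (of_real r * cis t)) = cis t"
    using assms by (simp add: cis_Arg sgn_mult sgn_of_real)
  then show ?thesis by (simp add: cis.code complex_eq_iff sin_cos_eq_iff[symmetric])
qed

text \<open>For t within pi of \<theta>, shifting by a nonzero multiple of 2 pi leaves a difference
  of at least pi > 1 - r, so the reduction modulo 2 pi drops out.\<close>

lemma polar_mem_Gamma_region_iff:
  assumes r: "0 < r" and t: "\<bar>t - \<theta>\<bar> \<le> pi"
  shows "of_real r * cis t \<in> Gamma_region (cis \<theta>) \<longleftrightarrow> r < 1 \<and> t \<in> ball \<theta> (1 - r)"
proof -
  obtain i :: int where i: "Arg (of_real r * cis t) = t + 2 * pi * of_int i"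
    using Arg_rcis_eq[OF r] by blast
  obtain j :: int where j: "Arg (cis \<theta>) = \<theta> + 2 * pi * of_int j"
    using Arg_rcis_eq[of 1 \<theta>] by auto
  have nz: "pi \<le> \<bar>t - \<theta> - 2 * pi * of_int k\<bar>" if "k \<noteq> 0" for k :: int
  proof -
    have "2 * pi * 1 \<le> 2 * pi * \<bar>of_int k\<bar>" using that by (intro mult_left_mono) auto
    then have "2 * pi \<le> \<bar>2 * pi * of_int k\<bar>" by (simp add: abs_mult)
    then show ?thesis using t by linarith
  qed
  have "of_real r * cis t \<in> Gamma_region (cis \<theta>) \<longleftrightarrow>
    r < 1 \<and> (\<exists>k::int. \<bar>t - \<theta> - 2 * pi * of_int (k + j - i)\<bar> < 1 - r)"
  proof -
    have mem: "z \<in> Gamma_region (cis \<theta>) \<longleftrightarrow>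
      cmod z < 1 \<and> (\<exists>k::int. \<bar>Arg z - Arg (cis \<theta>) - 2 * pi * of_int k\<bar> < 1 - cmod z)" for z
      by (simp add: Gamma_region_def)
    have c: "cmod (of_real r * cis t) = r" using r by (simp add: norm_mult)
    have e: "\<bar>t + 2 * pi * of_int i - (\<theta> + 2 * pi * of_int j) - 2 * pi * of_int k\<bar>
       = \<bar>t - \<theta> - 2 * pi * of_int (k + j - i)\<bar>" for k :: int
      by (simp add: algebra_simps)
    show ?thesis unfolding mem i j c e ..
  qed
  also have "\<dots> \<longleftrightarrow> r < 1 \<and> (\<exists>k::int. \<bar>t - \<theta> - 2 * pi * of_int k\<bar> < 1 - r)"
  proof -
    have "(\<exists>k::int. P (k + j - i)) \<longleftrightarrow> (\<exists>k. P k)" for P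
    proof
      assume "\<exists>k. P k"
      then obtain k where "P ((k - j + i) + j - i)" by auto
      then show "\<exists>k. P (k + j - i)" by blast
    qed blast
    from this[of "\<lambda>k. \<bar>t - \<theta> - 2 * pi * of_int k\<bar> < 1 - r"] show ?thesis by (simp only:)
  qed
  also have "\<dots> \<longleftrightarrow> r < 1 \<and> \<bar>t - \<theta>\<bar> < 1 - r"
  proof -
    have zero: "k = 0" if "\<bar>t - \<theta> - 2 * pi * of_int k\<bar> < 1 - r" for k :: int
    proof (rule ccontr)
      assume "k \<noteq> 0"
      from nz[OF this] that r pi_ge_two show False by linarith
    qed
    have "(\<exists>k::int. \<bar>t - \<theta> - 2 * pi * of_int k\<bar> < 1 - r) \<longleftrightarrow> \<bar>t - \<theta>\<bar> < 1 - r"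
    proof
      assume "\<exists>k::int. \<bar>t - \<theta> - 2 * pi * of_int k\<bar> < 1 - r"
      then obtain k :: int where k: "\<bar>t - \<theta> - 2 * pi * of_int k\<bar> < 1 - r" ..
      with zero[OF k] show "\<bar>t - \<theta>\<bar> < 1 - r" by simp
    qed (rule exI[of _ 0], simp)
    then show ?thesis by (rule arg_cong)
  qed
  finally show ?thesis unfolding mem_ball dist_real_def abs_minus_commute[of \<theta> t] .
qed

section \<open>From a radial weight to a Borel density\<close>

text \<open>In polar coordinates almost every ray meets a null set of the plane in a null set of
  radii; one such ray is enough.\<close>

lemma AE_lborel_radial_section:
  assumes "AE z in lborel. P (z :: complex)"
  obtains t where "AE r in lborel. 0 < r \<longrightarrow> P (of_real r * cis t)"
proof -
  from AE_E3[OF assms] obtain N where N: "\<And>z. z \<notin> N \<Longrightarrow> P z" "N \<in> null_sets lborel"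
    by (auto simp: subset_eq)
  then have [measurable]: "N \<in> sets borel" by auto
  have "(\<integral>\<^sup>+t\<in>{0..<0 + 2 * pi}. radial_integral (indicator N) t \<partial>lborel) = 0"
    using N by (subst nn_integral_polar[symmetric]) auto
  then have "AE t in lborel. radial_integral (indicator N) t * indicator {0..<0 + 2 * pi} t = 0"
    by (subst (asm) nn_integral_0_iff_AE) measurable
  moreover have "\<not> (AE t in lborel. t \<notin> {0..<2 * pi})"
    by (subst AE_iff_measurable[of "{0..<2 * pi}"]) auto
  ultimately obtain t where "radial_integral (indicator N) t = 0"
  proof (rule_tac ccontr)
    assume "\<not> thesis"
    then have "radial_integral (indicator N) t \<noteq> 0" for t using that by blast
    with \<open>AE t in lborel. radial_integral (indicator N) t * indicator {0..<0 + 2 * pi} t = 0\<close>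
    have "AE t in lborel. t \<notin> {0..<2 * pi}" by (auto split: split_indicator)
    with \<open>\<not> (AE t in lborel. t \<notin> {0..<2 * pi})\<close> show False by blast
  qed
  then have "AE r in lborel. indicator N (of_real r * cis t) * ennreal r * indicator {0<..} r = 0"
    unfolding radial_integral_def by (subst (asm) nn_integral_0_iff_AE) measurable
  then have "AE r in lborel. 0 < r \<longrightarrow> P (of_real r * cis t)"
    by (rule eventually_mono) (use N in \<open>auto split: split_indicator_asm\<close>)
  then show ?thesis by (rule that)
qed

text \<open>The opposite direction: circles whose radii form a null set fill a null set of the
  plane.\<close>

lemma AE_lborel_cmod:
  assumes "AE r in lborel. 0 < r \<longrightarrow> P r"
  shows "AE z in lborel. z \<noteq> 0 \<longrightarrow> P (cmod z)"
proof -
  from AE_E3[OF assms] obtain N where N: "\<And>r. r \<notin> N \<Longrightarrow> 0 < r \<longrightarrow> P r" "N \<in> null_sets lborel"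
    by (auto simp: subset_eq)
  then have [measurable]: "N \<in> sets borel" by auto
  have "radial_integral (\<lambda>z. indicator N (cmod z)) t = 0" for t
  proof -
    have "AE r in lborel. r \<notin> N" using N by (intro AE_not_in) auto
    then have "AE r in lborel. indicator N (cmod (of_real r * cis t)) * ennreal r * indicator {0<..} r = 0"
      by (rule eventually_mono) (auto simp: norm_mult split: split_indicator)
    then show ?thesis unfolding radial_integral_def
      by (subst nn_integral_0_iff_AE) auto
  qed
  then have "(\<integral>\<^sup>+z. indicator N (cmod z) \<partial>(lborel :: complex measure)) = 0"
    by (subst nn_integral_polar[of _ 0]) auto
  then have "AE z in lborel. (indicator N (cmod z) :: ennreal) = 0"
    by (subst (asm) nn_integral_0_iff_AE) auto
  then show ?thesis
    by (rule eventually_mono) (use N in \<open>auto split: split_indicator_asm\<close>)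
qed

text \<open>A weight need not be Borel, so it is replaced by a Borel function of the radius.\<close>

definition radial_density :: "(complex \<Rightarrow> real) \<Rightarrow> (real \<Rightarrow> real) \<Rightarrow> bool" where
  "radial_density \<omega> g \<longleftrightarrow> g \<in> borel_measurable borel \<and> (\<forall>r. 0 \<le> g r) \<and>
     (AE r in lborel. 0 < r \<and> r < 1 \<longrightarrow> \<omega> (of_real r) = g r) \<and>
     (AE z in lborel. z \<in> \<bbbD> \<longrightarrow> \<omega> z = g (cmod z)) \<and>
     (\<integral>\<^sup>+r. ennreal (g r * r) * indicator {0<..<1} r \<partial>lborel) < top"

text \<open>A Borel version of \<omega> in the plane says nothing about \<omega> on the positive
  axis, which is a null set, yet \<open>weight_hat\<close> and \<open>L_norm\<close> use exactly
  those values. Along a suitable ray the Borel version is right for almost every radius, and radial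
  symmetry carries its values to the axis.\<close>

lemma radial_weight_imp_radial_density:
  assumes "radial_weight \<omega>"
  obtains g where "radial_density \<omega> g"
proof -
  have nonneg: "\<And>z. z \<in> \<bbbD> \<Longrightarrow> 0 \<le> \<omega> z" and int: "integrable lebesgue (\<lambda>z. indicator \<bbbD> z *\<^sub>R \<omega> z)"
    and rad: "\<And>z. z \<in> \<bbbD> \<Longrightarrow> \<omega> z = \<omega> (of_real (cmod z))"
    using assms unfolding radial_weight_def weight_def set_integrable_def by blast+
  obtain h where h [measurable]: "h \<in> borel_measurable lborel"
    and hae: "AE z in lborel. indicator \<bbbD> z *\<^sub>R \<omega> z = h z"
    using completion_ex_borel_measurable_real[OF borel_measurable_integrable[OF int]] by blast
  obtain t where t: "AE r in lborel. 0 < r \<longrightarrow> indicator \<bbbD> (of_real r * cis t) *\<^sub>R \<omega> (of_real r * cis t) = h (of_real r * cis t)"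
    by (rule AE_lborel_radial_section[OF hae])
  \<comment> \<open>Clipping at 0 makes g nonnegative everywhere and changes nothing at almost all
    radii in (0, 1).\<close>
  define g where "g r = max 0 (h (of_real r * cis t))" for r
  have gm [measurable]: "g \<in> borel_measurable borel" unfolding g_def by measurable
  have g0: "0 \<le> g r" for r by (simp add: g_def)
  have g1: "AE r in lborel. 0 < r \<longrightarrow> r < 1 \<longrightarrow> \<omega> (of_real r) = g r"
    using t
  proof (rule eventually_mono, intro impI)
    fix r :: real assume "0 < r" "r < 1"
      and eq: "0 < r \<longrightarrow> indicator \<bbbD> (of_real r * cis t) *\<^sub>R \<omega> (of_real r * cis t) = h (of_real r * cis t)"
    then have "of_real r * cis t \<in> \<bbbD>" "cmod (of_real r * cis t) = r" by (auto simp: norm_mult)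
    then show "\<omega> (of_real r) = g r"
      using eq \<open>0 < r\<close> rad[of "of_real r * cis t"] nonneg[of "of_real r * cis t"] by (simp add: g_def)
  qed
  have "AE z in lborel. z \<noteq> 0 \<longrightarrow> (cmod z < 1 \<longrightarrow> \<omega> (of_real (cmod z)) = g (cmod z))"
    by (rule AE_lborel_cmod[OF g1])
  then have g2: "AE z in lborel. z \<in> \<bbbD> \<longrightarrow> \<omega> z = g (cmod z)"
    using AE_lborel_singleton[of "0::complex"]
  proof eventually_elim
    case (elim z)
    show ?case
    proof
      assume z: "z \<in> \<bbbD>"
      then have "\<omega> z = \<omega> (of_real (cmod z))" by (rule rad)
      also have "\<dots> = g (cmod z)" using elim z by simp
      finally show "\<omega> z = g (cmod z)" .
    qed
  qed
  have "(\<integral>\<^sup>+z. ennreal (g (cmod z)) * indicator \<bbbD> z \<partial>lborel) = (\<integral>\<^sup>+z. ennreal (norm (indicator \<bbbD> z *\<^sub>R \<omega> z)) \<partial>lborel)"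
    using g2 by (intro nn_integral_cong_AE) (auto elim!: eventually_mono simp: nonneg split: split_indicator)
  also have "\<dots> < top"
    using int by (simp add: integrable_iff_bounded nn_integral_completion)
  finally have fin: "(\<integral>\<^sup>+z. ennreal (g (cmod z)) * indicator \<bbbD> z \<partial>lborel) < top" .
  have [measurable]: "\<bbbD> \<in> sets borel" by simp
  \<comment> \<open>The area integral of the weight is 2 pi times the radial one, so integrability
    over the disc makes the mass of \<open>g r * r\<close> finite.\<close>
  have "radial_integral (\<lambda>z. ennreal (g (cmod z)) * indicator \<bbbD> z) t
    = (\<integral>\<^sup>+r. ennreal (g r * r) * indicator {0<..<1} r \<partial>lborel)" for t
    unfolding radial_integral_def
    by (intro nn_integral_cong) (auto simp: norm_mult g_def ennreal_mult split: split_indicator)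
  then have "(\<integral>\<^sup>+z. ennreal (g (cmod z)) * indicator \<bbbD> z \<partial>lborel)
     = (\<integral>\<^sup>+t. (\<integral>\<^sup>+r. ennreal (g r * r) * indicator {0<..<1} r \<partial>lborel) * indicator {0..<0 + 2 * pi} t \<partial>lborel)"
    by (subst nn_integral_polar[of _ 0]) auto
  also have "\<dots> = (\<integral>\<^sup>+r. ennreal (g r * r) * indicator {0<..<1} r \<partial>lborel) * ennreal (2 * pi)"
    by (subst nn_integral_cmult_indicator) auto
  finally have eq: "(\<integral>\<^sup>+z. ennreal (g (cmod z)) * indicator \<bbbD> z \<partial>lborel)
     = (\<integral>\<^sup>+r. ennreal (g r * r) * indicator {0<..<1} r \<partial>lborel) * ennreal (2 * pi)" .
  have "(\<integral>\<^sup>+r. ennreal (g r * r) * indicator {0<..<1} r \<partial>lborel) < top"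
  proof -
    have "ennreal (2 * pi) \<noteq> 0" by (simp add: ennreal_eq_0_iff not_le)
    then show ?thesis using fin unfolding eq by (auto simp: ennreal_mult_less_top)
  qed
  with g0 g1 g2 gm show ?thesis
    by (intro that[of g]) (simp add: radial_density_def imp_conjL)
qed

definition radial_measure :: "(real \<Rightarrow> real) \<Rightarrow> real measure" where
  "radial_measure g = density lborel (\<lambda>r. ennreal (g r * r) * indicator {0<..<1} r)"

lemma sets_radial_measure [measurable_cong, simp]: "sets (radial_measure g) = sets borel"
  by (simp add: radial_measure_def)

lemma space_radial_measure [simp]: "space (radial_measure g) = UNIV"
  by (simp add: radial_measure_def)

lemma nn_integral_radial_measure:
  assumes "radial_density \<omega> g" and [measurable]: "h \<in> borel_measurable borel"
  shows "(\<integral>\<^sup>+r. h r \<partial>radial_measure g) = (\<integral>\<^sup>+r. ennreal (g r * r) * indicator {0<..<1} r * h r \<partial>lborel)"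
proof -
  have [measurable]: "g \<in> borel_measurable borel" using assms by (simp add: radial_density_def)
  show ?thesis unfolding radial_measure_def by (subst nn_integral_density) auto
qed

lemma finite_measure_radial_measure:
  assumes "radial_density \<omega> g"
  shows "finite_measure (radial_measure g)"
proof
  have [measurable]: "g \<in> borel_measurable borel" using assms by (simp add: radial_density_def)
  show "emeasure (radial_measure g) (space (radial_measure g)) \<noteq> \<infinity>"
    using assms by (auto simp: radial_measure_def emeasure_density radial_density_def)
qed

lemma AE_radial_measure:
  assumes "radial_density \<omega> g"
  shows "AE r in radial_measure g. 0 < r \<and> r < 1"
proof -
  have [measurable]: "g \<in> borel_measurable borel" using assms by (simp add: radial_density_def)
  show ?thesis unfolding radial_measure_def by (subst AE_density) (auto split: split_indicator)
qed

lemma nn_integral_weight_radial: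
  assumes d: "radial_density \<omega> g" and [measurable]: "h \<in> borel_measurable borel" and "\<And>r. 0 \<le> h r"
  shows "(\<integral>\<^sup>+r\<in>{0..<1}. ennreal (h r * \<omega> (of_real r) * r) \<partial>lebesgue) = (\<integral>\<^sup>+r. ennreal (h r) \<partial>radial_measure g)"
proof -
  have gm [measurable]: "g \<in> borel_measurable borel" and g0: "\<And>r. 0 \<le> g r"
    and ae: "AE r in lborel. 0 < r \<and> r < 1 \<longrightarrow> \<omega> (of_real r) = g r"
    using d by (auto simp: radial_density_def)
  have "(\<integral>\<^sup>+r\<in>{0..<1}. ennreal (h r * \<omega> (of_real r) * r) \<partial>lebesgue)
     = (\<integral>\<^sup>+r. ennreal (g r * r) * indicator {0<..<1} r * ennreal (h r) \<partial>lborel)"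
    unfolding nn_integral_completion
  proof (rule nn_integral_cong_AE, rule eventually_mono[OF eventually_conj[OF ae AE_lborel_singleton[of "0::real"]]])
    fix r :: real
    assume r: "(0 < r \<and> r < 1 \<longrightarrow> \<omega> (of_real r) = g r) \<and> r \<noteq> 0"
    have "ennreal (g r * r * h r) = ennreal (g r * r) * ennreal (h r)" if "0 < r"
      using that by (intro ennreal_mult) (auto simp: g0 assms(3))
    then show "ennreal (h r * \<omega> (of_real r) * r) * indicator {0..<1} r
      = ennreal (g r * r) * indicator {0<..<1} r * ennreal (h r)"
      using r by (auto simp: mult.commute mult.left_commute split: split_indicator)
  qed
  then show ?thesis by (simp add: nn_integral_radial_measure[OF d])
qed

text \<open>Polar coordinates on the window centred at \<theta>, where the region reads |t -
  \<theta>| < 1 - r, followed by Fubini. F is Borel on the whole plane and stands in for h, which is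
  controlled only on the disc.\<close>

lemma nn_integral_weight_Gamma_region:
  assumes d: "radial_density \<omega> g" and Fm [measurable]: "F \<in> borel_measurable borel"
    and Fh: "\<And>z. z \<in> \<bbbD> \<Longrightarrow> F z = ennreal (h z)" "\<And>z. 0 \<le> h z"
  shows "(\<integral>\<^sup>+z\<in>Gamma_region (cis \<theta>). ennreal (h z * \<omega> z / (1 - cmod z)) \<partial>lebesgue)
    = (\<integral>\<^sup>+r. ennreal (1 / (1 - r)) * (\<integral>\<^sup>+t\<in>ball \<theta> (1 - r). F (of_real r * cis t) \<partial>lborel) \<partial>radial_measure g)"
proof -
  have gm [measurable]: "g \<in> borel_measurable borel" and g0: "\<And>r. 0 \<le> g r"
    and ae: "AE z in lborel. z \<in> \<bbbD> \<longrightarrow> \<omega> z = g (cmod z)"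
    using d by (auto simp: radial_density_def)
  have sub: "Gamma_region (cis \<theta>) \<subseteq> \<bbbD>" by (auto simp: Gamma_region_def)
  define K where "K z = F z * ennreal (g (cmod z) / (1 - cmod z)) * indicator (Gamma_region (cis \<theta>)) z" for z
  have [measurable]: "K \<in> borel_measurable borel" unfolding K_def by measurable
  have "(\<integral>\<^sup>+z\<in>Gamma_region (cis \<theta>). ennreal (h z * \<omega> z / (1 - cmod z)) \<partial>lebesgue) = (\<integral>\<^sup>+z. K z \<partial>lborel)"
    unfolding nn_integral_completion
  proof (rule nn_integral_cong_AE, rule eventually_mono[OF ae])
    fix z assume eq: "z \<in> \<bbbD> \<longrightarrow> \<omega> z = g (cmod z)"
    show "ennreal (h z * \<omega> z / (1 - cmod z)) * indicator (Gamma_region (cis \<theta>)) z = K z"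
    proof (cases "z \<in> Gamma_region (cis \<theta>)")
      case True
      then have z: "z \<in> \<bbbD>" using sub by auto
      then have "0 \<le> g (cmod z) / (1 - cmod z)" using g0 by simp
      then have "ennreal (h z * (g (cmod z) / (1 - cmod z))) = F z * ennreal (g (cmod z) / (1 - cmod z))"
        unfolding Fh(1)[OF z] by (intro ennreal_mult Fh(2))
      moreover have "\<omega> z = g (cmod z)" using z eq by blast
      ultimately show ?thesis using True by (simp add: K_def)
    qed (simp add: K_def)
  qed
  also have "\<dots> = (\<integral>\<^sup>+t\<in>{\<theta> - pi..<\<theta> - pi + 2 * pi}. radial_integral K t \<partial>lborel)"
    by (rule nn_integral_polar) measurable
  also have "\<dots> = (\<integral>\<^sup>+t. \<integral>\<^sup>+r. ennreal (g r * r) * indicator {0<..<1} r * (ennreal (1 / (1 - r)) * (F (of_real r * cis t) * indicator (ball \<theta> (1 - r)) t)) \<partial>lborel \<partial>lborel)"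
  proof (intro nn_integral_cong)
    fix t
    show "radial_integral K t * indicator {\<theta> - pi..<\<theta> - pi + 2 * pi} t
      = (\<integral>\<^sup>+r. ennreal (g r * r) * indicator {0<..<1} r * (ennreal (1 / (1 - r)) * (F (of_real r * cis t) * indicator (ball \<theta> (1 - r)) t)) \<partial>lborel)"
    proof (cases "t \<in> {\<theta> - pi..<\<theta> - pi + 2 * pi}")
      case True
      then have tt: "\<bar>t - \<theta>\<bar> \<le> pi" by (auto simp: abs_le_iff)
      have "radial_integral K t = (\<integral>\<^sup>+r. ennreal (g r * r) * indicator {0<..<1} r * (ennreal (1 / (1 - r)) * (F (of_real r * cis t) * indicator (ball \<theta> (1 - r)) t)) \<partial>lborel)"
        unfolding radial_integral_def
      proof (intro nn_integral_cong)
        fix r :: real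
        show "K (of_real r * cis t) * ennreal r * indicator {0<..} r
          = ennreal (g r * r) * indicator {0<..<1} r * (ennreal (1 / (1 - r)) * (F (of_real r * cis t) * indicator (ball \<theta> (1 - r)) t))"
        proof (cases "0 < r \<and> r < 1")
          case True
          have "K (of_real r * cis t) * ennreal r * indicator {0<..} r
            = (ennreal (g r / (1 - r)) * ennreal r) * (F (of_real r * cis t) * indicator (Gamma_region (cis \<theta>)) (of_real r * cis t))"
            using True by (simp add: K_def norm_mult mult_ac)
          also have "ennreal (g r / (1 - r)) * ennreal r = ennreal (g r / (1 - r) * r)"
            using True g0[of r] by (intro ennreal_mult[symmetric]) auto
          also have "g r / (1 - r) * r = g r * r * (1 / (1 - r))" by simp
          also have "ennreal \<dots> = ennreal (g r * r) * ennreal (1 / (1 - r))"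
            using True g0[of r] by (intro ennreal_mult) auto
          also have "(indicator (Gamma_region (cis \<theta>)) (of_real r * cis t) :: ennreal) = indicator (ball \<theta> (1 - r)) t"
            unfolding indicator_def using True polar_mem_Gamma_region_iff[of r t \<theta>] tt by simp
          also have "ennreal (g r * r) * ennreal (1 / (1 - r)) * (F (of_real r * cis t) * indicator (ball \<theta> (1 - r)) t)
            = ennreal (g r * r) * indicator {0<..<1} r * (ennreal (1 / (1 - r)) * (F (of_real r * cis t) * indicator (ball \<theta> (1 - r)) t))"
            using True by (simp add: mult.assoc)
          finally show ?thesis .
        next
          case False
          show ?thesis
          proof (cases "0 < r")
            case True
            then have "of_real r * cis t \<notin> Gamma_region (cis \<theta>)"
              using polar_mem_Gamma_region_iff[of r t \<theta>] tt False by simp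
            then show ?thesis using False by (simp add: K_def)
          qed simp
        qed
      qed
      then show ?thesis using True by simp
    next
      case False
      \<comment> \<open>Outside the window the right-hand integrand vanishes as well, since 1 - r <
        pi.\<close>
      have zero: "ennreal (g r * r) * indicator {0<..<1} r * (ennreal (1 / (1 - r)) * (F (of_real r * cis t) * indicator (ball \<theta> (1 - r)) t)) = 0" for r
      proof (cases "0 < r \<and> r < 1")
        case True
        have "t \<notin> ball \<theta> (1 - r)"
        proof
          assume "t \<in> ball \<theta> (1 - r)"
          then have "\<bar>\<theta> - t\<bar> < 1" using True by (simp add: dist_real_def)
          then show False using \<open>t \<notin> _\<close> pi_ge_two by auto
        qed
        then show ?thesis by simp
      qed auto
      show ?thesis unfolding zero using False by simp
    qed
  qed
  also have "\<dots> = (\<integral>\<^sup>+r. \<integral>\<^sup>+t. ennreal (g r * r) * indicator {0<..<1} r * (ennreal (1 / (1 - r)) * (F (of_real r * cis t) * indicator (ball \<theta> (1 - r)) t)) \<partial>lborel \<partial>lborel)"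
    unfolding indicator_def mem_ball by (rule lborel_pair.Fubini') measurable
  also have "\<dots> = (\<integral>\<^sup>+r. ennreal (g r * r) * indicator {0<..<1} r * (ennreal (1 / (1 - r)) * (\<integral>\<^sup>+t\<in>ball \<theta> (1 - r). F (of_real r * cis t) \<partial>lborel)) \<partial>lborel)"
    by (simp add: nn_integral_cmult)
  also have "\<dots> = (\<integral>\<^sup>+r. ennreal (1 / (1 - r)) * (\<integral>\<^sup>+t\<in>ball \<theta> (1 - r). F (of_real r * cis t) \<partial>lborel) \<partial>radial_measure g)"
    by (rule nn_integral_radial_measure[OF d, symmetric]) (unfold indicator_def mem_ball, measurable)
  finally show ?thesis .
qed

section \<open>Monotone functions and doubling measures\<close>

text \<open>Applied to superlevel sets of increasing functions. Whether the end point of the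
  half-line belongs to the set is left open, as \<open>doubling\<close> covers both cases.\<close>

lemma sets_borel_up_closed:
  fixes U :: "real set"
  assumes up: "\<And>x y. x \<in> U \<Longrightarrow> x \<le> y \<Longrightarrow> y \<in> U"
  shows "U = {} \<or> U = UNIV \<or> (\<exists>a. {a<..} \<subseteq> U \<and> U \<subseteq> {a..})" and "U \<in> sets borel"
proof -
  show *: "U = {} \<or> U = UNIV \<or> (\<exists>a. {a<..} \<subseteq> U \<and> U \<subseteq> {a..})"
  proof (cases "U = {} \<or> \<not> bdd_below U")
    case True
    then show ?thesis
    proof
      assume "\<not> bdd_below U"
      then have "y \<in> U" for y
        using up unfolding bdd_below_def by (meson linear)
      then show ?thesis by blast
    qed simp
  next
    case False
    have "x \<in> U" if "Inf U < x" for x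
      using cInf_lessD[of U x] that False up by (meson less_imp_le)
    then have "{Inf U<..} \<subseteq> U" by auto
    moreover have "U \<subseteq> {Inf U..}"
      using False by (auto intro: cInf_lower)
    ultimately show ?thesis by blast
  qed
  moreover have "U \<in> sets borel" if "{a<..} \<subseteq> U" "U \<subseteq> {a..}" for a
  proof -
    have "U = {a<..} \<or> U = {a..}"
      using that by (force simp: less_le)
    then show ?thesis by auto
  qed
  ultimately show "U \<in> sets borel" by auto
qed

lemma borel_measurable_mono_ennreal:
  fixes \<Phi> :: "real \<Rightarrow> ennreal"
  assumes "mono \<Phi>"
  shows "\<Phi> \<in> borel_measurable borel"
proof (rule borel_measurableI_greater)
  fix y
  have "{x. y < \<Phi> x} \<in> sets borel"
    by (rule sets_borel_up_closed(2)) (auto intro: order_less_le_trans dest: monoD[OF assms])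
  then show "{x \<in> space borel. y < \<Phi> x} \<in> sets borel" by simp
qed

text \<open>A closed tail on the left against an open one on the right: the strongest combination,
  so that it applies to half-lines with or without their end point. The distances of 2 a - 1 and a
  from 1 are in the ratio 2.\<close>

definition doubling :: "real measure \<Rightarrow> bool" where
  "doubling S \<longleftrightarrow> (\<exists>C::real. C > 0 \<and> (\<forall>a<1. emeasure S {2 * a - 1..} \<le> ennreal C * emeasure S {a<..}))"

text \<open>On the tail the densities with and without the factor s differ by a factor between r and
  1. The end point is a null set, which permits the closed tail in one bound and the open tail in
  the other.\<close>

lemma weight_hat_bounds:
  assumes d: "radial_density \<omega> g" and r: "0 < r" "r < 1"
  shows "emeasure (radial_measure g) {r..} \<le> weight_hat \<omega> (of_real r)"
    and "weight_hat \<omega> (of_real r) \<le> ennreal (1 / r) * emeasure (radial_measure g) {r<..}"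
proof -
  have gm [measurable]: "g \<in> borel_measurable borel" and g0: "\<And>r. 0 \<le> g r"
    and ae: "AE r in lborel. 0 < r \<and> r < 1 \<longrightarrow> \<omega> (of_real r) = g r"
    using d by (auto simp: radial_density_def)
  have hat: "weight_hat \<omega> (of_real r) = (\<integral>\<^sup>+s. ennreal (g s) * indicator {r..<1} s \<partial>lborel)"
    unfolding weight_hat_def nn_integral_completion
    by (rule nn_integral_cong_AE, rule eventually_mono[OF ae]) (use r in \<open>auto split: split_indicator\<close>)
  have em: "emeasure (radial_measure g) A = (\<integral>\<^sup>+s. ennreal (g s * s) * indicator {0<..<1} s * indicator A s \<partial>lborel)"
    if "A \<in> sets borel" for A
    unfolding radial_measure_def using that by (subst emeasure_density) auto
  show "emeasure (radial_measure g) {r..} \<le> weight_hat \<omega> (of_real r)"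
    unfolding hat using r g0
    by (subst em) (auto intro!: nn_integral_mono ennreal_leI mult_left_le split: split_indicator)
  have "weight_hat \<omega> (of_real r) \<le> (\<integral>\<^sup>+s. ennreal (1 / r) * (ennreal (g s * s) * indicator {0<..<1} s * indicator {r<..} s) \<partial>lborel)"
    unfolding hat
  proof (rule nn_integral_mono_AE, rule eventually_mono[OF AE_lborel_singleton[of r]])
    fix s assume s: "s \<noteq> r"
    show "ennreal (g s) * indicator {r..<1} s \<le> ennreal (1 / r) * (ennreal (g s * s) * indicator {0<..<1} s * indicator {r<..} s)"
    proof (cases "r \<le> s \<and> s < 1")
      case True
      have "g s * 1 \<le> g s * (s / r)" using True r g0 by (intro mult_left_mono) auto
      then have "ennreal (g s) \<le> ennreal (1 / r * (g s * s))" by (intro ennreal_leI) simp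
      also have "\<dots> = ennreal (1 / r) * ennreal (g s * s)" using r True g0 by (intro ennreal_mult) auto
      finally show ?thesis using True r s by auto
    qed auto
  qed
  also have "\<dots> = ennreal (1 / r) * emeasure (radial_measure g) {r<..}"
    by (subst em) (auto intro!: nn_integral_cmult)
  finally show "weight_hat \<omega> (of_real r) \<le> ennreal (1 / r) * emeasure (radial_measure g) {r<..}" .
qed

lemma emeasure_radial_measure_tail_pos:
  assumes d: "radial_density \<omega> g" and pos: "\<forall>z\<in>\<bbbD>. weight_hat \<omega> z > 0" and r: "r < 1"
  shows "0 < emeasure (radial_measure g) {r<..}"
proof -
  \<comment> \<open>The comparison costs 1 / s, so the radius is first moved away from 0.\<close>
  define s where "s = max r (1/2)"
  have s: "0 < s" "s < 1" "r \<le> s" using r by (auto simp: s_def)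
  then have "0 < weight_hat \<omega> (of_real s)" using pos by simp
  also have "\<dots> \<le> ennreal (1 / s) * emeasure (radial_measure g) {s<..}"
    using s by (intro weight_hat_bounds(2)[OF d])
  finally have "0 < emeasure (radial_measure g) {s<..}" by (auto simp: zero_less_iff_neq_zero)
  also have "\<dots> \<le> emeasure (radial_measure g) {r<..}" using s by (intro emeasure_mono) auto
  finally show ?thesis .
qed

text \<open>\<open>D_hat\<close> controls only radii close to 1. For the remaining a the right-hand
  tail contains the fixed tail beyond a0, of positive mass m, so the total mass divided by m serves
  as constant.\<close>

lemma D_hat_imp_doubling:
  assumes d: "radial_density \<omega> g" and pos: "\<forall>z\<in>\<bbbD>. weight_hat \<omega> z > 0" and D: "\<omega> \<in> D_hat"
  shows "doubling (radial_measure g)"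
proof -
  let ?S = "radial_measure g"
  interpret S: finite_measure ?S by (rule finite_measure_radial_measure[OF d])
  obtain C :: real where C: "C > 0"
    "\<forall>\<^sub>F r in at_left 1. weight_hat \<omega> (of_real r) \<le> ennreal C * weight_hat \<omega> (of_real ((1 + r) / 2))"
    using D by (auto simp: D_hat_def)
  then obtain b where b: "b < 1"
    "\<And>r. b < r \<Longrightarrow> r < 1 \<Longrightarrow> weight_hat \<omega> (of_real r) \<le> ennreal C * weight_hat \<omega> (of_real ((1 + r) / 2))"
    by (auto simp: eventually_at_left[of 0 1])
  define r0 where "r0 = max b (1/2)"
  have r0: "1/2 \<le> r0" "r0 < 1" "b \<le> r0" using b by (auto simp: r0_def)
  \<comment> \<open>The threshold is chosen so that a \<le> a0 means 2 a - 1 \<le> r0.\<close>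
  define a0 where "a0 = (1 + r0) / 2"
  have a0: "a0 < 1" using r0 by (simp add: a0_def)
  define m where "m = measure ?S {a0<..}"
  have m: "0 < m" "emeasure ?S {a0<..} = ennreal m"
    using emeasure_radial_measure_tail_pos[OF d pos a0] by (auto simp: m_def S.emeasure_eq_measure)
  \<comment> \<open>The 2 bounds the factor 1 / a that appears in passing from
    \<open>weight_hat\<close> to the measure.\<close>
  define C' where "C' = max (2 * C) (measure ?S UNIV / m)"
  have "0 < C'" using C by (simp add: C'_def less_max_iff_disj)
  moreover have "emeasure ?S {2 * a - 1..} \<le> ennreal C' * emeasure ?S {a<..}" if a: "a < 1" for a
  proof (cases "r0 < 2 * a - 1")
    case True
    have "emeasure ?S {2 * a - 1..} \<le> weight_hat \<omega> (of_real (2 * a - 1))"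
      using True a r0 by (intro weight_hat_bounds(1)[OF d]) auto
    also have "\<dots> \<le> ennreal C * weight_hat \<omega> (of_real a)"
      using b(2)[of "2 * a - 1"] True a r0 by simp
    also have "\<dots> \<le> ennreal C * (ennreal (1 / a) * emeasure ?S {a<..})"
      using True a r0 by (intro mult_left_mono weight_hat_bounds(2)[OF d]) auto
    also have "\<dots> = ennreal (C * (1 / a)) * emeasure ?S {a<..}"
      using C True r0 by (subst ennreal_mult) (auto simp: mult.assoc)
    also have "\<dots> \<le> ennreal C' * emeasure ?S {a<..}"
    proof (intro mult_right_mono ennreal_leI)
      have "C * (1 / a) \<le> C * 2" using C True r0 by (intro mult_left_mono) (auto simp: divide_le_eq)
      then show "C * (1 / a) \<le> C'" by (simp add: C'_def)
    qed auto
    finally show ?thesis .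
  next
    case False
    then have "a \<le> a0" by (simp add: a0_def field_simps)
    have "emeasure ?S {2 * a - 1..} \<le> emeasure ?S UNIV" by (intro emeasure_mono) auto
    also have "\<dots> = ennreal (measure ?S UNIV)" by (simp add: S.emeasure_eq_measure)
    also have "measure ?S UNIV = (measure ?S UNIV / m) * m" using m by simp
    also have "ennreal \<dots> \<le> ennreal (C' * m)"
      using m by (intro ennreal_leI mult_right_mono) (auto simp: C'_def)
    also have "\<dots> = ennreal C' * emeasure ?S {a0<..}"
      using \<open>0 < C'\<close> m by (simp add: ennreal_mult)
    also have "\<dots> \<le> ennreal C' * emeasure ?S {a<..}"
      using \<open>a \<le> a0\<close> by (intro mult_left_mono emeasure_mono) auto
    finally show ?thesis .
  qed
  ultimately show ?thesis unfolding doubling_def by blast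
qed

text \<open>Layer cake: the superlevel sets of an increasing function are tails, which halving the
  distance to 1 enlarges by at most the doubling constant.\<close>

lemma doubling_shift_obtain:
  assumes d: "radial_density \<omega> g" and dbl: "doubling (radial_measure g)"
  obtains C :: real where "0 < C"
    "\<And>\<Phi> :: real \<Rightarrow> ennreal. mono \<Phi> \<Longrightarrow>
      (\<integral>\<^sup>+r. \<Phi> ((1 + r) / 2) \<partial>radial_measure g) \<le> ennreal C * (\<integral>\<^sup>+r. \<Phi> r \<partial>radial_measure g)"
proof -
  let ?S = "radial_measure g"
  interpret S: finite_measure ?S by (rule finite_measure_radial_measure[OF d])
  obtain C0 :: real where C0: "C0 > 0" "\<And>a. a < 1 \<Longrightarrow> emeasure ?S {2 * a - 1..} \<le> ennreal C0 * emeasure ?S {a<..}"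
    using dbl by (auto simp: doubling_def)
  \<comment> \<open>At least 1, for the case where U is the whole line.\<close>
  define C where "C = max C0 1"
  have C: "0 < C" by (simp add: C_def)
  have up: "emeasure ?S {r. (1 + r) / 2 \<in> U} \<le> ennreal C * emeasure ?S U"
    if U: "\<And>x y. x \<in> U \<Longrightarrow> x \<le> y \<Longrightarrow> y \<in> U" for U
  proof -
    have [measurable]: "U \<in> sets borel" using U by (rule sets_borel_up_closed(2))
    consider "U = {}" | "U = UNIV" | a where "{a<..} \<subseteq> U" "U \<subseteq> {a..}"
      using sets_borel_up_closed(1)[of U] U by blast
    then show ?thesis
    proof cases
      case 2
      have "1 * emeasure ?S UNIV \<le> ennreal C * emeasure ?S UNIV"
        by (intro mult_right_mono) (auto simp: C_def)
      then show ?thesis using 2 by simp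
    next
      case 3
      have "emeasure ?S {r. (1 + r) / 2 \<in> U} \<le> emeasure ?S {2 * a - 1..}"
        using 3 by (intro emeasure_mono) (auto simp: subset_eq field_simps)
      also have "\<dots> \<le> ennreal C * emeasure ?S U"
      proof (cases "a < 1")
        case True
        have "emeasure ?S {2 * a - 1..} \<le> ennreal C0 * emeasure ?S {a<..}" by (rule C0(2)[OF True])
        also have "\<dots> \<le> ennreal C * emeasure ?S U"
          using 3 by (intro mult_mono emeasure_mono ennreal_leI) (auto simp: C_def)
        finally show ?thesis .
      next
        case False
        \<comment> \<open>The measure lives on (0, 1), so a tail starting at or beyond 1 is
          null.\<close>
        have "AE r in ?S. r \<notin> {2 * a - 1..}"
          using AE_radial_measure[OF d] by (rule eventually_mono) (use False in auto)
        then have "emeasure ?S {2 * a - 1..} = 0"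
          by (subst (asm) AE_iff_measurable[of "{2 * a - 1..}"]) auto
        then show ?thesis by simp
      qed
      finally show ?thesis .
    qed simp
  qed
  show ?thesis
  proof (rule that[OF C])
    fix \<Phi> :: "real \<Rightarrow> ennreal" assume \<Phi>: "mono \<Phi>"
    have [measurable]: "\<Phi> \<in> borel_measurable borel" by (rule borel_measurable_mono_ennreal[OF \<Phi>])
    have em: "(\<integral>\<^sup>+x. (if P x then 1 else 0) \<partial>?S) = emeasure ?S {x. P x}" if "Measurable.pred borel P" for P
    proof -
      have "(\<integral>\<^sup>+x. (if P x then 1 else 0) \<partial>?S) = (\<integral>\<^sup>+x. indicator {x. P x} x \<partial>?S)"
        by (intro nn_integral_cong) auto
      also have "\<dots> = emeasure ?S {x. P x}" using that by (subst nn_integral_indicator) auto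
      finally show ?thesis .
    qed
    have "(\<integral>\<^sup>+r. \<Phi> ((1 + r) / 2) \<partial>?S)
      = (\<integral>\<^sup>+t. (\<integral>\<^sup>+r. (if ennreal t < \<Phi> ((1 + r) / 2) then 1 else 0) \<partial>?S) * indicator {0..} t \<partial>lborel)"
      using layer_cake[OF S.sigma_finite_measure_axioms, of "\<lambda>r. \<Phi> ((1 + r) / 2)" "\<lambda>_. 1"] by simp
    also have "\<dots> \<le> (\<integral>\<^sup>+t. ennreal C * ((\<integral>\<^sup>+r. (if ennreal t < \<Phi> r then 1 else 0) \<partial>?S) * indicator {0..} t) \<partial>lborel)"
    proof (intro nn_integral_mono)
      fix t
      have "emeasure ?S {r. (1 + r) / 2 \<in> {x. ennreal t < \<Phi> x}} \<le> ennreal C * emeasure ?S {x. ennreal t < \<Phi> x}"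
        by (rule up) (auto intro: order_less_le_trans dest: monoD[OF \<Phi>])
      then have "(\<integral>\<^sup>+r. (if ennreal t < \<Phi> ((1 + r) / 2) then 1 else 0) \<partial>?S)
        \<le> ennreal C * (\<integral>\<^sup>+r. (if ennreal t < \<Phi> r then 1 else 0) \<partial>?S)"
        by (subst (1 2) em) auto
      then show "(\<integral>\<^sup>+r. (if ennreal t < \<Phi> ((1 + r) / 2) then 1 else 0) \<partial>?S) * indicator {0..} t
        \<le> ennreal C * ((\<integral>\<^sup>+r. (if ennreal t < \<Phi> r then 1 else 0) \<partial>?S) * indicator {0..} t)"
        by (auto split: split_indicator)
    qed
    also have "\<dots> = ennreal C * (\<integral>\<^sup>+t. (\<integral>\<^sup>+r. (if ennreal t < \<Phi> r then 1 else 0) \<partial>?S) * indicator {0..} t \<partial>lborel)"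
      by (intro nn_integral_cmult) measurable
    also have "(\<integral>\<^sup>+t. (\<integral>\<^sup>+r. (if ennreal t < \<Phi> r then 1 else 0) \<partial>?S) * indicator {0..} t \<partial>lborel) = (\<integral>\<^sup>+r. \<Phi> r \<partial>?S)"
      using layer_cake[OF S.sigma_finite_measure_axioms, of \<Phi> "\<lambda>_. 1"] by simp
    finally show "(\<integral>\<^sup>+r. \<Phi> ((1 + r) / 2) \<partial>?S) \<le> ennreal C * (\<integral>\<^sup>+r. \<Phi> r \<partial>?S)" .
  qed
qed

text \<open>Two halvings are spent: one because Cauchy discs of radius (1 - r) / 2 reach modulus (1
  + r) / 2, one because \<open>nt_max f \<rho>\<close> sees moduli only up to 2 \<rho> - 1. Indeed 2
  \<rho> - 1 = (1 + r) / 2 for \<rho> = (3 + r) / 4.\<close>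

lemma doubling_shift2_obtain:
  assumes d: "radial_density \<omega> g" and dbl: "doubling (radial_measure g)"
  obtains C :: real where "0 < C"
    "\<And>\<Phi> :: real \<Rightarrow> ennreal. mono \<Phi> \<Longrightarrow>
      (\<integral>\<^sup>+r. \<Phi> ((3 + r) / 4) \<partial>radial_measure g) \<le> ennreal C * (\<integral>\<^sup>+r. \<Phi> r \<partial>radial_measure g)"
proof -
  obtain C :: real where C: "0 < C"
    "\<And>\<Phi> :: real \<Rightarrow> ennreal. mono \<Phi> \<Longrightarrow>
      (\<integral>\<^sup>+r. \<Phi> ((1 + r) / 2) \<partial>radial_measure g) \<le> ennreal C * (\<integral>\<^sup>+r. \<Phi> r \<partial>radial_measure g)"
    by (rule doubling_shift_obtain[OF d dbl]) blast
  show ?thesis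
  proof (rule that[of "C * C"])
    fix \<Phi> :: "real \<Rightarrow> ennreal" assume \<Phi>: "mono \<Phi>"
    have "(1 + (1 + r) / 2) / 2 = (3 + r) / 4" for r :: real by (simp add: field_simps)
    then have "(\<integral>\<^sup>+r. \<Phi> ((3 + r) / 4) \<partial>radial_measure g) = (\<integral>\<^sup>+r. (\<lambda>x. \<Phi> ((1 + x) / 2)) ((1 + r) / 2) \<partial>radial_measure g)"
      by (simp only:)
    also have "\<dots> \<le> ennreal C * (\<integral>\<^sup>+r. \<Phi> ((1 + r) / 2) \<partial>radial_measure g)"
      by (intro C(2)) (auto intro!: monoI monoD[OF \<Phi>])
    also have "\<dots> \<le> ennreal C * (ennreal C * (\<integral>\<^sup>+r. \<Phi> r \<partial>radial_measure g))"
      by (intro mult_left_mono C(2) \<Phi>) auto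
    finally show "(\<integral>\<^sup>+r. \<Phi> ((3 + r) / 4) \<partial>radial_measure g) \<le> ennreal (C * C) * (\<integral>\<^sup>+r. \<Phi> r \<partial>radial_measure g)"
      using C(1) by (simp add: ennreal_mult mult.assoc)
  qed (use C in auto)
qed

section \<open>Nontangential maximal functions\<close>

text \<open>The supremum runs over the part of a Stolz region at distance at least \<open>2 (1 - \<rho>)\<close> from the
  circle: there the Poisson kernel of the circle of radius \<open>\<rho>\<close> does not see scales below \<open>1 - \<rho>\<close>.\<close>

definition nt_max :: "(complex \<Rightarrow> complex) \<Rightarrow> real \<Rightarrow> real \<Rightarrow> ennreal" where
  "nt_max f \<rho> \<theta> = (SUP w\<in>{w. cmod w < 1 \<and> cmod w \<le> 2 * \<rho> - 1 \<and> cmod (w - cis \<theta>) \<le> 5 * (1 - cmod w)}.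
     ennreal (cmod (f w)))"

lemma nt_max_mono: "\<rho> \<le> \<rho>' \<Longrightarrow> nt_max f \<rho> \<theta> \<le> nt_max f \<rho>' \<theta>"
  unfolding nt_max_def by (intro SUP_subset_mono) auto

lemma norm_le_nt_max:
  assumes "cmod w < 1" "cmod w \<le> 2 * \<rho> - 1" "cmod (w - cis \<theta>) \<le> 5 * (1 - cmod w)"
  shows "ennreal (cmod (f w)) \<le> nt_max f \<rho> \<theta>"
  unfolding nt_max_def using assms by (intro SUP_upper) auto

text \<open>Origin of the aperture 5: a point x of the Cauchy circle of radius R = (1 - r) / 2 is
  within R + (1 - r) + (1 - r) = 5 R of cis \<theta>, and R \<le> 1 - |x|. The angle t may differ
  from \<theta> by 1 - r so that arc means are covered.\<close>

lemma weighted_deriv_le_nt_max: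
  assumes hol: "f holomorphic_on \<bbbD>" and r: "0 \<le> r" "r < 1" and t: "\<bar>t - \<theta>\<bar> \<le> 1 - r"
  shows "ennreal (cmod ((deriv ^^ n) f (of_real r * cis t)) * (1 - r) ^ n)
    \<le> ennreal (fact n * 2 ^ n) * nt_max f ((3 + r) / 4) \<theta>"
proof (cases "nt_max f ((3 + r) / 4) \<theta>")
  case (real B)
  define \<xi> where "\<xi> = of_real r * cis t"
  define R where "R = (1 - r) / 2"
  have R: "0 < R" using r by (simp add: R_def)
  have xi: "cmod \<xi> = r" using r by (simp add: \<xi>_def norm_mult)
  have le: "cmod x \<le> r + R" if "cmod (\<xi> - x) \<le> R" for x
    using that xi norm_triangle_ineq2[of x \<xi>] by (simp add: norm_minus_commute)
  have sub: "cball \<xi> R \<subseteq> \<bbbD>"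
  proof
    fix x assume "x \<in> cball \<xi> R"
    then have "cmod x \<le> r + R" by (intro le) (simp add: dist_norm)
    also have "\<dots> < 1" using r by (simp add: R_def field_simps)
    finally show "x \<in> \<bbbD>" by simp
  qed
  have "cmod (f x) \<le> B" if x: "cmod (\<xi> - x) = R" for x
  proof -
    have "cmod x \<le> r + R" using le x by simp
    then have x1: "cmod x \<le> 1 - R" "R \<le> 1 - cmod x" by (auto simp: R_def field_simps)
    have "\<xi> - cis t = of_real (r - 1) * cis t" by (simp add: \<xi>_def algebra_simps)
    then have "cmod (\<xi> - cis t) = \<bar>r - 1\<bar>" by (simp add: norm_mult del: of_real_diff)
    moreover have "cmod (x - cis \<theta>) \<le> cmod (x - \<xi>) + cmod (\<xi> - cis t) + cmod (cis t - cis \<theta>)"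
      using norm_triangle_ineq[of "x - \<xi>" "\<xi> - cis t"] norm_triangle_ineq[of "x - cis t" "cis t - cis \<theta>"] by simp
    ultimately have "cmod (x - cis \<theta>) \<le> R + (1 - r) + (1 - r)"
      using x r t norm_cis_diff_le[of t \<theta>] by (simp add: norm_minus_commute)
    also have "\<dots> \<le> 5 * (1 - cmod x)" using x1 by (simp add: R_def)
    finally have "ennreal (cmod (f x)) \<le> nt_max f ((3 + r) / 4) \<theta>"
      using x1 R by (intro norm_le_nt_max) (auto simp: R_def field_simps)
    then show ?thesis using real by simp
  qed
  then have "cmod ((deriv ^^ n) f \<xi>) \<le> fact n * B / R ^ n"
  proof (rule Cauchy_inequality[rotated 3])
    show "f holomorphic_on ball \<xi> R"
      by (rule holomorphic_on_subset[OF hol]) (use sub in force)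
    show "continuous_on (cball \<xi> R) f"
      by (rule continuous_on_subset[OF holomorphic_on_imp_continuous_on[OF hol] sub])
  qed (use R in auto)
  then have "cmod ((deriv ^^ n) f \<xi>) * (1 - r) ^ n \<le> fact n * B / R ^ n * (1 - r) ^ n"
    using r by (intro mult_right_mono) auto
  also have "fact n * B / R ^ n * (1 - r) ^ n = fact n * 2 ^ n * B"
    using R r by (simp add: R_def power_divide)
  finally show ?thesis
    using real by (simp add: \<xi>_def ennreal_leI flip: ennreal_mult)
qed (simp add: ennreal_mult_top)

text \<open>The subharmonic power is s = \<tau> p; the final power 1 / \<tau> turns the maximal
  function of g^\<tau> into \<open>max_pow\<close>.\<close>

lemma nt_max_le_max_pow:
  assumes hol: "f holomorphic_on \<bbbD>" and \<rho>: "0 < \<rho>" "\<rho> < 1" and pt: "0 < p" "0 < \<tau>"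
    and avg: "\<And>u. 1 - \<rho> \<le> u \<Longrightarrow> u \<le> pi \<Longrightarrow>
       (\<integral>\<^sup>+y\<in>ball \<theta> u. ennreal (cmod (f (of_real \<rho> * cis y)) powr (\<tau> * p)) \<partial>lborel)
         \<le> (\<integral>\<^sup>+y\<in>ball \<theta> (2 * u). g y powe \<tau> \<partial>lborel)"
  shows "nt_max f \<rho> \<theta> powe p \<le> ennreal (36864 powr (1 / \<tau>)) * max_pow \<tau> g \<theta>"
proof -
  have "nt_max f \<rho> \<theta> powe (\<tau> * p) \<le> 36864 * hl_max (\<lambda>y. g y powe \<tau>) \<theta>"
    unfolding nt_max_def powe_SUP[OF mult_pos_pos[OF pt(2,1)]]
  proof (intro SUP_least)
    fix w assume "w \<in> {w. cmod w < 1 \<and> cmod w \<le> 2 * \<rho> - 1 \<and> cmod (w - cis \<theta>) \<le> 5 * (1 - cmod w)}"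
    then have w: "cmod w \<le> 2 * \<rho> - 1" "cmod (w - cis \<theta>) \<le> 5 * (1 - cmod w)" by auto
    have "ennreal (cmod (f w) powr (\<tau> * p)) \<le> 36864 * 1 * hl_max (\<lambda>y. g y powe \<tau>) \<theta>"
      using avg pt by (intro powr_norm_le_hl_max[OF hol \<rho> w]) auto
    then show "ennreal (cmod (f w)) powe (\<tau> * p) \<le> 36864 * hl_max (\<lambda>y. g y powe \<tau>) \<theta>"
      by (simp add: powe_ennreal)
  qed
  then have "(nt_max f \<rho> \<theta> powe (\<tau> * p)) powe (1 / \<tau>) \<le> (36864 * hl_max (\<lambda>y. g y powe \<tau>) \<theta>) powe (1 / \<tau>)"
    using pt by (intro powe_mono) auto
  also have "\<dots> = ennreal (36864 powr (1 / \<tau>)) * max_pow \<tau> g \<theta>"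
    using pt powe_ennreal[of 36864 "1 / \<tau>"] by (simp add: powe_mult max_pow_def)
  finally show ?thesis using pt by (simp add: powe_powe)
qed

text \<open>Undoes the cut-off to three periods that gives the vector-valued inequality an integrand
  supported in a set of finite measure.\<close>

lemma nn_integral_three_periods:
  fixes K :: "real \<Rightarrow> ennreal"
  assumes [measurable]: "K \<in> borel_measurable borel" and per: "\<And>x. K (x + 2 * pi) = K x"
  shows "(\<integral>\<^sup>+x\<in>{- 2 * pi..<4 * pi}. K x \<partial>lborel) \<le> 3 * (\<integral>\<^sup>+x\<in>{0..2 * pi}. K x \<partial>lborel)"
proof -
  have one: "(\<integral>\<^sup>+x\<in>{b..<b + 2 * pi}. K x \<partial>lborel) \<le> (\<integral>\<^sup>+x\<in>{0..2 * pi}. K x \<partial>lborel)" for b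
    unfolding nn_integral_periodic[of K "2 * pi" b, OF assms(1) per pi_gt_zero[THEN mult_pos_pos[OF zero_less_numeral]]]
    by (intro nn_integral_mono) (auto split: split_indicator)
  have "(\<integral>\<^sup>+x\<in>{- 2 * pi..<4 * pi}. K x \<partial>lborel)
     \<le> (\<integral>\<^sup>+x. K x * indicator {- 2 * pi..<- 2 * pi + 2 * pi} x + (K x * indicator {0..<0 + 2 * pi} x
          + K x * indicator {2 * pi..<2 * pi + 2 * pi} x) \<partial>lborel)"
    by (intro nn_integral_mono) (auto split: split_indicator)
  also have "\<dots> = (\<integral>\<^sup>+x\<in>{- 2 * pi..<- 2 * pi + 2 * pi}. K x \<partial>lborel) + ((\<integral>\<^sup>+x\<in>{0..<0 + 2 * pi}. K x \<partial>lborel)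
     + (\<integral>\<^sup>+x\<in>{2 * pi..<2 * pi + 2 * pi}. K x \<partial>lborel))"
    by (simp add: nn_integral_add)
  also have "\<dots> \<le> (\<integral>\<^sup>+x\<in>{0..2 * pi}. K x \<partial>lborel) + ((\<integral>\<^sup>+x\<in>{0..2 * pi}. K x \<partial>lborel) + (\<integral>\<^sup>+x\<in>{0..2 * pi}. K x \<partial>lborel))"
    by (intro add_mono one)
  also have "\<dots> = (1 + (1 + 1)) * (\<integral>\<^sup>+x\<in>{0..2 * pi}. K x \<partial>lborel)"
    by (simp only: distrib_right mult_1_left)
  finally show ?thesis by simp
qed

text \<open>G stands for |f|^p or its arc means, H for anything below the truncated maximal
  function. Besides the derivative this admits functions constant in r and \<theta>, by which the
  derivatives at 0 are handled.\<close>

lemma mixed_norm_bound_obtain: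
  assumes d: "radial_density \<omega> g" and dbl: "doubling (radial_measure g)"
    and a: "0 < a" and p: "0 < p" and c: "0 < c"
  obtains C :: real where "0 < C"
    "\<And>f G H. f holomorphic_on \<bbbD> \<Longrightarrow> case_prod G \<in> borel_measurable (radial_measure g \<Otimes>\<^sub>M borel) \<Longrightarrow>
       (\<And>r y. G r (y + 2 * pi) = G r y) \<Longrightarrow>
       (\<And>r \<theta> u. 0 < r \<Longrightarrow> r < 1 \<Longrightarrow> 1 - r \<le> u \<Longrightarrow> u \<le> pi \<Longrightarrow>
          (\<integral>\<^sup>+y\<in>ball \<theta> u. ennreal (cmod (f (of_real r * cis y)) powr (min a 1 / 4 * p)) \<partial>lborel)
            \<le> (\<integral>\<^sup>+y\<in>ball \<theta> (2 * u). G r y powe (min a 1 / 4) \<partial>lborel)) \<Longrightarrow>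
       (\<And>r \<theta>. 0 < r \<Longrightarrow> r < 1 \<Longrightarrow> H r \<theta> \<le> ennreal c * nt_max f ((3 + r) / 4) \<theta> powe p) \<Longrightarrow>
       (\<integral>\<^sup>+\<theta>\<in>{0..2 * pi}. (\<integral>\<^sup>+r. H r \<theta> \<partial>radial_measure g) powe a \<partial>lborel)
         \<le> ennreal C * (\<integral>\<^sup>+\<theta>\<in>{0..2 * pi}. (\<integral>\<^sup>+r. G r \<theta> \<partial>radial_measure g) powe a \<partial>lborel)"
proof -
  let ?S = "radial_measure g"
  define \<tau> where "\<tau> = min a 1 / 4"
  have \<tau>: "0 < \<tau>" using a by (simp add: \<tau>_def)
  interpret S: finite_measure ?S by (rule finite_measure_radial_measure[OF d])
  obtain C1 :: real where C1: "0 < C1"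
    "\<And>\<Phi> :: real \<Rightarrow> ennreal. mono \<Phi> \<Longrightarrow> (\<integral>\<^sup>+r. \<Phi> ((3 + r) / 4) \<partial>?S) \<le> ennreal C1 * (\<integral>\<^sup>+r. \<Phi> r \<partial>?S)"
    by (rule doubling_shift2_obtain[OF d dbl]) blast
  obtain C2 :: real where C2: "0 < C2"
    "\<And>G B W. case_prod G \<in> borel_measurable (?S \<Otimes>\<^sub>M borel) \<Longrightarrow> B \<in> sets borel \<Longrightarrow>
       emeasure lborel B < top \<Longrightarrow> W \<in> sets borel \<Longrightarrow> emeasure lborel W < top \<Longrightarrow>
       (\<And>r y. y \<notin> W \<Longrightarrow> G r y = 0) \<Longrightarrow>
       (\<integral>\<^sup>+x\<in>B. (\<integral>\<^sup>+r. max_pow (min a 1 / 4) (G r) x \<partial>?S) powe a \<partial>lborel)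
         \<le> ennreal C2 * (\<integral>\<^sup>+x. (\<integral>\<^sup>+r. G r x \<partial>?S) powe a \<partial>lborel)"
    by (rule vector_maximal_inequality_obtain[OF S.sigma_finite_measure_axioms a]) blast
  define k where "k = c * C1 * 36864 powr (1 / \<tau>)"
  have k: "0 < k" using c C1 by (simp add: k_def)
  define C where "C = k powr a * C2 * 3"
  show ?thesis
  proof (rule that[of C])
    show "0 < C" using k C2 by (simp add: C_def)
    fix f G H
    assume hol: "f holomorphic_on \<bbbD>" and Gm [measurable]: "case_prod G \<in> borel_measurable (?S \<Otimes>\<^sub>M borel)"
      and per: "\<And>r y. G r (y + 2 * pi) = G r y"
      and avg: "\<And>r \<theta> u. 0 < r \<Longrightarrow> r < 1 \<Longrightarrow> 1 - r \<le> u \<Longrightarrow> u \<le> pi \<Longrightarrow>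
          (\<integral>\<^sup>+y\<in>ball \<theta> u. ennreal (cmod (f (of_real r * cis y)) powr (min a 1 / 4 * p)) \<partial>lborel)
            \<le> (\<integral>\<^sup>+y\<in>ball \<theta> (2 * u). G r y powe (min a 1 / 4) \<partial>lborel)"
      and H: "\<And>r \<theta>. 0 < r \<Longrightarrow> r < 1 \<Longrightarrow> H r \<theta> \<le> ennreal c * nt_max f ((3 + r) / 4) \<theta> powe p"
    \<comment> \<open>Contains every \<open>ball \<theta> (2 * u)\<close> with \<theta> in
      \<open>{0..2 * pi}\<close> and u \<le> pi.\<close>
    define W where "W = {- 2 * pi..<4 * pi}"
    have [measurable]: "W \<in> sets borel" by (simp add: W_def)
    define GW where "GW r y = G r y * indicator W y" for r y
    have GWm [measurable]: "case_prod GW \<in> borel_measurable (?S \<Otimes>\<^sub>M borel)"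
      unfolding GW_def by measurable
    have mp [measurable]: "(\<lambda>(r, x). max_pow \<tau> (GW r) x) \<in> borel_measurable (?S \<Otimes>\<^sub>M borel)"
      by (rule max_pow_measurable_param[OF GWm])
    have mp1: "(\<lambda>r. max_pow \<tau> (GW r) \<theta>) \<in> borel_measurable ?S" for \<theta>
      using measurable_compose[OF measurable_Pair2'[of \<theta>] mp] by simp
    have pt: "(\<integral>\<^sup>+r. H r \<theta> \<partial>?S) \<le> ennreal k * (\<integral>\<^sup>+r. max_pow \<tau> (GW r) \<theta> \<partial>?S)"
      if \<theta>: "\<theta> \<in> {0..2 * pi}" for \<theta>
    proof -
      define \<Phi> where "\<Phi> \<rho> = nt_max f \<rho> \<theta> powe p" for \<rho>
      have \<Phi>: "mono \<Phi>" unfolding \<Phi>_def using p by (intro monoI powe_mono nt_max_mono) auto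
      note [measurable] = borel_measurable_mono_ennreal[OF \<Phi>]
      have nt: "\<Phi> r \<le> ennreal (36864 powr (1 / \<tau>)) * max_pow \<tau> (GW r) \<theta>" if r: "0 < r \<and> r < 1" for r
        unfolding \<Phi>_def
      proof (rule nt_max_le_max_pow[OF hol])
        fix u assume u: "1 - r \<le> u" "u \<le> pi"
        have "y \<in> W" if "y \<in> ball \<theta> (2 * u)" for y
          using that u \<theta> by (auto simp: W_def dist_real_def)
        then have "(\<integral>\<^sup>+y\<in>ball \<theta> (2 * u). G r y powe \<tau> \<partial>lborel) = (\<integral>\<^sup>+y\<in>ball \<theta> (2 * u). GW r y powe \<tau> \<partial>lborel)"
          by (intro nn_integral_cong) (auto simp: GW_def simp del: mem_ball split: split_indicator)
        with avg[of r u \<theta>] r u show "(\<integral>\<^sup>+y\<in>ball \<theta> u. ennreal (cmod (f (of_real r * cis y)) powr (\<tau> * p)) \<partial>lborel)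
         \<le> (\<integral>\<^sup>+y\<in>ball \<theta> (2 * u). GW r y powe \<tau> \<partial>lborel)"
          unfolding \<tau>_def by simp
      qed (use r p \<tau> in auto)
      have "(\<integral>\<^sup>+r. H r \<theta> \<partial>?S) \<le> (\<integral>\<^sup>+r. ennreal c * \<Phi> ((3 + r) / 4) \<partial>?S)"
        unfolding \<Phi>_def by (rule nn_integral_mono_AE, rule eventually_mono[OF AE_radial_measure[OF d]]) (use H in auto)
      also have "\<dots> = ennreal c * (\<integral>\<^sup>+r. \<Phi> ((3 + r) / 4) \<partial>?S)"
        by (intro nn_integral_cmult) measurable
      also have "\<dots> \<le> ennreal c * (ennreal C1 * (\<integral>\<^sup>+r. \<Phi> r \<partial>?S))"
        by (intro mult_left_mono C1(2) \<Phi>) auto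
      also have "(\<integral>\<^sup>+r. \<Phi> r \<partial>?S) \<le> (\<integral>\<^sup>+r. ennreal (36864 powr (1 / \<tau>)) * max_pow \<tau> (GW r) \<theta> \<partial>?S)"
        by (rule nn_integral_mono_AE, rule eventually_mono[OF AE_radial_measure[OF d]]) (rule nt)
      also have "\<dots> = ennreal (36864 powr (1 / \<tau>)) * (\<integral>\<^sup>+r. max_pow \<tau> (GW r) \<theta> \<partial>?S)"
        by (intro nn_integral_cmult mp1)
      finally show ?thesis
        using c C1 by (simp add: k_def ennreal_mult mult.assoc mult_left_mono)
    qed
    define U where "U x = (\<integral>\<^sup>+r. G r x \<partial>?S)" for x
    have [measurable]: "U \<in> borel_measurable borel" unfolding U_def by measurable
    have "(\<integral>\<^sup>+\<theta>\<in>{0..2 * pi}. (\<integral>\<^sup>+r. H r \<theta> \<partial>?S) powe a \<partial>lborel)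
      \<le> (\<integral>\<^sup>+\<theta>. ennreal (k powr a) * ((\<integral>\<^sup>+r. max_pow \<tau> (GW r) \<theta> \<partial>?S) powe a * indicator {0..2 * pi} \<theta>) \<partial>lborel)"
    proof (intro nn_integral_mono)
      fix \<theta>
      show "(\<integral>\<^sup>+r. H r \<theta> \<partial>?S) powe a * indicator {0..2 * pi} \<theta>
        \<le> ennreal (k powr a) * ((\<integral>\<^sup>+r. max_pow \<tau> (GW r) \<theta> \<partial>?S) powe a * indicator {0..2 * pi} \<theta>)"
      proof (cases "\<theta> \<in> {0..2 * pi}")
        case True
        have "(\<integral>\<^sup>+r. H r \<theta> \<partial>?S) powe a \<le> (ennreal k * (\<integral>\<^sup>+r. max_pow \<tau> (GW r) \<theta> \<partial>?S)) powe a"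
          using a by (intro powe_mono pt True) auto
        also have "\<dots> = ennreal (k powr a) * (\<integral>\<^sup>+r. max_pow \<tau> (GW r) \<theta> \<partial>?S) powe a"
          using a k by (simp add: powe_mult powe_ennreal)
        finally show ?thesis using True by simp
      qed simp
    qed
    also have "\<dots> = ennreal (k powr a) * (\<integral>\<^sup>+\<theta>\<in>{0..2 * pi}. (\<integral>\<^sup>+r. max_pow \<tau> (GW r) \<theta> \<partial>?S) powe a \<partial>lborel)"
      by (intro nn_integral_cmult) measurable
    also have "\<dots> \<le> ennreal (k powr a) * (ennreal C2 * (\<integral>\<^sup>+x. (\<integral>\<^sup>+r. GW r x \<partial>?S) powe a \<partial>lborel))"
      unfolding \<tau>_def by (intro mult_left_mono C2(2)[of GW _ W]) (auto simp: GW_def W_def)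
    also have "(\<integral>\<^sup>+x. (\<integral>\<^sup>+r. GW r x \<partial>?S) powe a \<partial>lborel) = (\<integral>\<^sup>+x\<in>{- 2 * pi..<4 * pi}. U x powe a \<partial>lborel)"
      unfolding GW_def W_def U_def by (intro nn_integral_cong) (auto split: split_indicator)
    also have "\<dots> \<le> 3 * (\<integral>\<^sup>+x\<in>{0..2 * pi}. U x powe a \<partial>lborel)"
      by (rule nn_integral_three_periods) (auto simp: U_def per)
    finally have "(\<integral>\<^sup>+\<theta>\<in>{0..2 * pi}. (\<integral>\<^sup>+r. H r \<theta> \<partial>?S) powe a \<partial>lborel)
      \<le> ennreal (k powr a) * (ennreal C2 * (3 * (\<integral>\<^sup>+x\<in>{0..2 * pi}. U x powe a \<partial>lborel)))"
      by (auto simp: mult_left_mono)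
    also have "\<dots> = ennreal (k powr a) * ennreal C2 * ennreal 3 * (\<integral>\<^sup>+x\<in>{0..2 * pi}. U x powe a \<partial>lborel)"
      by (simp add: mult.assoc)
    also have "ennreal (k powr a) * ennreal C2 * ennreal 3 = ennreal C"
    proof -
      have "ennreal C = ennreal (k powr a * C2) * ennreal 3"
        unfolding C_def using C2(1) by (intro ennreal_mult) auto
      also have "ennreal (k powr a * C2) = ennreal (k powr a) * ennreal C2"
        using C2(1) by (intro ennreal_mult) auto
      finally show ?thesis by simp
    qed
    finally show "(\<integral>\<^sup>+\<theta>\<in>{0..2 * pi}. (\<integral>\<^sup>+r. H r \<theta> \<partial>?S) powe a \<partial>lborel)
      \<le> ennreal C * (\<integral>\<^sup>+\<theta>\<in>{0..2 * pi}. (\<integral>\<^sup>+r. G r \<theta> \<partial>?S) powe a \<partial>lborel)"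
      by (simp add: U_def)
  qed
qed

section \<open>The two norms in polar coordinates\<close>

text \<open>Outside the disc the values of a function are cut off, which makes it Borel.\<close>

definition modp :: "real \<Rightarrow> (complex \<Rightarrow> complex) \<Rightarrow> complex \<Rightarrow> ennreal" where
  "modp p F z = ennreal (cmod (indicator \<bbbD> z *\<^sub>R F z) powr p)"

text \<open>The divisor is 1 - r and not the arc length 2 (1 - r): it is the factor 1 / (1 - |z|) of
  the tent norm. The true mean is half of this.\<close>

definition arc_mean :: "real \<Rightarrow> (complex \<Rightarrow> complex) \<Rightarrow> real \<Rightarrow> real \<Rightarrow> ennreal" where
  "arc_mean p F r \<theta> = ennreal (1 / (1 - r)) * (\<integral>\<^sup>+t\<in>ball \<theta> (1 - r). modp p F (of_real r * cis t) \<partial>lborel)"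

lemma modp_eq: "cmod z < 1 \<Longrightarrow> modp p F z = ennreal (cmod (F z) powr p)"
  by (simp add: modp_def)

lemma modp_measurable [measurable]:
  assumes "continuous_on \<bbbD> F"
  shows "modp p F \<in> borel_measurable borel"
proof -
  have [measurable]: "(\<lambda>z. indicator \<bbbD> z *\<^sub>R F z) \<in> borel_measurable borel"
    using assms by (intro borel_measurable_continuous_on_indicator) auto
  show ?thesis unfolding modp_def by measurable
qed

lemma modp_periodic: "modp p F (of_real r * cis (y + 2 * pi)) = modp p F (of_real r * cis y)"
  by (simp flip: cis_mult)

lemma arc_mean_measurable:
  assumes F: "continuous_on \<bbbD> F"
  shows "case_prod (arc_mean p F) \<in> borel_measurable (radial_measure g \<Otimes>\<^sub>M borel)"
proof -
  note [measurable] = modp_measurable[OF F]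
  show ?thesis unfolding arc_mean_def indicator_def mem_ball by measurable
qed

lemma arc_mean_periodic:
  assumes F: "continuous_on \<bbbD> F"
  shows "arc_mean p F r (y + 2 * pi) = arc_mean p F r y"
proof -
  note [measurable] = modp_measurable[OF F]
  have "(\<integral>\<^sup>+t\<in>ball (y + 2 * pi) (1 - r). modp p F (of_real r * cis t) \<partial>lborel)
    = (\<integral>\<^sup>+t. modp p F (of_real r * cis (t + 2 * pi)) * indicator (ball (y + 2 * pi) (1 - r)) (t + 2 * pi) \<partial>lborel)"
    by (rule nn_integral_shift[symmetric]) measurable
  also have "\<dots> = (\<integral>\<^sup>+t\<in>ball y (1 - r). modp p F (of_real r * cis t) \<partial>lborel)"
    unfolding modp_periodic by (intro nn_integral_cong) (auto simp: dist_real_def split: split_indicator)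
  finally show ?thesis by (simp add: arc_mean_def)
qed

lemma L_norm_eq:
  assumes d: "radial_density \<omega> g" and F: "continuous_on \<bbbD> F"
  shows "L_norm p q \<omega> F = (ennreal (1 / (2 * pi)) *
    (\<integral>\<^sup>+\<theta>\<in>{0..2 * pi}. (\<integral>\<^sup>+r. modp p F (of_real r * cis \<theta>) \<partial>radial_measure g) powe (q / p) \<partial>lborel)) powe (1 / q)"
proof -
  have "(\<integral>\<^sup>+r\<in>{0..<1}. ennreal (cmod (F (of_real r * cis \<theta>)) powr p * \<omega> (of_real r) * r) \<partial>lebesgue)
     = (\<integral>\<^sup>+r. modp p F (of_real r * cis \<theta>) \<partial>radial_measure g)" for \<theta>
  proof -
    have [measurable]: "(\<lambda>z. indicator \<bbbD> z *\<^sub>R F z) \<in> borel_measurable borel"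
      using F by (intro borel_measurable_continuous_on_indicator) auto
    define h where "h r = cmod (indicator \<bbbD> (of_real r * cis \<theta>) *\<^sub>R F (of_real r * cis \<theta>)) powr p" for r
    have hm: "h \<in> borel_measurable borel"
    proof -
      have "(\<lambda>r. indicator \<bbbD> (of_real r * cis \<theta>) *\<^sub>R F (of_real r * cis \<theta>)) \<in> borel_measurable borel"
        by (rule measurable_compose[of "\<lambda>r. of_real r * cis \<theta>" borel borel]) measurable
      then show ?thesis unfolding h_def by measurable
    qed
    have "(\<integral>\<^sup>+r\<in>{0..<1}. ennreal (cmod (F (of_real r * cis \<theta>)) powr p * \<omega> (of_real r) * r) \<partial>lebesgue)
       = (\<integral>\<^sup>+r\<in>{0..<1}. ennreal (h r * \<omega> (of_real r) * r) \<partial>lebesgue)"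
      by (intro nn_integral_cong) (auto simp: h_def norm_mult split: split_indicator)
    also have "\<dots> = (\<integral>\<^sup>+r. ennreal (h r) \<partial>radial_measure g)"
      by (rule nn_integral_weight_radial[OF d hm]) (simp add: h_def)
    finally show ?thesis by (simp add: h_def modp_def)
  qed
  then show ?thesis unfolding L_norm_def by (simp add: nn_integral_completion)
qed

lemma T_norm_eq:
  assumes d: "radial_density \<omega> g" and F: "continuous_on \<bbbD> F" and pq: "0 < p" "0 < q"
  shows "T_norm p q \<omega> F = (ennreal ((1 / pi) powr (q / p)) *
    (\<integral>\<^sup>+\<theta>\<in>{0..2 * pi}. (\<integral>\<^sup>+r. arc_mean p F r \<theta> \<partial>radial_measure g) powe (q / p) \<partial>lborel)) powe (1 / q)"
proof -
  interpret S: finite_measure "radial_measure g" by (rule finite_measure_radial_measure[OF d])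
  note [measurable] = modp_measurable[OF F] arc_mean_measurable[OF F]
  have "(\<integral>\<^sup>+z\<in>Gamma_region (cis \<theta>). ennreal (cmod (F z) powr p * \<omega> z / (1 - cmod z)) \<partial>lebesgue)
     = (\<integral>\<^sup>+r. arc_mean p F r \<theta> \<partial>radial_measure g)" for \<theta>
    unfolding arc_mean_def
    by (rule nn_integral_weight_Gamma_region[OF d, of "modp p F" "\<lambda>z. cmod (F z) powr p"]) (auto simp: modp_eq)
  then have "T_norm p q \<omega> F = (\<integral>\<^sup>+\<theta>\<in>{0..2 * pi}. (ennreal (1 / pi) * (\<integral>\<^sup>+r. arc_mean p F r \<theta> \<partial>radial_measure g)) powe (q / p) \<partial>lborel) powe (1 / q)"
    unfolding T_norm_def by (simp add: nn_integral_completion)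
  also have "(\<integral>\<^sup>+\<theta>\<in>{0..2 * pi}. (ennreal (1 / pi) * (\<integral>\<^sup>+r. arc_mean p F r \<theta> \<partial>radial_measure g)) powe (q / p) \<partial>lborel)
    = (\<integral>\<^sup>+\<theta>. ennreal ((1 / pi) powr (q / p)) * ((\<integral>\<^sup>+r. arc_mean p F r \<theta> \<partial>radial_measure g) powe (q / p) * indicator {0..2 * pi} \<theta>) \<partial>lborel)"
    using pq by (simp add: powe_mult powe_ennreal mult.assoc)
  also have "\<dots> = ennreal ((1 / pi) powr (q / p)) * (\<integral>\<^sup>+\<theta>\<in>{0..2 * pi}. (\<integral>\<^sup>+r. arc_mean p F r \<theta> \<partial>radial_measure g) powe (q / p) \<partial>lborel)"
    by (intro nn_integral_cmult) measurable
  finally show ?thesis .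
qed

lemma continuous_on_weighted_deriv:
  assumes "f holomorphic_on \<bbbD>"
  shows "continuous_on \<bbbD> (weighted_deriv n f)"
  unfolding weighted_deriv_def
  by (intro continuous_intros holomorphic_on_imp_continuous_on holomorphic_higher_deriv assms) auto

lemma modp_weighted_deriv_le:
  assumes hol: "f holomorphic_on \<bbbD>" and r: "0 < r" "r < 1" and t: "\<bar>t - \<theta>\<bar> \<le> 1 - r" and p: "0 < p"
  shows "modp p (weighted_deriv n f) (of_real r * cis t)
    \<le> ennreal ((fact n * 2 ^ n) powr p) * nt_max f ((3 + r) / 4) \<theta> powe p"
proof -
  have "modp p (weighted_deriv n f) (of_real r * cis t)
     = ennreal (cmod ((deriv ^^ n) f (of_real r * cis t)) * (1 - r) ^ n) powe p"
    using r by (simp add: modp_eq norm_mult weighted_deriv_def powe_ennreal norm_power del: of_real_power of_real_diff)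
  also have "\<dots> \<le> (ennreal (fact n * 2 ^ n) * nt_max f ((3 + r) / 4) \<theta>) powe p"
    using r p t by (intro powe_mono weighted_deriv_le_nt_max[OF hol]) auto
  also have "\<dots> = ennreal ((fact n * 2 ^ n) powr p) * nt_max f ((3 + r) / 4) \<theta> powe p"
    using p by (simp add: powe_mult powe_ennreal)
  finally show ?thesis .
qed

text \<open>All points of the arc are within 1 - r of \<theta>, so the maximal function at the
  single angle \<theta> bounds the whole mean; the 2 is the arc length over the divisor.\<close>

lemma arc_mean_weighted_deriv_le:
  assumes hol: "f holomorphic_on \<bbbD>" and r: "0 < r" "r < 1" and p: "0 < p"
  shows "arc_mean p (weighted_deriv n f) r \<theta>
    \<le> ennreal (2 * (fact n * 2 ^ n) powr p) * nt_max f ((3 + r) / 4) \<theta> powe p"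
proof -
  define Y where "Y = ennreal ((fact n * 2 ^ n) powr p) * nt_max f ((3 + r) / 4) \<theta> powe p"
  have "arc_mean p (weighted_deriv n f) r \<theta> \<le> ennreal (1 / (1 - r)) * (\<integral>\<^sup>+t\<in>ball \<theta> (1 - r). Y \<partial>lborel)"
    unfolding arc_mean_def Y_def
  proof (intro mult_left_mono nn_integral_mono)
    fix t
    show "modp p (weighted_deriv n f) (of_real r * cis t) * indicator (ball \<theta> (1 - r)) t
      \<le> ennreal ((fact n * 2 ^ n) powr p) * nt_max f ((3 + r) / 4) \<theta> powe p * indicator (ball \<theta> (1 - r)) t"
    proof (cases "t \<in> ball \<theta> (1 - r)")
      case True
      then have "\<bar>t - \<theta>\<bar> \<le> 1 - r" by (auto simp: dist_real_def)
      from modp_weighted_deriv_le[OF hol r this p] True show ?thesis by simp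
    qed simp
  qed auto
  also have "\<dots> = ennreal (1 / (1 - r)) * ennreal (2 * (1 - r)) * Y"
    using r by (subst nn_integral_cmult_indicator) (auto simp: emeasure_ball_real mult_ac)
  also have "ennreal (1 / (1 - r)) * ennreal (2 * (1 - r)) = 2"
  proof -
    have "ennreal (1 / (1 - r)) * ennreal (2 * (1 - r)) = ennreal (1 / (1 - r) * (2 * (1 - r)))"
      using r by (intro ennreal_mult[symmetric]) auto
    also have "1 / (1 - r) * (2 * (1 - r)) = 2" using r by (simp add: field_simps)
    finally show ?thesis by simp
  qed
  finally show ?thesis
    by (simp add: Y_def ennreal_mult mult.assoc)
qed

text \<open>For the radial norm no averaging is involved; the larger arc only matches the form that
  arc means require.\<close>

lemma modp_average:
  assumes hol: "f holomorphic_on \<bbbD>" and r: "0 < r" "r < 1" and u: "0 \<le> u"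
  shows "(\<integral>\<^sup>+y\<in>ball \<theta> u. ennreal (cmod (f (of_real r * cis y)) powr (\<tau> * p)) \<partial>lborel)
    \<le> (\<integral>\<^sup>+y\<in>ball \<theta> (2 * u). modp p f (of_real r * cis y) powe \<tau> \<partial>lborel)"
  using r u by (intro nn_integral_mono)
    (auto simp: modp_eq norm_mult powe_ennreal powr_powr mult.commute split: split_indicator)

text \<open>By Jensen's inequality the power of the mean over the window of radius \<open>1 - r\<close> dominates the
  mean of the power; averaging over all windows that meet the arc then recovers the arc.\<close>

lemma arc_mean_average:
  assumes hol: "f holomorphic_on \<bbbD>" and r: "0 < r" "r < 1" and u: "1 - r \<le> u" and t: "0 < \<tau>" "\<tau> < 1"
  shows "(\<integral>\<^sup>+y\<in>ball \<theta> u. ennreal (cmod (f (of_real r * cis y)) powr (\<tau> * p)) \<partial>lborel)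
    \<le> (\<integral>\<^sup>+y\<in>ball \<theta> (2 * u). arc_mean p f r y powe \<tau> \<partial>lborel)"
proof -
  note [measurable] = modp_measurable[OF holomorphic_on_imp_continuous_on[OF hol]]
  define \<delta> where "\<delta> = 1 - r"
  have \<delta>: "0 < \<delta>" "\<delta> \<le> u" using r u by (auto simp: \<delta>_def)
  define k where "k y = modp p f (of_real r * cis y)" for y
  have [measurable]: "k \<in> borel_measurable borel" unfolding k_def by measurable
  have kt: "ennreal (cmod (f (of_real r * cis y)) powr (\<tau> * p)) = k y powe \<tau>" for y
    using r by (simp add: k_def modp_eq norm_mult powe_ennreal powr_powr mult.commute)
  have jensen: "ennreal (1 / (2 * \<delta>)) * (\<integral>\<^sup>+t\<in>ball y \<delta>. k t powe \<tau> \<partial>lborel) \<le> arc_mean p f r y powe \<tau>" for y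
  proof -
    let ?B = "indicator (ball y \<delta>) :: real \<Rightarrow> ennreal"
    have "(\<integral>\<^sup>+t\<in>ball y \<delta>. k t powe \<tau> \<partial>lborel) = (\<integral>\<^sup>+t. (k t * ?B t) powe \<tau> * ?B t powe (1 - \<tau>) \<partial>lborel)"
      by (intro nn_integral_cong) (auto split: split_indicator)
    also have "\<dots> \<le> (\<integral>\<^sup>+t. k t * ?B t \<partial>lborel) powe \<tau> * (\<integral>\<^sup>+t. ?B t \<partial>lborel) powe (1 - \<tau>)"
      using t by (intro nn_integral_Hoelder) auto
    also have "(\<integral>\<^sup>+t. ?B t \<partial>lborel) = ennreal (2 * \<delta>)"
      using \<delta> by (simp add: emeasure_ball_real)
    finally have "ennreal (1 / (2 * \<delta>)) * (\<integral>\<^sup>+t\<in>ball y \<delta>. k t powe \<tau> \<partial>lborel)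
      \<le> ennreal (1 / (2 * \<delta>)) * ((\<integral>\<^sup>+t. k t * ?B t \<partial>lborel) powe \<tau> * ennreal (2 * \<delta>) powe (1 - \<tau>))"
      by (rule mult_left_mono) simp
    also have "\<dots> = ennreal (1 / (2 * \<delta>) * (2 * \<delta>) powr (1 - \<tau>)) * (\<integral>\<^sup>+t. k t * ?B t \<partial>lborel) powe \<tau>"
    proof -
      have "ennreal (2 * \<delta>) powe (1 - \<tau>) = ennreal ((2 * \<delta>) powr (1 - \<tau>))"
        using \<delta> by (intro powe_ennreal) simp
      moreover have "ennreal (1 / (2 * \<delta>) * (2 * \<delta>) powr (1 - \<tau>)) = ennreal (1 / (2 * \<delta>)) * ennreal ((2 * \<delta>) powr (1 - \<tau>))"
        using \<delta> by (intro ennreal_mult) auto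
      ultimately show ?thesis by (simp only: mult_ac)
    qed
    also have "1 / (2 * \<delta>) * (2 * \<delta>) powr (1 - \<tau>) = (1 / (2 * \<delta>)) powr \<tau>"
      using \<delta> by (simp add: powr_diff powr_divide)
    \<comment> \<open>A factor 2^\<tau> is given away, because \<open>arc_mean\<close> divides by
      \<delta> and not by 2 \<delta>.\<close>
    also have "ennreal ((1 / (2 * \<delta>)) powr \<tau>) * (\<integral>\<^sup>+t. k t * ?B t \<partial>lborel) powe \<tau>
      \<le> ennreal ((1 / \<delta>) powr \<tau>) * (\<integral>\<^sup>+t. k t * ?B t \<partial>lborel) powe \<tau>"
      using \<delta> t by (intro mult_right_mono ennreal_leI powr_mono2) (auto simp: field_simps)
    also have "\<dots> = arc_mean p f r y powe \<tau>"
      using t \<delta> by (simp add: arc_mean_def k_def \<delta>_def powe_mult powe_ennreal)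
    finally show ?thesis .
  qed
  \<comment> \<open>Each t lies in \<open>ball y \<delta>\<close> for a set of centres y of measure
    2 \<delta>, and for t in the arc these centres stay in the doubled arc because \<delta> \<le>
    u.\<close>
  have "(\<integral>\<^sup>+y\<in>ball \<theta> u. k y powe \<tau> \<partial>lborel)
    \<le> (\<integral>\<^sup>+t. \<integral>\<^sup>+y. ennreal (1 / (2 * \<delta>)) * (k t powe \<tau> * indicator (ball y \<delta>) t) * indicator (ball \<theta> (2 * u)) y \<partial>lborel \<partial>lborel)"
  proof (intro nn_integral_mono)
    fix t
    show "k t powe \<tau> * indicator (ball \<theta> u) t
      \<le> (\<integral>\<^sup>+y. ennreal (1 / (2 * \<delta>)) * (k t powe \<tau> * indicator (ball y \<delta>) t) * indicator (ball \<theta> (2 * u)) y \<partial>lborel)"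
    proof (cases "t \<in> ball \<theta> u")
      case True
      have "k t powe \<tau> = ennreal (1 / (2 * \<delta>)) * k t powe \<tau> * ennreal (2 * \<delta>)"
        using \<delta> by (simp add: mult.assoc mult.commute[of _ "ennreal (2 * \<delta>)"] flip: ennreal_mult mult.assoc)
      also have "\<dots> = (\<integral>\<^sup>+y. ennreal (1 / (2 * \<delta>)) * k t powe \<tau> * indicator (ball t \<delta>) y \<partial>lborel)"
        using \<delta> by (subst nn_integral_cmult_indicator) (auto simp: emeasure_ball_real)
      also have "\<dots> \<le> (\<integral>\<^sup>+y. ennreal (1 / (2 * \<delta>)) * (k t powe \<tau> * indicator (ball y \<delta>) t) * indicator (ball \<theta> (2 * u)) y \<partial>lborel)"
      proof (intro nn_integral_mono)
        fix y
        show "ennreal (1 / (2 * \<delta>)) * k t powe \<tau> * indicator (ball t \<delta>) y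
          \<le> ennreal (1 / (2 * \<delta>)) * (k t powe \<tau> * indicator (ball y \<delta>) t) * indicator (ball \<theta> (2 * u)) y"
        proof (cases "y \<in> ball t \<delta>")
          case y: True
          then have "t \<in> ball y \<delta>" by (simp add: dist_commute)
          moreover have "y \<in> ball \<theta> (2 * u)"
            using y True \<delta> dist_triangle[of \<theta> y t] by simp
          ultimately show ?thesis using y by (simp del: mem_ball)
        qed (simp del: mem_ball)
      qed
      finally show ?thesis using True by (simp del: mem_ball)
    qed simp
  qed
  also have "\<dots> = (\<integral>\<^sup>+y. \<integral>\<^sup>+t. ennreal (1 / (2 * \<delta>)) * (k t powe \<tau> * indicator (ball y \<delta>) t) * indicator (ball \<theta> (2 * u)) y \<partial>lborel \<partial>lborel)"
    unfolding indicator_def mem_ball by (rule lborel_pair.Fubini') measurable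
  also have "\<dots> = (\<integral>\<^sup>+y\<in>ball \<theta> (2 * u). ennreal (1 / (2 * \<delta>)) * (\<integral>\<^sup>+t\<in>ball y \<delta>. k t powe \<tau> \<partial>lborel) \<partial>lborel)"
    by (simp add: nn_integral_cmult nn_integral_multc)
  also have "\<dots> \<le> (\<integral>\<^sup>+y\<in>ball \<theta> (2 * u). arc_mean p f r y powe \<tau> \<partial>lborel)"
    by (intro nn_integral_mono mult_right_mono jensen) auto
  finally show ?thesis unfolding kt .
qed

section \<open>Sufficiency of the doubling condition\<close>

text \<open>Covers both norms: \<open>nrm\<close> is the norm and \<open>G F r \<theta>\<close> the mean of \<open>|F|\<^sup>p\<close> that it
  integrates in \<open>r\<close> first.\<close>

lemma littlewood_paley_of_mean:
  fixes G :: "(complex \<Rightarrow> complex) \<Rightarrow> real \<Rightarrow> real \<Rightarrow> ennreal" and nrm :: "(complex \<Rightarrow> complex) \<Rightarrow> ennreal"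
  assumes d: "radial_density \<omega> g" and pos: "\<forall>z\<in>\<bbbD>. weight_hat \<omega> z > 0" and dbl: "doubling (radial_measure g)"
    and pq: "0 < p" "0 < q" and c0: "0 < c0" and c1: "0 < c1"
    and nrm: "\<And>F. continuous_on \<bbbD> F \<Longrightarrow> nrm F = (ennreal c0 *
      (\<integral>\<^sup>+\<theta>\<in>{0..2 * pi}. (\<integral>\<^sup>+r. G F r \<theta> \<partial>radial_measure g) powe (q / p) \<partial>lborel)) powe (1 / q)"
    and meas: "\<And>F. continuous_on \<bbbD> F \<Longrightarrow> case_prod (G F) \<in> borel_measurable (radial_measure g \<Otimes>\<^sub>M borel)"
    and per: "\<And>F r y. continuous_on \<bbbD> F \<Longrightarrow> G F r (y + 2 * pi) = G F r y"
    and avg: "\<And>f r \<theta> u. f holomorphic_on \<bbbD> \<Longrightarrow> 0 < r \<Longrightarrow> r < 1 \<Longrightarrow> 1 - r \<le> u \<Longrightarrow>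
      (\<integral>\<^sup>+y\<in>ball \<theta> u. ennreal (cmod (f (of_real r * cis y)) powr (min (q / p) 1 / 4 * p)) \<partial>lborel)
        \<le> (\<integral>\<^sup>+y\<in>ball \<theta> (2 * u). G f r y powe (min (q / p) 1 / 4) \<partial>lborel)"
    and der: "\<And>f r \<theta>. f holomorphic_on \<bbbD> \<Longrightarrow> 0 < r \<Longrightarrow> r < 1 \<Longrightarrow>
      G (weighted_deriv n f) r \<theta> \<le> ennreal c1 * nt_max f ((3 + r) / 4) \<theta> powe p"
  shows "\<exists>C::real. C > 0 \<and> (\<forall>f. f holomorphic_on \<bbbD> \<longrightarrow>
     nrm (weighted_deriv n f) + ennreal (\<Sum>j<n. cmod ((deriv ^^ j) f 0)) \<le> ennreal C * nrm f)"
proof -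
  let ?S = "radial_measure g"
  interpret S: finite_measure ?S by (rule finite_measure_radial_measure[OF d])
  define a where "a = q / p"
  have a: "0 < a" using pq by (simp add: a_def)
  \<comment> \<open>One constant dominates the bound for the derivative and those for all
    |f^(j)(0)|, so the same C serves every term.\<close>
  define c where "c = c1 + (\<Sum>j<n. (fact j * 2 ^ j) powr p)"
  have c: "0 < c" "c1 \<le> c" using c1 by (auto simp: c_def intro!: add_pos_nonneg sum_nonneg)
  have cj: "(fact j * 2 ^ j) powr p \<le> c" if "j < n" for j
    using c1 that member_le_sum[of j "{..<n}" "\<lambda>j. (fact j * 2 ^ j) powr p"] by (simp add: c_def)
  define m0 where "m0 = measure ?S UNIV"
  have m0: "0 < m0" "emeasure ?S UNIV = ennreal m0"
  proof -
    have "0 < emeasure ?S {0<..}" by (rule emeasure_radial_measure_tail_pos[OF d pos]) simp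
    also have "\<dots> \<le> emeasure ?S UNIV" by (rule emeasure_mono) auto
    finally show "0 < m0" by (simp add: m0_def S.emeasure_eq_measure)
  qed (simp add: m0_def S.emeasure_eq_measure)
  define mixed where "mixed K = (\<integral>\<^sup>+\<theta>\<in>{0..2 * pi}. (\<integral>\<^sup>+r. K r \<theta> \<partial>?S) powe a \<partial>lborel)" for K :: "real \<Rightarrow> real \<Rightarrow> ennreal"
  obtain C :: real where C: "0 < C"
    and bound: "\<And>f G H. f holomorphic_on \<bbbD> \<Longrightarrow> case_prod G \<in> borel_measurable (?S \<Otimes>\<^sub>M borel) \<Longrightarrow>
       (\<And>r y. G r (y + 2 * pi) = G r y) \<Longrightarrow>
       (\<And>r \<theta> u. 0 < r \<Longrightarrow> r < 1 \<Longrightarrow> 1 - r \<le> u \<Longrightarrow> u \<le> pi \<Longrightarrow>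
          (\<integral>\<^sup>+y\<in>ball \<theta> u. ennreal (cmod (f (of_real r * cis y)) powr (min a 1 / 4 * p)) \<partial>lborel)
            \<le> (\<integral>\<^sup>+y\<in>ball \<theta> (2 * u). G r y powe (min a 1 / 4) \<partial>lborel)) \<Longrightarrow>
       (\<And>r \<theta>. 0 < r \<Longrightarrow> r < 1 \<Longrightarrow> H r \<theta> \<le> ennreal c * nt_max f ((3 + r) / 4) \<theta> powe p) \<Longrightarrow>
       mixed H \<le> ennreal C * mixed G"
    unfolding mixed_def by (rule mixed_norm_bound_obtain[OF d dbl a pq(1) c(1)]) blast
  define D1 where "D1 = C powr (1 / q)"
  \<comment> \<open>Obtained by solving X^q m0^a 2 pi \<le> C \<open>mixed (G f)\<close> for X and
    expressing \<open>mixed (G f)\<close> through \<open>nrm f\<close>.\<close>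
  define D2 where "D2 = (C / (m0 powr a * (2 * pi) * c0)) powr (1 / q)"
  define E where "E = D1 + n * D2"
  have D: "0 < D1" "0 < D2" using C m0 c0 by (auto simp: D1_def D2_def)
  have "0 < E" using D by (simp add: E_def add_pos_nonneg)
  moreover have "nrm (weighted_deriv n f) + ennreal (\<Sum>j<n. cmod ((deriv ^^ j) f 0)) \<le> ennreal E * nrm f"
    if f: "f holomorphic_on \<bbbD>" for f
  proof -
    have cf: "continuous_on \<bbbD> f" by (rule holomorphic_on_imp_continuous_on[OF f])
    have bnd: "mixed H \<le> ennreal C * mixed (G f)"
      if "\<And>r \<theta>. 0 < r \<Longrightarrow> r < 1 \<Longrightarrow> H r \<theta> \<le> ennreal c * nt_max f ((3 + r) / 4) \<theta> powe p" for H
      by (rule bound[OF f meas[OF cf] per[OF cf] _ that]) (use avg[OF f] in \<open>simp_all add: a_def\<close>)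
    have nf: "nrm f = (ennreal c0 * mixed (G f)) powe (1 / q)"
      by (simp add: nrm[OF cf] mixed_def a_def)
    have "mixed (G (weighted_deriv n f)) \<le> ennreal C * mixed (G f)"
    proof (rule bnd)
      fix r \<theta> :: real assume r: "0 < r" "r < 1"
      have "G (weighted_deriv n f) r \<theta> \<le> ennreal c1 * nt_max f ((3 + r) / 4) \<theta> powe p"
        by (rule der[OF f r])
      also have "\<dots> \<le> ennreal c * nt_max f ((3 + r) / 4) \<theta> powe p"
        using c by (intro mult_right_mono ennreal_leI) auto
      finally show "G (weighted_deriv n f) r \<theta> \<le> \<dots>" .
    qed
    then have "nrm (weighted_deriv n f) \<le> (ennreal c0 * (ennreal C * mixed (G f))) powe (1 / q)"
      unfolding nrm[OF continuous_on_weighted_deriv[OF f]] a_def[symmetric] mixed_def[symmetric]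
      using pq by (intro powe_mono mult_left_mono) auto
    also have "\<dots> = (ennreal C * (ennreal c0 * mixed (G f))) powe (1 / q)"
      by (simp add: mult_ac)
    also have "\<dots> = ennreal D1 * nrm f"
      using C pq by (simp add: nf D1_def powe_mult powe_ennreal)
    finally have part1: "nrm (weighted_deriv n f) \<le> ennreal D1 * nrm f" .
    have part2: "ennreal (cmod ((deriv ^^ j) f 0)) \<le> ennreal D2 * nrm f" if j: "j < n" for j
    proof -
      define X where "X = cmod ((deriv ^^ j) f 0)"
      have X: "0 \<le> X" by (simp add: X_def)
      \<comment> \<open>The derivative at 0 is dominated by the maximal function at every angle and
        every truncation radius from 3/4 on, so it may enter as a constant integrand.\<close>
      have "mixed (\<lambda>r \<theta>. ennreal X powe p) \<le> ennreal C * mixed (G f)"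
      proof (rule bnd)
        fix r \<theta> :: real assume r: "0 < r" "r < 1"
        have "ennreal X \<le> ennreal (fact j * 2 ^ j) * nt_max f (3 / 4) \<theta>"
          using weighted_deriv_le_nt_max[OF f, of 0 \<theta> \<theta> j] by (simp add: X_def)
        also have "\<dots> \<le> ennreal (fact j * 2 ^ j) * nt_max f ((3 + r) / 4) \<theta>"
          using r by (intro mult_left_mono nt_max_mono) auto
        finally have "ennreal X powe p \<le> (ennreal (fact j * 2 ^ j) * nt_max f ((3 + r) / 4) \<theta>) powe p"
          using pq by (intro powe_mono) auto
        also have "\<dots> = ennreal ((fact j * 2 ^ j) powr p) * nt_max f ((3 + r) / 4) \<theta> powe p"
          using pq by (simp add: powe_mult powe_ennreal)
        also have "\<dots> \<le> ennreal c * nt_max f ((3 + r) / 4) \<theta> powe p"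
          using cj[OF j] by (intro mult_right_mono ennreal_leI) auto
        finally show "ennreal X powe p \<le> \<dots>" .
      qed
      moreover have "mixed (\<lambda>r \<theta>. ennreal X powe p) = ennreal (X powr q * (m0 powr a * (2 * pi)))"
      proof -
        have "(\<integral>\<^sup>+r. ennreal X powe p \<partial>?S) powe a = ennreal ((X powr p * m0) powr a)"
          using X m0 by (simp add: powe_ennreal flip: ennreal_mult)
        also have "(X powr p * m0) powr a = X powr q * m0 powr a"
          using X m0 pq by (simp add: powr_mult powr_powr a_def)
        finally have "mixed (\<lambda>r \<theta>. ennreal X powe p) = ennreal (X powr q * m0 powr a) * ennreal (2 * pi)"
          unfolding mixed_def by (simp add: nn_integral_cmult_indicator)
        then show ?thesis by (simp add: mult.assoc flip: ennreal_mult)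
      qed
      ultimately have le: "ennreal (X powr q * (m0 powr a * (2 * pi))) \<le> ennreal C * mixed (G f)" by simp
      define b where "b = 1 / (m0 powr a * (2 * pi))"
      have b: "0 < b" using m0 by (simp add: b_def)
      have "ennreal (X powr q) = ennreal b * ennreal (X powr q * (m0 powr a * (2 * pi)))"
        using m0 by (simp add: b_def flip: ennreal_mult)
      also have "\<dots> \<le> ennreal b * (ennreal C * mixed (G f))"
        by (intro mult_left_mono le) auto
      also have "\<dots> = ennreal (C / (m0 powr a * (2 * pi) * c0)) * (ennreal c0 * mixed (G f))"
      proof -
        have "b * C = C / (m0 powr a * (2 * pi) * c0) * c0" using c0 by (simp add: b_def)
        then have "ennreal b * ennreal C = ennreal (C / (m0 powr a * (2 * pi) * c0)) * ennreal c0"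
          using b C c0 by (simp flip: ennreal_mult)
        then show ?thesis by (simp add: mult.assoc[symmetric])
      qed
      finally have "ennreal (X powr q) powe (1 / q)
        \<le> (ennreal (C / (m0 powr a * (2 * pi) * c0)) * (ennreal c0 * mixed (G f))) powe (1 / q)"
        using pq by (intro powe_mono) auto
      then show ?thesis
        using pq X C c0 by (simp add: powe_ennreal powr_powr powe_mult nf D2_def X_def)
    qed
    have "ennreal (\<Sum>j<n. cmod ((deriv ^^ j) f 0)) = (\<Sum>j<n. ennreal (cmod ((deriv ^^ j) f 0)))"
      by (rule sum_ennreal[symmetric]) simp
    also have "\<dots> \<le> (\<Sum>j<n. ennreal D2 * nrm f)" by (intro sum_mono part2) auto
    also have "\<dots> = ennreal (n * D2) * nrm f"
      using D by (simp add: ennreal_mult ennreal_of_nat_eq_real_of_nat mult.assoc)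
    finally have "nrm (weighted_deriv n f) + ennreal (\<Sum>j<n. cmod ((deriv ^^ j) f 0))
      \<le> ennreal D1 * nrm f + ennreal (n * D2) * nrm f"
      by (intro add_mono part1)
    also have "\<dots> = ennreal E * nrm f"
      using D by (simp add: E_def ennreal_plus distrib_right)
    finally show ?thesis .
  qed
  ultimately show ?thesis by blast
qed

lemma L_norm_littlewood_paley:
  assumes d: "radial_density \<omega> g" and pos: "\<forall>z\<in>\<bbbD>. weight_hat \<omega> z > 0" and D: "\<omega> \<in> D_hat"
    and pq: "0 < p" "0 < q"
  shows "\<exists>C::real. C > 0 \<and> (\<forall>f. f holomorphic_on \<bbbD> \<longrightarrow>
     L_norm p q \<omega> (weighted_deriv n f) + ennreal (\<Sum>j<n. cmod ((deriv ^^ j) f 0)) \<le> ennreal C * L_norm p q \<omega> f)"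
proof (rule littlewood_paley_of_mean[OF d pos D_hat_imp_doubling[OF d pos D] pq,
      of "1 / (2 * pi)" "(fact n * 2 ^ n) powr p" "L_norm p q \<omega>" "\<lambda>F r \<theta>. modp p F (of_real r * cis \<theta>)"])
  show "L_norm p q \<omega> F = (ennreal (1 / (2 * pi)) *
      (\<integral>\<^sup>+\<theta>\<in>{0..2 * pi}. (\<integral>\<^sup>+r. modp p F (of_real r * cis \<theta>) \<partial>radial_measure g) powe (q / p) \<partial>lborel)) powe (1 / q)"
    if "continuous_on \<bbbD> F" for F
    by (rule L_norm_eq[OF d that])
  show "(\<lambda>(r, \<theta>). modp p F (of_real r * cis \<theta>)) \<in> borel_measurable (radial_measure g \<Otimes>\<^sub>M borel)"
    if "continuous_on \<bbbD> F" for F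
  proof -
    note [measurable] = modp_measurable[OF that]
    show ?thesis by measurable
  qed
  show "modp p (weighted_deriv n f) (of_real r * cis \<theta>) \<le> ennreal ((fact n * 2 ^ n) powr p) * nt_max f ((3 + r) / 4) \<theta> powe p"
    if "f holomorphic_on \<bbbD>" "0 < r" "r < 1" for f r \<theta>
    using that pq by (intro modp_weighted_deriv_le) auto
  show "(\<integral>\<^sup>+y\<in>ball \<theta> u. ennreal (cmod (f (of_real r * cis y)) powr (min (q / p) 1 / 4 * p)) \<partial>lborel)
        \<le> (\<integral>\<^sup>+y\<in>ball \<theta> (2 * u). modp p f (of_real r * cis y) powe (min (q / p) 1 / 4) \<partial>lborel)"
    if "f holomorphic_on \<bbbD>" "0 < r" "r < 1" "1 - r \<le> u" for f r \<theta> u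
    using that by (intro modp_average) auto
qed (auto simp: modp_periodic)

lemma T_norm_littlewood_paley:
  assumes d: "radial_density \<omega> g" and pos: "\<forall>z\<in>\<bbbD>. weight_hat \<omega> z > 0" and D: "\<omega> \<in> D_hat"
    and pq: "0 < p" "0 < q"
  shows "\<exists>C::real. C > 0 \<and> (\<forall>f. f holomorphic_on \<bbbD> \<longrightarrow>
     T_norm p q \<omega> (weighted_deriv n f) + ennreal (\<Sum>j<n. cmod ((deriv ^^ j) f 0)) \<le> ennreal C * T_norm p q \<omega> f)"
proof (rule littlewood_paley_of_mean[OF d pos D_hat_imp_doubling[OF d pos D] pq,
      of "(1 / pi) powr (q / p)" "2 * (fact n * 2 ^ n) powr p" "T_norm p q \<omega>" "arc_mean p"])
  show "T_norm p q \<omega> F = (ennreal ((1 / pi) powr (q / p)) *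
      (\<integral>\<^sup>+\<theta>\<in>{0..2 * pi}. (\<integral>\<^sup>+r. arc_mean p F r \<theta> \<partial>radial_measure g) powe (q / p) \<partial>lborel)) powe (1 / q)"
    if "continuous_on \<bbbD> F" for F
    by (rule T_norm_eq[OF d that pq])
  show "arc_mean p (weighted_deriv n f) r \<theta> \<le> ennreal (2 * (fact n * 2 ^ n) powr p) * nt_max f ((3 + r) / 4) \<theta> powe p"
    if "f holomorphic_on \<bbbD>" "0 < r" "r < 1" for f r \<theta>
    using that pq by (intro arc_mean_weighted_deriv_le) auto
  show "(\<integral>\<^sup>+y\<in>ball \<theta> u. ennreal (cmod (f (of_real r * cis y)) powr (min (q / p) 1 / 4 * p)) \<partial>lborel)
        \<le> (\<integral>\<^sup>+y\<in>ball \<theta> (2 * u). arc_mean p f r y powe (min (q / p) 1 / 4) \<partial>lborel)"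
    if "f holomorphic_on \<bbbD>" "0 < r" "r < 1" "1 - r \<le> u" for f r \<theta> u
    using that pq by (intro arc_mean_average) auto
qed (auto intro: arc_mean_measurable arc_mean_periodic)

section \<open>Necessity of the doubling condition\<close>

lemma modp_radial:
  assumes "0 < r" "r < 1" "\<And>t. cmod (F (of_real r * cis t)) = \<phi> r"
  shows "modp p F (of_real r * cis t) = ennreal (\<phi> r powr p)"
  using assms by (simp add: modp_eq norm_mult)

text \<open>For radial |F| the inner integral does not depend on \<theta>, so the power q / p and
  the outer root combine to 1 / p and q disappears.\<close>

lemma L_norm_radial:
  assumes d: "radial_density \<omega> g" and F: "continuous_on \<bbbD> F" and pq: "0 < p" "0 < q"
    and rad: "\<And>r t. 0 < r \<Longrightarrow> r < 1 \<Longrightarrow> cmod (F (of_real r * cis t)) = \<phi> r"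
  shows "L_norm p q \<omega> F = (\<integral>\<^sup>+r. ennreal (\<phi> r powr p) \<partial>radial_measure g) powe (1 / p)"
proof -
  define I where "I = (\<integral>\<^sup>+r. ennreal (\<phi> r powr p) \<partial>radial_measure g)"
  have "(\<integral>\<^sup>+r. modp p F (of_real r * cis \<theta>) \<partial>radial_measure g) = I" for \<theta>
    unfolding I_def
    by (rule nn_integral_cong_AE, rule eventually_mono[OF AE_radial_measure[OF d]]) (use rad in \<open>auto intro: modp_radial\<close>)
  then have "L_norm p q \<omega> F = (ennreal (1 / (2 * pi)) * (I powe (q / p) * ennreal (2 * pi))) powe (1 / q)"
    unfolding L_norm_eq[OF d F] by (simp add: nn_integral_cmult_indicator)
  also have "ennreal (1 / (2 * pi)) * (I powe (q / p) * ennreal (2 * pi)) = ennreal (1 / (2 * pi) * (2 * pi)) * I powe (q / p)"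
    by (subst ennreal_mult) (auto simp: mult_ac)
  also have "\<dots> powe (1 / q) = I powe (1 / p)"
    using pq by (simp add: powe_powe)
  finally show ?thesis by (simp add: I_def)
qed

text \<open>As for the other norm, up to a factor independent of F, which cancels when two such
  norms are compared.\<close>

lemma T_norm_radial:
  assumes d: "radial_density \<omega> g" and F: "continuous_on \<bbbD> F" and pq: "0 < p" "0 < q"
    and rad: "\<And>r t. 0 < r \<Longrightarrow> r < 1 \<Longrightarrow> cmod (F (of_real r * cis t)) = \<phi> r"
    and \<phi>: "\<phi> \<in> borel_measurable borel"
  shows "T_norm p q \<omega> F = ennreal (((1 / pi) powr (q / p) * 2 powr (q / p) * (2 * pi)) powr (1 / q)) *
    (\<integral>\<^sup>+r. ennreal (\<phi> r powr p) \<partial>radial_measure g) powe (1 / p)"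
proof -
  define I where "I = (\<integral>\<^sup>+r. ennreal (\<phi> r powr p) \<partial>radial_measure g)"
  have "arc_mean p F r \<theta> = 2 * ennreal (\<phi> r powr p)" if r: "0 < r \<and> r < 1" for r \<theta>
  proof -
    have "arc_mean p F r \<theta> = ennreal (1 / (1 - r)) * (\<integral>\<^sup>+t\<in>ball \<theta> (1 - r). ennreal (\<phi> r powr p) \<partial>lborel)"
      using r rad by (simp add: arc_mean_def modp_radial[where \<phi> = \<phi>])
    also have "\<dots> = ennreal (1 / (1 - r)) * ennreal (2 * (1 - r)) * ennreal (\<phi> r powr p)"
      using r by (subst nn_integral_cmult_indicator) (auto simp: emeasure_ball_real mult_ac)
    also have "ennreal (1 / (1 - r)) * ennreal (2 * (1 - r)) = 2"
    proof -
      have "ennreal (1 / (1 - r)) * ennreal (2 * (1 - r)) = ennreal (1 / (1 - r) * (2 * (1 - r)))"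
        using r by (intro ennreal_mult[symmetric]) auto
      also have "1 / (1 - r) * (2 * (1 - r)) = 2" using r by (simp add: field_simps)
      finally show ?thesis by simp
    qed
    finally show ?thesis .
  qed
  then have "(\<integral>\<^sup>+r. arc_mean p F r \<theta> \<partial>radial_measure g) = (\<integral>\<^sup>+r. 2 * ennreal (\<phi> r powr p) \<partial>radial_measure g)" for \<theta>
    by (intro nn_integral_cong_AE eventually_mono[OF AE_radial_measure[OF d]]) auto
  then have int: "(\<integral>\<^sup>+r. arc_mean p F r \<theta> \<partial>radial_measure g) = 2 * I" for \<theta>
    using \<phi> unfolding I_def by (simp add: nn_integral_cmult)
  have "T_norm p q \<omega> F = (ennreal ((1 / pi) powr (q / p)) * ((2 * I) powe (q / p) * ennreal (2 * pi))) powe (1 / q)"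
    unfolding T_norm_eq[OF d F pq] int by (simp add: nn_integral_cmult_indicator)
  also have "(2 * I) powe (q / p) = ennreal (2 powr (q / p)) * I powe (q / p)"
    using pq powe_ennreal[of 2 "q / p"] by (simp add: powe_mult)
  also have "ennreal ((1 / pi) powr (q / p)) * (ennreal (2 powr (q / p)) * I powe (q / p) * ennreal (2 * pi))
     = (ennreal ((1 / pi) powr (q / p)) * ennreal (2 powr (q / p)) * ennreal (2 * pi)) * I powe (q / p)"
    by (simp only: mult_ac)
  also have "ennreal ((1 / pi) powr (q / p)) * ennreal (2 powr (q / p)) * ennreal (2 * pi)
     = ennreal ((1 / pi) powr (q / p) * 2 powr (q / p) * (2 * pi))"
    by (simp only: ennreal_mult powr_ge_zero mult_nonneg_nonneg pi_ge_zero zero_le_numeral)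
  also have "(ennreal ((1 / pi) powr (q / p) * 2 powr (q / p) * (2 * pi)) * I powe (q / p)) powe (1 / q)
     = ennreal (((1 / pi) powr (q / p) * 2 powr (q / p) * (2 * pi)) powr (1 / q)) * I powe (1 / p)"
    using pq by (simp add: powe_mult powe_powe powe_ennreal)
  finally show ?thesis by (simp add: I_def)
qed

lemma power_le_pochhammer: "0 < k \<Longrightarrow> real k ^ n \<le> pochhammer (real k) n"
proof (induction n)
  case (Suc n)
  have "real k ^ n * real k \<le> pochhammer (real k) n * (real k + real n)"
    by (intro mult_mono Suc pochhammer_nonneg) (use Suc.prems in auto)
  then show ?case by (simp add: pochhammer_Suc mult.commute)
qed simp

text \<open>The rising factorial from m - n + 1 is m! / (m - n)!. For m < n natural subtraction lets
  it start at 0, so that it vanishes together with the derivative.\<close>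

definition monomial_deriv_modulus :: "nat \<Rightarrow> nat \<Rightarrow> real \<Rightarrow> real" where
  "monomial_deriv_modulus n m r = \<bar>pochhammer (real (Suc m - n)) n * r ^ (m - n) * (1 - r) ^ n\<bar>"

lemma cmod_weighted_deriv_monomial:
  assumes r: "0 < r" "r < 1"
  shows "cmod (weighted_deriv n (\<lambda>z. z ^ m) (of_real r * cis t)) = monomial_deriv_modulus n m r"
proof -
  have "(deriv ^^ n) (\<lambda>w. w ^ m) z = pochhammer (of_nat (Suc m - n)) n * z ^ (m - n)" for z :: complex
    using higher_deriv_power[of n 0 m z] by simp
  moreover have "cmod (pochhammer (of_nat (Suc m - n)) n) = \<bar>pochhammer (real (Suc m - n)) n\<bar>"
    by (metis norm_of_real pochhammer_of_real of_real_of_nat_eq)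
  ultimately show ?thesis
    using r by (simp add: weighted_deriv_def monomial_deriv_modulus_def norm_mult norm_power abs_mult
        power_abs del: of_real_power of_real_diff)
qed

text \<open>For m \<ge> 2 n each of the n factors produced by differentiation is at least m / 2, and
  lowering the exponent of r only increases the value.\<close>

lemma monomial_deriv_modulus_ge:
  assumes r: "0 < r" "r < 1" and m: "2 * n \<le> m"
  shows "(real m / 2 * (1 - r)) ^ n * r ^ m \<le> monomial_deriv_modulus n m r"
proof -
  have "real m / 2 \<le> real (Suc m - n)" using m by simp
  then have "(real m / 2) ^ n \<le> real (Suc m - n) ^ n" by (intro power_mono) auto
  also have "\<dots> \<le> pochhammer (real (Suc m - n)) n" using m by (intro power_le_pochhammer) simp
  finally have 1: "(real m / 2) ^ n \<le> pochhammer (real (Suc m - n)) n" .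
  have 2: "r ^ m \<le> r ^ (m - n)" using r by (intro power_decreasing) auto
  have "(real m / 2) ^ n * r ^ m * (1 - r) ^ n \<le> pochhammer (real (Suc m - n)) n * r ^ (m - n) * (1 - r) ^ n"
    using r m by (intro mult_right_mono mult_mono 1 2 pochhammer_nonneg) auto
  also have "\<dots> \<le> monomial_deriv_modulus n m r" by (simp add: monomial_deriv_modulus_def)
  finally show ?thesis by (simp add: power_mult_distrib power_divide mult_ac)
qed

text \<open>The weight \<open>(m (1 - r))\<^sup>n\<^sup>p\<close> is large for \<open>1 - r \<ge> K / m\<close>, so the moment of order \<open>m p\<close>
  lives on \<open>1 - r < K / m\<close>; on \<open>1 - r \<le> 4 K / m\<close> the integrand \<open>r\<^sup>m\<^sup>p\<close> is bounded below.\<close>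

lemma tail_bound_of_moments:
  assumes d: "radial_density \<omega> g" and n: "1 \<le> n" and p: "0 < p" and C: "0 < C"
    and mom: "\<And>m. (\<integral>\<^sup>+r. ennreal (monomial_deriv_modulus n m r powr p) \<partial>radial_measure g)
      \<le> ennreal C * (\<integral>\<^sup>+r. ennreal ((r ^ m) powr p) \<partial>radial_measure g)"
  obtains K :: real where "1 \<le> K"
    "\<And>m. 2 * n \<le> m \<Longrightarrow> 8 * K \<le> real m \<Longrightarrow>
       emeasure (radial_measure g) {1 - 4 * K / m..} \<le> ennreal (2 * exp (8 * K * p)) * emeasure (radial_measure g) {1 - K / m<..}"
proof -
  let ?S = "radial_measure g"
  interpret S: finite_measure ?S by (rule finite_measure_radial_measure[OF d])
  \<comment> \<open>Chosen so that (K / 2)^(n p) \<ge> 2 C: for r \<le> 1 - K / m the integrand of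
    the derivative is then at least 2 C times \<open>w r\<close>.\<close>
  define K where "K = max 1 (2 * (2 * C) powr (1 / (n * p)))"
  have K1: "1 \<le> K" by (simp add: K_def)
  have K2: "2 * C \<le> (K / 2) powr (n * p)"
  proof -
    have "2 * C = ((2 * C) powr (1 / (n * p))) powr (n * p)" using C n p by (simp add: powr_powr)
    also have "\<dots> \<le> (K / 2) powr (n * p)" using p by (intro powr_mono2) (auto simp: K_def)
    finally show ?thesis .
  qed
  show ?thesis
  proof (rule that[OF K1])
    fix m :: nat assume m: "2 * n \<le> m" "8 * K \<le> real m"
    have m0: "0 < real m" using m K1 by simp
    define b where "b = 1 - K / m"
    define e where "e = 1 - 4 * K / m"
    have e: "1/2 \<le> e" "e < 1" "e \<le> b"
      using m m0 K1 by (auto simp: e_def b_def field_simps)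
    define w where "w r = ennreal ((r ^ m) powr p)" for r :: real
    have [measurable]: "w \<in> borel_measurable borel" unfolding w_def by measurable
    define I where "I = (\<integral>\<^sup>+r. w r \<partial>?S)"
    define I1 where "I1 = (\<integral>\<^sup>+r. w r * indicator {..b} r \<partial>?S)"
    define I2 where "I2 = (\<integral>\<^sup>+r. w r * indicator {b<..} r \<partial>?S)"
    have w1: "w r \<le> 1" if "0 < r \<and> r < 1" for r
      using that p by (auto simp: w_def intro!: powr_le1 power_le_one)
    have I: "I = I1 + I2"
    proof -
      have "I = (\<integral>\<^sup>+r. w r * indicator {..b} r + w r * indicator {b<..} r \<partial>?S)"
        unfolding I_def by (intro nn_integral_cong) (auto split: split_indicator)
      then show ?thesis unfolding I1_def I2_def by (simp add: nn_integral_add)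
    qed
    have le1: "(\<integral>\<^sup>+r. w r * indicator A r \<partial>?S) \<le> emeasure ?S A" if "A \<in> sets borel" for A
    proof -
      have "(\<integral>\<^sup>+r. w r * indicator A r \<partial>?S) \<le> (\<integral>\<^sup>+r. indicator A r \<partial>?S)"
        by (rule nn_integral_mono_AE, rule eventually_mono[OF AE_radial_measure[OF d]])
          (use w1 in \<open>auto split: split_indicator\<close>)
      then show ?thesis using that by simp
    qed
    \<comment> \<open>Finiteness allows I1 to be cancelled in I1 + I1 \<le> I1 + I2.\<close>
    have I1fin: "I1 < top"
    proof -
      have "I1 \<le> emeasure ?S {..b}" unfolding I1_def by (rule le1) simp
      also have "\<dots> < top" by (simp add: S.emeasure_eq_measure)
      finally show ?thesis .
    qed
    have "ennreal (2 * C) * I1 = (\<integral>\<^sup>+r. ennreal (2 * C) * (w r * indicator {..b} r) \<partial>?S)"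
      unfolding I1_def by (intro nn_integral_cmult[symmetric]) measurable
    also have "\<dots> \<le> (\<integral>\<^sup>+r. ennreal (monomial_deriv_modulus n m r powr p) \<partial>?S)"
    proof (rule nn_integral_mono_AE, rule eventually_mono[OF AE_radial_measure[OF d]])
      fix r :: real assume r: "0 < r \<and> r < 1"
      show "ennreal (2 * C) * (w r * indicator {..b} r) \<le> ennreal (monomial_deriv_modulus n m r powr p)"
      proof (cases "r \<le> b")
        case True
        then have "K / 2 \<le> real m / 2 * (1 - r)" using m0 by (simp add: b_def field_simps)
        then have "(K / 2) powr (n * p) \<le> (real m / 2 * (1 - r)) powr (n * p)"
          using K1 p by (intro powr_mono2) auto
        then have "2 * C * (r ^ m) powr p \<le> (real m / 2 * (1 - r)) powr (n * p) * (r ^ m) powr p"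
          using K2 by (intro mult_right_mono) auto
        also have "\<dots> = ((real m / 2 * (1 - r)) ^ n * r ^ m) powr p"
          using r m0 by (simp add: powr_mult powr_powr flip: powr_realpow)
        also have "\<dots> \<le> monomial_deriv_modulus n m r powr p"
          using r p m0 by (intro powr_mono2 monomial_deriv_modulus_ge m) auto
        finally show ?thesis using C True by (simp add: w_def ennreal_leI flip: ennreal_mult)
      qed simp
    qed
    also have "\<dots> \<le> ennreal C * I" unfolding I_def w_def by (rule mom)
    finally have "ennreal (2 * C) * I1 \<le> ennreal C * (I1 + I2)" unfolding I .
    moreover have "ennreal (2 * C) * I1 = ennreal C * (I1 + I1)"
      using C by (simp add: ennreal_mult mult_ac flip: mult_2)
    ultimately have "I1 + I1 \<le> I1 + I2"
      using C by (simp add: ennreal_mult_le_mult_iff)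
    then have "I1 \<le> I2"
      using I1fin by (auto simp: ennreal_add_left_cancel_le)
    then have "I \<le> I2 + I2" unfolding I by (rule add_right_mono)
    also have "\<dots> = 2 * I2" by (rule mult_2[symmetric])
    also have "\<dots> \<le> 2 * emeasure ?S {b<..}"
      unfolding I2_def by (intro mult_left_mono le1) auto
    finally have up: "I \<le> 2 * emeasure ?S {b<..}" .
    have low: "ennreal (exp (- (8 * K * p))) * emeasure ?S {e..} \<le> I"
    proof -
      have "ennreal (exp (- (8 * K * p))) * emeasure ?S {e..} = (\<integral>\<^sup>+r. ennreal (exp (- (8 * K * p))) * indicator {e..} r \<partial>?S)"
        by (simp add: nn_integral_cmult_indicator)
      also have "\<dots> \<le> I" unfolding I_def
      proof (intro nn_integral_mono)
        fix r
        show "ennreal (exp (- (8 * K * p))) * indicator {e..} r \<le> w r"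
        proof (cases "e \<le> r")
          case True
          \<comment> \<open>For x \<le> 1/2 the bound ln (1 - x) \<ge> - x - 2 x^2 is at least - 2
            x; with x = 4 K / m the power m p then costs exp (- 8 K p).\<close>
          have x: "0 \<le> 4 * K / m" "4 * K / m \<le> 1 / 2" using e K1 m0 by (auto simp: e_def)
          have "2 * (4 * K / m)\<^sup>2 \<le> 4 * K / m"
            using mult_mono[OF x(2) order_refl[of "4 * K / m"]] x by (simp add: power2_eq_square)
          then have "- (2 * (4 * K / m)) \<le> ln e"
            using ln_one_minus_pos_lower_bound[OF x] by (simp add: e_def)
          then have "(m * p) * - (2 * (4 * K / m)) \<le> (m * p) * ln e"
            using p by (intro mult_left_mono) auto
          moreover have "(m * p) * - (2 * (4 * K / m)) = - (8 * K * p)" using m0 by simp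
          ultimately have "- (8 * K * p) \<le> (m * p) * ln e" by linarith
          then have "exp (- (8 * K * p)) \<le> exp ((m * p) * ln e)" by simp
          also have "\<dots> = (e ^ m) powr p"
            using e by (simp add: powr_def ln_realpow mult_ac)
          also have "\<dots> \<le> (r ^ m) powr p"
            using e True p by (intro powr_mono2 power_mono) auto
          finally show ?thesis using True by (simp add: w_def ennreal_leI)
        qed simp
      qed
      finally show ?thesis .
    qed
    have "emeasure ?S {e..} = ennreal (exp (8 * K * p)) * (ennreal (exp (- (8 * K * p))) * emeasure ?S {e..})"
      by (simp flip: mult.assoc ennreal_mult exp_add)
    also have "\<dots> \<le> ennreal (exp (8 * K * p)) * (2 * emeasure ?S {b<..})"
      by (intro mult_left_mono order_trans[OF low up]) auto
    also have "\<dots> = ennreal (2 * exp (8 * K * p)) * emeasure ?S {b<..}"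
      by (simp add: ennreal_mult mult_ac)
    finally show "emeasure ?S {1 - 4 * K / m..} \<le> ennreal (2 * exp (8 * K * p)) * emeasure ?S {1 - K / m<..}"
      by (simp add: e_def b_def)
  qed
qed

text \<open>m is the least integer with 2 K \<le> m (1 - r), and rounding up keeps m (1 - r) \<le> 4
  K. So the tail beyond r lies in the one beyond 1 - 4 K / m, and the tail beyond 1 - K / m lies in
  the one from (1 + r) / 2. The ratio 4 in the tail bound is the doubling times this rounding
  slack.\<close>

lemma D_hat_of_moments:
  assumes rw: "radial_weight \<omega>" and d: "radial_density \<omega> g" and n: "1 \<le> n" and p: "0 < p" and C: "0 < C"
    and mom: "\<And>m. (\<integral>\<^sup>+r. ennreal (monomial_deriv_modulus n m r powr p) \<partial>radial_measure g)
      \<le> ennreal C * (\<integral>\<^sup>+r. ennreal ((r ^ m) powr p) \<partial>radial_measure g)"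
  shows "\<omega> \<in> D_hat"
proof -
  let ?S = "radial_measure g"
  obtain K :: real where K: "1 \<le> K"
    "\<And>m. 2 * n \<le> m \<Longrightarrow> 8 * K \<le> real m \<Longrightarrow>
       emeasure ?S {1 - 4 * K / m..} \<le> ennreal (2 * exp (8 * K * p)) * emeasure ?S {1 - K / m<..}"
    by (rule tail_bound_of_moments[OF d n p C mom]) blast
  define C' where "C' = 4 * exp (8 * K * p)"
  \<comment> \<open>1 - r < 1/4 forces m \<ge> 8 K, and 1 - r < 1 / n forces m \<ge> 2 n.\<close>
  define r0 where "r0 = max (3/4) (1 - 1 / real n)"
  have r0: "r0 < 1" using n by (simp add: r0_def)
  have main: "weight_hat \<omega> (of_real r) \<le> ennreal C' * weight_hat \<omega> (of_real ((1 + r) / 2))" if r: "r0 < r" "r < 1" for r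
  proof -
    have r34: "3/4 < r" and rn: "1 - r < 1 / n" using r by (auto simp: r0_def)
    define m where "m = nat \<lceil>2 * K / (1 - r)\<rceil>"
    have pos: "0 < 1 - r" using r by simp
    have mr: "2 * K / (1 - r) \<le> real m" "real m < 2 * K / (1 - r) + 1"
      using K(1) pos by (auto simp: m_def) linarith+
    have m1: "2 * K \<le> m * (1 - r)" using mr(1) pos by (simp add: divide_le_eq)
    have m2: "m * (1 - r) \<le> 4 * K"
    proof -
      have "m * (1 - r) \<le> (2 * K / (1 - r) + 1) * (1 - r)" using mr(2) pos by (intro mult_right_mono) auto
      also have "\<dots> = 2 * K + (1 - r)" using pos by (simp add: field_simps)
      finally show ?thesis using K(1) r34 by simp
    qed
    have m3: "8 * K \<le> real m"
    proof -
      have "m * (1 - r) \<le> m * (1 / 4)" using r34 by (intro mult_left_mono) auto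
      then show ?thesis using m1 by simp
    qed
    have m4: "2 * n \<le> m"
    proof -
      have "2 * K \<le> m * (1 / n)" using m1 mult_left_mono[OF less_imp_le[OF rn], of "real m"] by linarith
      then have "2 * K * n \<le> m" using n by (simp add: field_simps)
      moreover have "2 * 1 * real n \<le> 2 * K * n" using K(1) by (intro mult_right_mono) auto
      ultimately have "real (2 * n) \<le> real m" by simp
      then show ?thesis by (simp only: of_nat_le_iff)
    qed
    have m0: "0 < real m" using m3 K(1) by simp
    have lower: "1 - 4 * K / m \<le> r" and upper: "(1 + r) / 2 \<le> 1 - K / m"
      using m1 m2 m0 by (auto simp: field_simps)
    have sub: "{1 - K / m<..} \<subseteq> {(1 + r) / 2..}"
    proof
      fix x assume "x \<in> {1 - K / m<..}"
      then have "1 - K / m < x" by simp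
      with upper have "(1 + r) / 2 \<le> x" by linarith
      then show "x \<in> {(1 + r) / 2..}" by (simp only: atLeast_iff)
    qed
    have "weight_hat \<omega> (of_real r) \<le> ennreal (1 / r) * emeasure ?S {r<..}"
      using r34 r by (intro weight_hat_bounds(2)[OF d]) auto
    also have "\<dots> \<le> ennreal 2 * emeasure ?S {1 - 4 * K / m..}"
      using r34 lower by (intro mult_mono ennreal_leI emeasure_mono) (auto simp: divide_le_eq)
    also have "\<dots> \<le> ennreal 2 * (ennreal (2 * exp (8 * K * p)) * emeasure ?S {1 - K / m<..})"
      by (intro mult_left_mono K(2) m3 m4) auto
    also have "\<dots> \<le> ennreal 2 * (ennreal (2 * exp (8 * K * p)) * emeasure ?S {(1 + r) / 2..})"
      by (intro mult_left_mono emeasure_mono[OF sub]) auto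
    also have "\<dots> = ennreal C' * emeasure ?S {(1 + r) / 2..}"
      by (simp add: C'_def ennreal_mult flip: mult.assoc)
    also have "\<dots> \<le> ennreal C' * weight_hat \<omega> (of_real ((1 + r) / 2))"
      using r34 r by (intro mult_left_mono weight_hat_bounds(1)[OF d]) auto
    finally show ?thesis .
  qed
  have "\<forall>\<^sub>F r in at_left 1. weight_hat \<omega> (of_real r) \<le> ennreal C' * weight_hat \<omega> (of_real ((1 + r) / 2))"
    unfolding eventually_at_left[OF r0] using main r0 by blast
  moreover have "C' > 0" by (simp add: C'_def)
  ultimately show ?thesis using rw unfolding D_hat_def by blast
qed

text \<open>The inequality is tested on z^m, and the nonnegative terms at the origin are
  dropped.\<close>

lemma moments_of_L_norm:
  assumes d: "radial_density \<omega> g" and pq: "0 < p" "0 < q" and C: "0 < C"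
    and le: "\<And>f. f holomorphic_on \<bbbD> \<Longrightarrow>
      L_norm p q \<omega> (weighted_deriv n f) + ennreal (\<Sum>j<n. cmod ((deriv ^^ j) f 0)) \<le> ennreal C * L_norm p q \<omega> f"
  shows "(\<integral>\<^sup>+r. ennreal (monomial_deriv_modulus n m r powr p) \<partial>radial_measure g)
      \<le> ennreal (C powr p) * (\<integral>\<^sup>+r. ennreal ((r ^ m) powr p) \<partial>radial_measure g)" (is "?I \<le> _ * ?J")
proof -
  have hol: "(\<lambda>z. z ^ m) holomorphic_on \<bbbD>" by (intro holomorphic_intros)
  have "?I powe (1 / p) = L_norm p q \<omega> (weighted_deriv n (\<lambda>z. z ^ m))"
    by (rule L_norm_radial[symmetric, OF d continuous_on_weighted_deriv[OF hol] pq cmod_weighted_deriv_monomial])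
  also have "\<dots> \<le> ennreal C * L_norm p q \<omega> (\<lambda>z. z ^ m)"
    by (rule order_trans[OF _ le[OF hol]]) simp
  also have "L_norm p q \<omega> (\<lambda>z. z ^ m) = ?J powe (1 / p)"
    by (rule L_norm_radial[OF d holomorphic_on_imp_continuous_on[OF hol] pq]) (simp add: norm_power norm_mult)
  finally have "(?I powe (1 / p)) powe p \<le> (ennreal C * ?J powe (1 / p)) powe p"
    using pq by (intro powe_mono) auto
  then show ?thesis using pq C by (simp add: powe_powe powe_mult powe_ennreal)
qed

text \<open>The same test on z^m; the factor k of the radial formula stands on both sides and is
  cancelled.\<close>

lemma moments_of_T_norm:
  assumes d: "radial_density \<omega> g" and pq: "0 < p" "0 < q" and C: "0 < C"
    and le: "\<And>f. f holomorphic_on \<bbbD> \<Longrightarrow>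
      T_norm p q \<omega> (weighted_deriv n f) + ennreal (\<Sum>j<n. cmod ((deriv ^^ j) f 0)) \<le> ennreal C * T_norm p q \<omega> f"
  shows "(\<integral>\<^sup>+r. ennreal (monomial_deriv_modulus n m r powr p) \<partial>radial_measure g)
      \<le> ennreal (C powr p) * (\<integral>\<^sup>+r. ennreal ((r ^ m) powr p) \<partial>radial_measure g)" (is "?I \<le> _ * ?J")
proof -
  define k where "k = ((1 / pi) powr (q / p) * 2 powr (q / p) * (2 * pi)) powr (1 / q)"
  have k: "0 < k" by (simp add: k_def)
  have hol: "(\<lambda>z. z ^ m) holomorphic_on \<bbbD>" by (intro holomorphic_intros)
  have [measurable]: "monomial_deriv_modulus n m \<in> borel_measurable borel"
    unfolding monomial_deriv_modulus_def by measurable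
  have "ennreal k * ?I powe (1 / p) = T_norm p q \<omega> (weighted_deriv n (\<lambda>z. z ^ m))"
    unfolding k_def
    by (rule T_norm_radial[symmetric, OF d continuous_on_weighted_deriv[OF hol] pq cmod_weighted_deriv_monomial]) auto
  also have "\<dots> \<le> ennreal C * T_norm p q \<omega> (\<lambda>z. z ^ m)"
    by (rule order_trans[OF _ le[OF hol]]) simp
  also have "T_norm p q \<omega> (\<lambda>z. z ^ m) = ennreal k * ?J powe (1 / p)"
    unfolding k_def
    by (rule T_norm_radial[OF d holomorphic_on_imp_continuous_on[OF hol] pq]) (auto simp: norm_power norm_mult)
  finally have "ennreal k * ?I powe (1 / p) \<le> ennreal k * (ennreal C * ?J powe (1 / p))"
    by (simp add: mult.left_commute)
  then have "?I powe (1 / p) \<le> ennreal C * ?J powe (1 / p)"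
    using k by (simp add: ennreal_mult_le_mult_iff)
  then have "(?I powe (1 / p)) powe p \<le> (ennreal C * ?J powe (1 / p)) powe p"
    using pq by (intro powe_mono) auto
  then show ?thesis using pq C by (simp add: powe_powe powe_mult powe_ennreal)
qed

theorem theorem3p2:
  fixes p q :: real and n :: nat and \<omega> :: "complex \<Rightarrow> real"
  assumes "0 < p" and "0 < q" and "1 \<le> n"
    and "radial_weight \<omega>"
    and "\<forall>z\<in>\<bbbD>. weight_hat \<omega> z > 0"
  shows "(\<omega> \<in> D_hat \<longleftrightarrow>
            (\<exists>C::real. C > 0 \<and> (\<forall>f. f holomorphic_on \<bbbD> \<longrightarrow>
               L_norm p q \<omega> (weighted_deriv n f) + ennreal (\<Sum>j<n. cmod ((deriv ^^ j) f 0))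
                 \<le> ennreal C * L_norm p q \<omega> f)))
       \<and> (\<omega> \<in> D_hat \<longleftrightarrow>
            (\<exists>C::real. C > 0 \<and> (\<forall>f. f holomorphic_on \<bbbD> \<longrightarrow>
               T_norm p q \<omega> (weighted_deriv n f) + ennreal (\<Sum>j<n. cmod ((deriv ^^ j) f 0))
                 \<le> ennreal C * T_norm p q \<omega> f)))"
proof -
  obtain g where d: "radial_density \<omega> g"
    using radial_weight_imp_radial_density[OF assms(4)] .
  have L: "\<omega> \<in> D_hat" if "C > 0" "\<forall>f. f holomorphic_on \<bbbD> \<longrightarrow>
      L_norm p q \<omega> (weighted_deriv n f) + ennreal (\<Sum>j<n. cmod ((deriv ^^ j) f 0)) \<le> ennreal C * L_norm p q \<omega> f"
    for C :: real
    using that by (intro D_hat_of_moments[OF assms(4) d assms(3,1), of "C powr p"]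
        moments_of_L_norm[OF d assms(1,2)]) auto
  have T: "\<omega> \<in> D_hat" if "C > 0" "\<forall>f. f holomorphic_on \<bbbD> \<longrightarrow>
      T_norm p q \<omega> (weighted_deriv n f) + ennreal (\<Sum>j<n. cmod ((deriv ^^ j) f 0)) \<le> ennreal C * T_norm p q \<omega> f"
    for C :: real
    using that by (intro D_hat_of_moments[OF assms(4) d assms(3,1), of "C powr p"]
        moments_of_T_norm[OF d assms(1,2)]) auto
  show ?thesis
    using L T L_norm_littlewood_paley[OF d assms(5) _ assms(1,2)] T_norm_littlewood_paley[OF d assms(5) _ assms(1,2)]
    by blast
qed

end
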